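(* Let $\tau\in\mathbb{R}$ with $\tau>-1$. Then $E_{\ast}(\tau)$ is a Salem set and $$\dim_H E_{\ast}(\tau)=\dim_F E_{\ast}(\tau)=\min\{4/(1+\tau),\,2\}.$$
   Context: Identify $\mathbb{R}^2$ with $\mathbb{C}$, so that for $q,x\in\mathbb{R}^2$ the product $qx$ is complex multiplication and $\mathbb{Z}^2$ is the ring of Gaussian integers. For $x\in\mathbb{R}^2$, $|x|=\max(|x_1|,|x_2|)$. Define $$E_{\ast}(\tau)=\{x\in\mathbb{R}^2: |qx-r|\le|q|^{-\tau}\text{ for infinitely many }(q,r)\in\mathbb{Z}^2\times\mathbb{Z}^2\text{ with }q\neq0\}.$$ $\dim_H$ denotes Hausdorff dimension. For $A\subseteq\mathbb{R}^2$, let $\mathcal{P}(A)$ be the set of Borel probability measures with compact support contained in $A$, and with $\widehat{\mu}(\xi)=\int e^{-2\pi i(\xi_1x_1+\xi_2x_2)}d\mu(x)$ define the Fourier dimension $$\dim_F A=\sup\{s\in[0,2]:\ \sup_{0\neq\xi\in\mathbb{R}^2}|\widehat{\mu}(\xi)|^2|\xi|^{s}<\infty\text{ for some }\mu\in\mathcal{P}(A)\}.$$ A set $A$ is a Salem set if $\dim_F A=\dim_H A$. *)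

theory Defs
  imports "HOL-Analysis.Analysis" "HOL-Probability.Probability"
begin

text \<open>R^2 is identified with the complex numbers. Gaussian integers and the max-norm.\<close>

definition gauss_ints :: "complex set" where
  "gauss_ints = {z. Re z \<in> \<int> \<and> Im z \<in> \<int>}"

definition supnorm :: "complex \<Rightarrow> real" where
  "supnorm z = max \<bar>Re z\<bar> \<bar>Im z\<bar>"

definition E_star :: "real \<Rightarrow> complex set" where
  "E_star \<tau> = {x. infinite {(q, r). q \<in> gauss_ints \<and> r \<in> gauss_ints \<and> q \<noteq> 0 \<and>
                     supnorm (q * x - r) \<le> supnorm q powr (- \<tau>)}}"

definition hausdorff_pre :: "real \<Rightarrow> real \<Rightarrow> complex set \<Rightarrow> ennreal" where
  "hausdorff_pre s \<delta> A =
     (INF C \<in> {C :: nat \<Rightarrow> complex set. A \<subseteq> (\<Union>n. C n) \<and>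
                 (\<forall>n. bounded (C n) \<and> diameter (C n) \<le> \<delta>)}.
        (\<Sum>n. ennreal (diameter (C n) powr s)))"

definition hausdorff_measure :: "real \<Rightarrow> complex set \<Rightarrow> ennreal" where
  "hausdorff_measure s A = (SUP \<delta> \<in> {0<..}. hausdorff_pre s \<delta> A)"

definition hausdorff_dim :: "complex set \<Rightarrow> real" where
  "hausdorff_dim A = Inf {s. 0 \<le> s \<and> hausdorff_measure s A = 0}"

definition measure_support :: "complex measure \<Rightarrow> complex set" where
  "measure_support M = {x. \<forall>e>0. emeasure M (ball x e) > 0}"

definition compact_prob_measures :: "complex set \<Rightarrow> complex measure set" where
  "compact_prob_measures A = {M. sets M = sets borel \<and> prob_space M \<and>
       compact (measure_support M) \<and> measure_support M \<subseteq> A}"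

definition fourier_transform :: "complex measure \<Rightarrow> complex \<Rightarrow> complex" where
  "fourier_transform M \<xi> = (LINT x|M. cis (- 2 * pi * (Re \<xi> * Re x + Im \<xi> * Im x)))"

definition fourier_dim :: "complex set \<Rightarrow> real" where
  "fourier_dim A = Sup {s. 0 \<le> s \<and> s \<le> 2 \<and>
      (\<exists>M \<in> compact_prob_measures A. \<exists>C. \<forall>\<xi>. \<xi> \<noteq> 0 \<longrightarrow>
          (cmod (fourier_transform M \<xi>))\<^sup>2 * supnorm \<xi> powr s \<le> C)}"

definition salem_set :: "complex set \<Rightarrow> bool" where
  "salem_set A \<longleftrightarrow> fourier_dim A = hausdorff_dim A"

end

theory Submission
  imports Defs
begin

text \<open>
  The upper bound for the Hausdorff dimension is the usual covering argument. Conversely, a Fourier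
  decay exponent \<open>s\<close> of a measure \<open>\<mu>\<close> bounds the dimension of its support from below: testing \<open>|\<mu>^|\<^sup>2\<close>
  against a Gaussian of width \<open>1/r\<close> gives \<open>\<integral> \<mu>(B(x,r)) d\<mu>(x) \<lesssim> r\<^sup>s\<close>, and the mass distribution
  principle applies on the set where \<open>\<mu>(B(x,r)) \<lesssim> r\<^sup>t\<close>, for any \<open>t < s\<close>.

  It remains to find measures on \<open>E_star \<tau>\<close> with decay exponent close to \<open>4/(1+\<tau>)\<close>, where one may
  assume \<open>\<tau> \<ge> 1\<close>. Following Kaufman, start from a smooth density and multiply it repeatedly by
  averages \<open>F\<^sub>M\<close>, over \<open>M\<^sup>2\<close> denominators \<open>q\<close> of size about \<open>M\<close>, of periodic bumps supported where
  \<open>q x\<close> is within \<open>(2M)\<close>-to-the-\<open>-\<tau>\<close> of the lattice. The coefficient of \<open>F\<^sub>M\<close> at a frequency \<open>k \<noteq> 0\<close> comes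
  only from those \<open>q\<close> whose conjugate divides \<open>k\<close>, so that the divisor bound makes it small, and
  multiplication by \<open>F\<^sub>M\<close> hardly changes the Fourier transform. A weak limit of the resulting measures
  is supported on points with an approximation at every scale.
\<close>

section \<open>Gaussian integers and the upper bound for the Hausdorff dimension\<close>

text \<open>The exponent comes from one balance. For a width \<delta> of order M^(-\<tau>), a
  frequency \<open>k = cnj q * m\<close> with |q| of order M carries a coefficient of size at most
  (\<delta>|m|)^(-b), that is M^((1+\<tau>)b) |k|^(-b) up to constants; averaging over M^2
  denominators gains M^(-2). For b < 2/(1+\<tau>) the total power of M is negative, and squaring the
  transform doubles this threshold to 4/(1+\<tau>). The divisor bound only lowers b to an arbitrary
  a < b. The estimate consumes sums of the transform over translates of the lattice, weighted by 1 +
  |.|, and these sums must survive each multiplication. Hence the demand on the bump: with the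
  weight paid, its coefficients must still be summable in each coordinate, which decay of order
  |t|^(-3) provides. Constants may grow with M, because each M is chosen after the function that its
  kernel multiplies. For \<tau> < 1 the claimed value is 2, which exponents up to the threshold at 1
  already yield inside \<open>E_star \<tau>\<close>. With \<tau> >= 1 the widths are at most 1/2,
  and b <= 1, so that linear decay of the coefficients is enough.\<close>

lemma supnorm_le_cmod: "supnorm z \<le> cmod z"
  by (simp add: supnorm_def abs_Re_le_cmod abs_Im_le_cmod)

lemma cmod_le_2_supnorm: "cmod z \<le> 2 * supnorm z"
  using cmod_le[of z] by (simp add: supnorm_def)

lemma supnorm_nonneg [simp]: "0 \<le> supnorm z"
  by (simp add: supnorm_def)

lemma supnorm_0 [simp]: "supnorm 0 = 0"
  by (simp add: supnorm_def)

lemma supnorm_pos: "z \<noteq> 0 \<Longrightarrow> 0 < supnorm z"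
  by (auto simp: supnorm_def complex_eq_iff)

lemma supnorm_triangle: "supnorm (x + y) \<le> supnorm x + supnorm y"
  unfolding supnorm_def plus_complex.simps
  by (intro max.boundedI order_trans[OF abs_triangle_ineq add_mono]) auto

lemma supnorm_minus_commute: "supnorm (x - y) = supnorm (y - x)"
  by (simp add: supnorm_def abs_minus_commute)

lemma gauss_supnorm_ge_1:
  assumes "z \<in> gauss_ints" "z \<noteq> 0"
  shows "1 \<le> supnorm z"
  using assms Ints_nonzero_abs_ge1[of "Re z"] Ints_nonzero_abs_ge1[of "Im z"]
  by (auto simp: gauss_ints_def supnorm_def complex_eq_iff le_max_iff_disj)

lemma gauss_ints_closed [simp]:
  "0 \<in> gauss_ints" "1 \<in> gauss_ints"
  "x \<in> gauss_ints \<Longrightarrow> y \<in> gauss_ints \<Longrightarrow> x + y \<in> gauss_ints"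
  "x \<in> gauss_ints \<Longrightarrow> y \<in> gauss_ints \<Longrightarrow> x - y \<in> gauss_ints"
  "x \<in> gauss_ints \<Longrightarrow> y \<in> gauss_ints \<Longrightarrow> x * y \<in> gauss_ints"
  "x \<in> gauss_ints \<Longrightarrow> cnj x \<in> gauss_ints"
  by (auto simp: gauss_ints_def)

lemma finite_Ints_bounded: "finite {x \<in> \<int>. \<bar>x\<bar> \<le> (R::real)}"
proof (rule finite_subset)
  show "{x \<in> \<int>. \<bar>x\<bar> \<le> R} \<subseteq> real_of_int ` {-\<lceil>R\<rceil>..\<lceil>R\<rceil>}"
  proof
    fix x assume "x \<in> {x \<in> \<int>. \<bar>x\<bar> \<le> R}"
    then obtain i where "x = of_int i" "\<bar>of_int i\<bar> \<le> R"
      by (auto elim!: Ints_cases)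
    moreover have "\<bar>i\<bar> \<le> \<lceil>R\<rceil>"
      using \<open>\<bar>of_int i\<bar> \<le> R\<close> by linarith
    ultimately show "x \<in> real_of_int ` {-\<lceil>R\<rceil>..\<lceil>R\<rceil>}"
      by (auto intro!: imageI simp: abs_le_iff)
  qed
qed simp

lemma finite_gauss_bounded: "finite {z \<in> gauss_ints. supnorm z \<le> R}"
proof (rule finite_subset)
  show "{z \<in> gauss_ints. supnorm z \<le> R} \<subseteq>
     (\<lambda>(x, y). Complex x y) ` ({x \<in> \<int>. \<bar>x\<bar> \<le> R} \<times> {x \<in> \<int>. \<bar>x\<bar> \<le> R})"
    (is "?L \<subseteq> ?f ` ?R")
  proof
    fix z assume "z \<in> ?L"
    then have "(Re z, Im z) \<in> ?R" by (auto simp: gauss_ints_def supnorm_def)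
    then have "?f (Re z, Im z) \<in> ?f ` ?R" by (rule imageI)
    then show "z \<in> ?f ` ?R" by simp
  qed
qed (auto intro: finite_Ints_bounded)

lemma countable_gauss_ints: "countable gauss_ints"
proof -
  have "gauss_ints \<subseteq> (\<Union>n::nat. {z \<in> gauss_ints. supnorm z \<le> real n})"
  proof
    fix z assume "z \<in> gauss_ints"
    moreover obtain n :: nat where "supnorm z \<le> real n" using real_arch_simple by blast
    ultimately show "z \<in> (\<Union>n::nat. {z \<in> gauss_ints. supnorm z \<le> real n})" by auto
  qed
  moreover have "countable (\<Union>n::nat. {z \<in> gauss_ints. supnorm z \<le> real n})"
    using countable_finite[OF finite_gauss_bounded] by auto
  ultimately show ?thesis by (rule countable_subset)
qed

text \<open>Each half line of integers injects into \<open>nat\<close> through the absolute value,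
  so every index is used at most twice. Integers are reals here, hence the floor, which changes
  nothing.\<close>

lemma Ints_sum_le:
  fixes f :: "nat \<Rightarrow> real"
  assumes "summable f" "\<And>n. 0 \<le> f n" "finite F" "F \<subseteq> \<int>"
  shows "(\<Sum>x\<in>F. f (nat \<lfloor>\<bar>x :: real\<bar>\<rfloor>)) \<le> 2 * suminf f"
proof -
  have half: "(\<Sum>x\<in>G. f (nat \<lfloor>\<bar>x\<bar>\<rfloor>)) \<le> suminf f"
    if "finite G" "G \<subseteq> \<int>" "G \<subseteq> {0..} \<or> G \<subseteq> {..<0::real}" for G
  proof -
    have "inj_on (\<lambda>x. nat \<lfloor>\<bar>x\<bar>\<rfloor>) G"
    proof (rule inj_onI)
      fix x y assume xy: "x \<in> G" "y \<in> G" "nat \<lfloor>\<bar>x\<bar>\<rfloor> = nat \<lfloor>\<bar>y\<bar>\<rfloor>"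
      from xy that obtain i j where "x = of_int i" "y = of_int j"
        by (meson Ints_cases subsetD)
      with xy that show "x = y"
        by (auto simp: subset_iff abs_if split: if_splits)
    qed
    then have "(\<Sum>x\<in>G. f (nat \<lfloor>\<bar>x\<bar>\<rfloor>)) = sum f ((\<lambda>x. nat \<lfloor>\<bar>x\<bar>\<rfloor>) ` G)"
      by (simp add: sum.reindex)
    also have "\<dots> \<le> suminf f"
      using assms that by (intro sum_le_suminf) auto
    finally show ?thesis .
  qed
  have "(\<Sum>x\<in>F. f (nat \<lfloor>\<bar>x\<bar>\<rfloor>)) =
      (\<Sum>x\<in>F \<inter> {0..}. f (nat \<lfloor>\<bar>x\<bar>\<rfloor>)) + (\<Sum>x\<in>F \<inter> {..<0}. f (nat \<lfloor>\<bar>x\<bar>\<rfloor>))"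
    using assms by (subst sum.union_disjoint[symmetric]) (auto intro!: sum.cong)
  also have "\<dots> \<le> suminf f + suminf f"
    using assms by (intro add_mono half) auto
  finally show ?thesis by simp
qed

lemma Ints_powr_sum_bounded:
  assumes "p > 1"
  obtains B :: real where "\<And>F. finite F \<Longrightarrow> F \<subseteq> \<int> \<Longrightarrow> (\<Sum>x\<in>F. (1 + \<bar>x\<bar>) powr (-p)) \<le> B" "0 \<le> B"
proof -
  have "summable (\<lambda>n. real (Suc n) powr (-p))"
    using assms by (subst summable_Suc_iff) (simp add: summable_real_powr_iff)
  then have s: "summable (\<lambda>n. (1 + real n) powr (-p))"
    by (simp add: add.commute)
  have "(\<Sum>x\<in>F. (1 + \<bar>x\<bar>) powr (-p)) \<le> 2 * (\<Sum>n. (1 + real n) powr (-p))"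
    if "finite F" "F \<subseteq> \<int>" for F
  proof -
    have "(\<Sum>x\<in>F. (1 + \<bar>x\<bar>) powr (-p)) = (\<Sum>x\<in>F. (1 + real (nat \<lfloor>\<bar>x\<bar>\<rfloor>)) powr (-p))"
    proof (rule sum.cong)
      fix x assume "x \<in> F"
      then have "x \<in> \<int>" using that by auto
      then obtain i where "x = of_int i" by (auto elim: Ints_cases)
      then show "(1 + \<bar>x\<bar>) powr (-p) = (1 + real (nat \<lfloor>\<bar>x\<bar>\<rfloor>)) powr (-p)" 
        by (simp flip: of_int_abs)
    qed simp
    also have "\<dots> \<le> 2 * (\<Sum>n. (1 + real n) powr (-p))"
      using s that by (intro Ints_sum_le) auto
    finally show ?thesis .
  qed
  moreover have "0 \<le> 2 * (\<Sum>n. (1 + real n) powr (-p))"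
    using s by (simp add: suminf_nonneg)
  ultimately show ?thesis using that by blast
qed

text \<open>A finite set of points lies in the product of its two coordinate projections, and
  nonnegative terms allow the enlargement. Lattice sums in the plane thus reduce to sums over
  integers.\<close>

lemma gauss_sum_prod_le:
  fixes f g :: "real \<Rightarrow> real"
  assumes "finite F" "\<And>x. 0 \<le> f x" "\<And>x. 0 \<le> g x"
  shows "(\<Sum>z\<in>F. f (Re z) * g (Im z)) \<le> (\<Sum>x\<in>Re ` F. f x) * (\<Sum>y\<in>Im ` F. g y)"
proof -
  have "(\<Sum>z\<in>F. f (Re z) * g (Im z)) = (\<Sum>(x, y)\<in>(\<lambda>z. (Re z, Im z)) ` F. f x * g y)"
    by (subst sum.reindex) (auto intro: inj_onI complex_eqI)
  also have "\<dots> \<le> (\<Sum>(x, y)\<in>Re ` F \<times> Im ` F. f x * g y)"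
    using assms by (intro sum_mono2) auto
  also have "\<dots> = (\<Sum>x\<in>Re ` F. f x) * (\<Sum>y\<in>Im ` F. g y)"
    by (simp add: sum_product sum.cartesian_product)
  finally show ?thesis .
qed

text \<open>\<open>supnorm z\<close> dominates both coordinates, so each of them may receive half of
  the exponent, and \<open>p/2 > 1\<close> is the one-dimensional condition.\<close>

lemma gauss_powr_sum_bounded:
  assumes "p > 2"
  obtains B :: real where
    "\<And>F. finite F \<Longrightarrow> F \<subseteq> gauss_ints \<Longrightarrow> (\<Sum>z\<in>F. (1 + supnorm z) powr (-p)) \<le> B" "0 \<le> B"
proof -
  obtain B where B: "\<And>F. finite F \<Longrightarrow> F \<subseteq> \<int> \<Longrightarrow> (\<Sum>x\<in>F. (1 + \<bar>x\<bar>) powr (-(p/2))) \<le> B" "0 \<le> B"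
    using Ints_powr_sum_bounded[of "p/2"] assms by auto
  have "(\<Sum>z\<in>F. (1 + supnorm z) powr (-p)) \<le> B * B"
    if F: "finite F" "F \<subseteq> gauss_ints" for F
  proof -
    have "(\<Sum>z\<in>F. (1 + supnorm z) powr (-p)) \<le>
       (\<Sum>z\<in>F. (1 + \<bar>Re z\<bar>) powr (-(p/2)) * (1 + \<bar>Im z\<bar>) powr (-(p/2)))"
    proof (rule sum_mono)
      fix z
      have "(1 + supnorm z) powr (-p) = (1 + supnorm z) powr (-(p/2)) * (1 + supnorm z) powr (-(p/2))"
        by (simp flip: powr_add)
      also have "\<dots> \<le> (1 + \<bar>Re z\<bar>) powr (-(p/2)) * (1 + \<bar>Im z\<bar>) powr (-(p/2))"
        using assms by (intro mult_mono powr_mono2') (auto simp: supnorm_def)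
      finally show "(1 + supnorm z) powr (-p) \<le> (1 + \<bar>Re z\<bar>) powr (-(p/2)) * (1 + \<bar>Im z\<bar>) powr (-(p/2))" .
    qed
    also have "\<dots> \<le> (\<Sum>x\<in>Re ` F. (1 + \<bar>x\<bar>) powr (-(p/2))) * (\<Sum>y\<in>Im ` F. (1 + \<bar>y\<bar>) powr (-(p/2)))"
      using F by (intro gauss_sum_prod_le) auto
    also have "\<dots> \<le> B * B"
      using F B by (intro mult_mono B sum_nonneg) (auto simp: gauss_ints_def)
    finally show ?thesis .
  qed
  then show ?thesis using that[of "B * B"] B by auto
qed

lemma half_powr_minus:
  fixes y r :: real
  shows "0 \<le> y \<Longrightarrow> (y / 2) powr (-r) = 2 powr r * y powr (-r)"
  by (simp add: powr_divide powr_minus field_simps)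

section \<open>Hausdorff measure of limsup sets\<close>

lemma hausdorff_measure_mono:
  assumes "A \<subseteq> A'"
  shows "hausdorff_measure s A \<le> hausdorff_measure s A'"
  unfolding hausdorff_measure_def hausdorff_pre_def
  using assms by (intro SUP_mono' INF_superset_mono) auto

text \<open>The convergent half of the Borel-Cantelli lemma: in an enumeration of \<open>I\<close>,
  every tail still covers the points that lie in infinitely many \<open>S i\<close>, while its sum
  is arbitrarily small. A common bound on finite sums expresses summability over an unordered index
  set.\<close>

lemma hausdorff_measure_limsup_null:
  fixes S :: "'i \<Rightarrow> complex set"
  assumes s: "0 < s"
    and cnt: "countable I"
    and bdd: "\<And>i. i \<in> I \<Longrightarrow> bounded (S i)"
    and sum: "\<And>F. finite F \<Longrightarrow> F \<subseteq> I \<Longrightarrow> (\<Sum>i\<in>F. diameter (S i) powr s) \<le> B"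
    and sub: "A \<subseteq> {x. infinite {i \<in> I. x \<in> S i}}"
  shows "hausdorff_measure s A = 0"
proof (cases "finite I")
  case True
  then have "A = {}" using sub by auto
  have "hausdorff_pre s \<delta> {} \<le> 0" if "\<delta> > 0" for \<delta>
    unfolding hausdorff_pre_def
    by (rule INF_lower2[of "\<lambda>_. {}"]) (use that s in \<open>auto simp: diameter_empty\<close>)
  then show ?thesis
    unfolding hausdorff_measure_def \<open>A = {}\<close> by (auto intro!: antisym SUP_least)
next
  case False
  define g where "g = from_nat_into I"
  have bij: "bij_betw g UNIV I"
    unfolding g_def using cnt False by (rule bij_betw_from_nat_into)
  have inj: "inj g" and range: "range g = I" using bij by (auto simp: bij_betw_def)
  define d where "d n = diameter (S (g n)) powr s" for n
  have summ: "summable d"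
  proof (rule summableI_nonneg_bounded[of _ B])
    fix n
    have "sum d {..<n} = (\<Sum>i\<in>g ` {..<n}. diameter (S i) powr s)"
      using inj by (subst sum.reindex) (auto simp: d_def inj_on_def)
    also have "\<dots> \<le> B" using range by (intro sum) auto
    finally show "sum d {..<n} \<le> B" .
  qed (simp add: d_def)
  have le: "hausdorff_pre s \<delta> A \<le> ennreal \<epsilon>" if "\<delta> > 0" "\<epsilon> > 0" for \<delta> \<epsilon>
  proof -
    \<comment> \<open>Convergence also makes the single terms small, and as \<open>s > 0\<close>
      this bounds the diameters in the tail by \<delta>.\<close>
    have "eventually (\<lambda>n. d n < \<delta> powr s) sequentially"
      using summable_LIMSEQ_zero[OF summ] that by (intro order_tendstoD(2)) auto
    moreover have "eventually (\<lambda>n. norm (\<Sum>i. d (i + n)) < \<epsilon>) sequentially"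
      using suminf_exist_split[OF that(2) summ] by (auto simp: eventually_sequentially)
    ultimately have "eventually (\<lambda>n. (\<forall>m\<ge>n. d m < \<delta> powr s) \<and> norm (\<Sum>i. d (i + n)) < \<epsilon>) sequentially"
      by (intro eventually_conj) (auto simp: eventually_sequentially intro: order_trans)
    then obtain N where N: "\<forall>m\<ge>N. d m < \<delta> powr s" "norm (\<Sum>i. d (i + N)) < \<epsilon>"
      by (auto simp: eventually_sequentially)
    define C where "C n = S (g (n + N))" for n
    have "A \<subseteq> (\<Union>n. C n)"
    proof
      fix x assume "x \<in> A"
      then have "infinite {i \<in> I. x \<in> S i}" using sub by auto
      moreover have "{i \<in> I. x \<in> S i} = g ` {n. x \<in> S (g n)}" using range by auto
      ultimately have "infinite {n. x \<in> S (g n)}" by auto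
      then obtain n where "n \<ge> N" "x \<in> S (g n)"
        by (auto simp: infinite_nat_iff_unbounded_le)
      then have "x \<in> C (n - N)" by (simp add: C_def)
      then show "x \<in> (\<Union>n. C n)" by auto
    qed
    moreover have "bounded (C n)" "diameter (C n) \<le> \<delta>" for n
    proof -
      show "bounded (C n)" unfolding C_def using bdd range by auto
      have "diameter (C n) powr s < \<delta> powr s" using N(1) by (auto simp: C_def d_def)
      then show "diameter (C n) \<le> \<delta>"
        using s that by (meson less_eq_real_def not_le powr_mono2)
    qed
    ultimately have "hausdorff_pre s \<delta> A \<le> (\<Sum>n. ennreal (diameter (C n) powr s))"
      unfolding hausdorff_pre_def by (intro INF_lower) auto
    also have "\<dots> = (\<Sum>n. ennreal (d (n + N)))" by (simp add: C_def d_def)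
    also have "\<dots> = ennreal (\<Sum>n. d (n + N))"
      using summ unfolding d_def by (intro suminf_ennreal2) (auto intro: summable_ignore_initial_segment[of "\<lambda>n. diameter (S (g n)) powr s"])
    also have "\<dots> \<le> ennreal \<epsilon>" using N(2) by (intro ennreal_leI) auto
    finally show ?thesis .
  qed
  then have "hausdorff_pre s \<delta> A = 0" if "\<delta> > 0" for \<delta>
  proof -
    have "hausdorff_pre s \<delta> A \<le> 0"
      by (rule ennreal_le_epsilon) (simp add: le[OF that])
    then show ?thesis by simp
  qed
  then show ?thesis unfolding hausdorff_measure_def by auto
qed

text \<open>The auxiliary index set \<open>J\<close> is either all nonzero Gaussian integers or the powers of two; in
  the latter case, with \<open>\<tau> = 0\<close>, every point of the plane is covered infinitely often.\<close>
lemma hausdorff_measure_approx_null: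
  assumes tau: "\<tau> > -1"
    and J: "J \<subseteq> gauss_ints - {0}"
    and p: "p \<ge> 0"
    and sumJ: "\<And>F. finite F \<Longrightarrow> F \<subseteq> J \<Longrightarrow> (\<Sum>q\<in>F. supnorm q powr (-p)) \<le> B"
    and s: "s * (1 + \<tau>) > 2 + p"
  shows "hausdorff_measure s {x. infinite {(q, r). q \<in> J \<and> r \<in> gauss_ints \<and>
                     supnorm (q * x - r) \<le> supnorm q powr (- \<tau>)}} = 0"
proof -
  have "0 < s * (1 + \<tau>)" using p s by linarith
  then have s0: "s > 0" using tau by (simp add: zero_less_mult_iff)
  \<comment> \<open>With \<open>X\<close> for the excess \<open>s * (1 + \<tau>) - 2 - p\<close>,
    this is \<open>X / (X + 6)\<close>. It is below 1, so \<open>3 * \<epsilon> + \<epsilon>\<^sup>2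
    \<le> 4 * \<epsilon> \<le> X\<close>, which is \<open>key\<close>.\<close>
  define \<epsilon> where "\<epsilon> = (s * (1 + \<tau>) - 2 - p) / (s * (1 + \<tau>) - p + 4)"
  have den: "s * (1 + \<tau>) - p + 4 > 0" using s by linarith
  have e0: "\<epsilon> > 0" using s den by (simp add: \<epsilon>_def)
  have e1: "\<epsilon> < 1" using s den by (simp add: \<epsilon>_def)
  have "\<epsilon> * (s * (1 + \<tau>) - p + 4) = s * (1 + \<tau>) - 2 - p"
    using den by (simp add: \<epsilon>_def)
  have key: "(1 + \<epsilon>) * (2 + \<epsilon>) - s * (1 + \<tau>) \<le> - p"
  proof -
    define X where "X = s * (1 + \<tau>) - 2 - p"
    have X: "\<epsilon> * (X + 6) = X"
      using \<open>\<epsilon> * (s * (1 + \<tau>) - p + 4) = s * (1 + \<tau>) - 2 - p\<close> unfolding X_def by (simp add: algebra_simps)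
    have "X > 0" using s by (simp add: X_def)
    have "\<epsilon> * 3 + \<epsilon> * \<epsilon> \<le> \<epsilon> * 3 + \<epsilon> * 1" using e0 e1 by (intro add_mono mult_left_mono) auto
    also have "\<dots> \<le> \<epsilon> * (X + 6)"
      using e0 \<open>X > 0\<close> by (simp add: algebra_simps)
    finally have "\<epsilon> * 3 + \<epsilon> * \<epsilon> \<le> X" using X by simp
    then show ?thesis unfolding X_def by (simp add: algebra_simps)
  qed
  obtain B2 where B2: "\<And>F. finite F \<Longrightarrow> F \<subseteq> gauss_ints \<Longrightarrow> (\<Sum>z\<in>F. (1 + supnorm z) powr (-(2+\<epsilon>))) \<le> B2" "0 \<le> B2"
    using gauss_powr_sum_bounded[of "2 + \<epsilon>"] e0 by auto
  \<comment> \<open>For fixed \<open>x\<close> an admissible numerator has size O(|q|), so all but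
    finitely many pairs satisfy this bound on \<open>r\<close>. Letting the range of
    \<open>r\<close> grow like |q|^(1+\<epsilon>) treats the unbounded set in one piece, at the
    price of \<epsilon> in the exponent.\<close>
  define I where "I = {(q, r). q \<in> J \<and> r \<in> gauss_ints \<and> supnorm r \<le> supnorm q powr (1 + \<epsilon>)}"
  define S where "S = (\<lambda>(q, r). {x. supnorm (q * x - r) \<le> supnorm q powr (- \<tau>)})"
  have q1: "supnorm q \<ge> 1" if "q \<in> J" for q
    using gauss_supnorm_ge_1 J that by auto
  have dist: "dist x y \<le> 4 * supnorm q powr (-(1+\<tau>))"
    if "q \<in> J" "x \<in> S (q, r)" "y \<in> S (q, r)" for q r x y
  proof -
    have "supnorm q * dist x y \<le> cmod q * dist x y"
      by (intro mult_right_mono supnorm_le_cmod) auto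
    also have "\<dots> = cmod (q * x - q * y)"
      by (simp add: dist_norm norm_mult flip: right_diff_distrib)
    also have "\<dots> \<le> 2 * supnorm ((q * x - r) + (r - q * y))"
      using cmod_le_2_supnorm by (metis add_diff_cancel_right' diff_add_eq add_diff_eq)
    also have "\<dots> \<le> 2 * (supnorm q powr (-\<tau>) + supnorm q powr (-\<tau>))"
      using that supnorm_triangle[of "q * x - r" "r - q * y"]
      by (simp add: S_def supnorm_minus_commute[of r])
    finally have "dist x y \<le> 4 * (supnorm q powr (-\<tau>) / supnorm q)"
      using q1[OF that(1)] by (simp add: field_simps)
    also have "supnorm q powr (-\<tau>) / supnorm q = supnorm q powr (-(1+\<tau>))"
      using q1[OF that(1)] by (simp add: powr_diff powr_minus powr_add field_simps)
    finally show ?thesis .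
  qed
  have S_bdd: "bounded (S i)" if "i \<in> I" for i
  proof (cases i)
    case (Pair q r)
    then have "q \<in> J" using that by (simp add: I_def)
    then show ?thesis
      unfolding bounded_two_points Pair using dist by blast
  qed
  have S_diam: "diameter (S (q, r)) \<le> 4 * supnorm q powr (-(1+\<tau>))" if "q \<in> J" for q r
    using dist[OF that] by (intro diameter_le) (auto simp: dist_norm)
  have null: "hausdorff_measure s {x. infinite {i \<in> I. x \<in> S i}} = 0"
  proof (rule hausdorff_measure_limsup_null[OF s0 _ S_bdd])
    have "I \<subseteq> gauss_ints \<times> gauss_ints" using J by (auto simp: I_def)
    then show "countable I"
      using countable_gauss_ints by (meson countable_SIGMA countable_subset)
    show "(\<Sum>i\<in>F. diameter (S i) powr s) \<le> 4 powr s * 2 powr (2+\<epsilon>) * (B * B2)" if F: "finite F" "F \<subseteq> I" for F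
    proof -
      let ?w = "\<lambda>r. (1 + supnorm r) powr (-(2+\<epsilon>))"
      have "(\<Sum>i\<in>F. diameter (S i) powr s) \<le>
         (\<Sum>(q,r)\<in>F. 4 powr s * 2 powr (2+\<epsilon>) * (supnorm q powr (-p) * ?w r))"
      proof (rule sum_mono, clarify)
        fix q r assume "(q, r) \<in> F"
        then have q: "q \<in> J" and r: "supnorm r \<le> supnorm q powr (1 + \<epsilon>)" using F by (auto simp: I_def)
        note q1 = q1[OF q]
        have "diameter (S (q, r)) powr s \<le> (4 * supnorm q powr (-(1+\<tau>))) powr s"
          using S_diam[OF q] s0 diameter_ge_0[OF S_bdd[of "(q, r)"]] F \<open>(q, r) \<in> F\<close> by (intro powr_mono2) auto
        also have "\<dots> = 4 powr s * supnorm q powr (-(s*(1+\<tau>)))"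
          by (subst powr_mult) (simp_all add: powr_powr algebra_simps)
        finally have 1: "diameter (S (q, r)) powr s \<le> 4 powr s * supnorm q powr (-(s*(1+\<tau>)))" .
        \<comment> \<open>Part of the power of |q| is converted into a summable weight in
          \<open>r\<close>, which is possible because |r| is at most |q|^(1+\<epsilon>). The double
          sum then factors over the two projections of \<open>F\<close>.\<close>
        have "supnorm q powr (-(s*(1+\<tau>))) \<le> supnorm q powr (-p - (1+\<epsilon>)*(2+\<epsilon>))"
          using q1 key by (intro powr_mono) auto
        also have "\<dots> = supnorm q powr (-p) * (supnorm q powr (1+\<epsilon>)) powr (-(2+\<epsilon>))"
          unfolding powr_powr powr_add[symmetric] by (simp add: algebra_simps)
        finally have 2: "supnorm q powr (-(s*(1+\<tau>))) \<le> supnorm q powr (-p) * (supnorm q powr (1+\<epsilon>)) powr (-(2+\<epsilon>))" .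
        have "(supnorm q powr (1+\<epsilon>)) powr (-(2+\<epsilon>)) \<le> ((1 + supnorm r) / 2) powr (-(2+\<epsilon>))"
        proof (rule powr_mono2')
          have "1 \<le> supnorm q powr (1+\<epsilon>)" using q1 e0 by (intro ge_one_powr_ge_zero) auto
          then show "(1 + supnorm r) / 2 \<le> supnorm q powr (1+\<epsilon>)"
            using add_mono[OF _ r] by fastforce
          show "0 < (1 + supnorm r) / 2" by (simp add: add_pos_nonneg)
        qed (use e0 in auto)
        also have "((1 + supnorm r) / 2) powr (-(2+\<epsilon>)) = 2 powr (2+\<epsilon>) * ?w r"
          by (rule half_powr_minus) simp
        finally have 3: "(supnorm q powr (1+\<epsilon>)) powr (-(2+\<epsilon>)) \<le> 2 powr (2+\<epsilon>) * ?w r" .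
        have "diameter (S (q, r)) powr s \<le> 4 powr s * (supnorm q powr (-p) * (2 powr (2+\<epsilon>) * ?w r))"
          by (rule order_trans[OF 1 mult_left_mono[OF order_trans[OF 2 mult_left_mono[OF 3]]]]) auto
        then show "diameter (S (q, r)) powr s \<le> 4 powr s * 2 powr (2+\<epsilon>) * (supnorm q powr (-p) * ?w r)"
          by (simp only: mult_ac)
      qed
      also have "\<dots> \<le> (\<Sum>(q,r)\<in>fst ` F \<times> snd ` F. 4 powr s * 2 powr (2+\<epsilon>) * (supnorm q powr (-p) * ?w r))"
        using F by (intro sum_mono2) (auto simp: image_iff Bex_def split: prod.splits)
      also have "\<dots> = 4 powr s * 2 powr (2+\<epsilon>) * ((\<Sum>q\<in>fst ` F. supnorm q powr (-p)) * (\<Sum>r\<in>snd ` F. ?w r))"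
        by (subst sum_product, subst sum.cartesian_product) (simp add: sum_distrib_left case_prod_unfold)
      also have "\<dots> \<le> 4 powr s * 2 powr (2+\<epsilon>) * (B * B2)"
      proof (intro mult_left_mono mult_mono sumJ B2)
        show "0 \<le> B" using sumJ[of "{}"] by simp
      qed (use F B2 in \<open>auto simp: I_def intro!: sum_nonneg\<close>)
      finally show ?thesis .
    qed
  qed auto
  have sub: "{x. infinite {(q, r). q \<in> J \<and> r \<in> gauss_ints \<and> supnorm (q * x - r) \<le> supnorm q powr (- \<tau>)}}
       \<subseteq> {x. infinite {i \<in> I. x \<in> S i}}"
  proof clarify
    fix x
    let ?A = "{(q, r). q \<in> J \<and> r \<in> gauss_ints \<and> supnorm (q * x - r) \<le> supnorm q powr (- \<tau>)}"
    assume inf: "infinite ?A" and fin: "finite {i \<in> I. x \<in> S i}"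
    \<comment> \<open>Beyond this size |q|^\<epsilon> exceeds the factor
      \<open>2 * cmod x + 1\<close> that bounds |r| / |q|.\<close>
    define R where "R = (2 * cmod x + 1) powr (1/\<epsilon>)"
    have r: "supnorm r \<le> supnorm q * (2 * cmod x + 1)" if "(q, r) \<in> ?A" for q r
    proof -
      have q: "supnorm q \<ge> 1" using that q1 by auto
      have "supnorm r \<le> supnorm (q * x) + supnorm (r - q * x)"
        using supnorm_triangle[of "q * x" "r - q * x"] by simp
      also have "supnorm (r - q * x) \<le> supnorm q powr (-\<tau>)"
        using that by (simp add: supnorm_minus_commute)
      also have "\<dots> \<le> supnorm q powr 1" using q tau by (intro powr_mono) auto
      also have "supnorm (q * x) \<le> cmod q * cmod x"
        using supnorm_le_cmod[of "q * x"] by (simp add: norm_mult)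
      also have "\<dots> \<le> 2 * supnorm q * cmod x"
        by (intro mult_right_mono cmod_le_2_supnorm) auto
      finally show ?thesis using q by (simp add: algebra_simps)
    qed
    have "?A \<subseteq> {i \<in> I. x \<in> S i} \<union> {q \<in> gauss_ints. supnorm q \<le> R} \<times> {r \<in> gauss_ints. supnorm r \<le> R * (2 * cmod x + 1)}"
    proof
      fix i assume i: "i \<in> ?A"
      obtain q r where qr: "i = (q, r)" by (cases i)
      have q: "q \<in> J" "supnorm q \<ge> 1" using i q1 qr by auto
      note r = r[of q r, OF i[unfolded qr]]
      show "i \<in> {i \<in> I. x \<in> S i} \<union> {q \<in> gauss_ints. supnorm q \<le> R} \<times> {r \<in> gauss_ints. supnorm r \<le> R * (2 * cmod x + 1)}"
      proof (cases "supnorm q \<le> R")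
        case True
        then have "supnorm r \<le> R * (2 * cmod x + 1)"
          using r by (smt (verit) mult_right_mono norm_ge_zero)
        then show ?thesis using True i J qr by auto
      next
        case False
        then have "R powr \<epsilon> \<le> supnorm q powr \<epsilon>" using e0 by (intro powr_mono2) (auto simp: R_def)
        then have "2 * cmod x + 1 \<le> supnorm q powr \<epsilon>" using e0 by (simp add: R_def powr_powr)
        then have "supnorm q * (2 * cmod x + 1) \<le> supnorm q * supnorm q powr \<epsilon>"
          by (intro mult_left_mono) auto
        moreover have "supnorm q powr (1 + \<epsilon>) = supnorm q * supnorm q powr \<epsilon>"
          using q by (simp add: powr_add)
        ultimately have "supnorm r \<le> supnorm q powr (1 + \<epsilon>)" using r by linarith
        then show ?thesis using i qr by (auto simp: I_def S_def)
      qed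
    qed
    then have "finite ?A"
      by (rule finite_subset) (use fin in \<open>auto intro!: finite_cartesian_product finite_gauss_bounded\<close>)
    then show False using inf by simp
  qed
  show ?thesis using hausdorff_measure_mono[OF sub, of s] null by simp
qed

text \<open>With powers of two as denominators the cover consists of overlapping dyadic squares: the
  sum over \<open>q\<close> converges for every \<open>p > 0\<close>, so only the cost 2 of the sum
  over \<open>r\<close> remains, and \<open>p\<close> is half of the excess \<open>s - 2\<close>.
  This caps every dimension by 2 and shows that the infimum in \<open>hausdorff_dim\<close> is taken
  over a nonempty set.\<close>

lemma hausdorff_measure_null_above_2:
  assumes "s > 2"
  shows "hausdorff_measure s A = 0"
proof -
  define J where "J = range (\<lambda>k::nat. 2 ^ k :: complex)"
  define p where "p = (s - 2) / 2"
  have p: "p > 0" using assms by (simp add: p_def)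
  have pow: "(2::complex) ^ k = complex_of_real (2 ^ k)" for k by simp
  have sn: "supnorm (2 ^ k) = 2 ^ k" for k
    unfolding supnorm_def pow by (simp only: Re_complex_of_real Im_complex_of_real) simp
  have inj: "inj (\<lambda>k::nat. 2 ^ k :: complex)"
  proof (rule injI)
    fix j k :: nat assume "(2 ^ j :: complex) = 2 ^ k"
    then have "(2::real) ^ j = 2 ^ k" using sn by metis
    then show "j = k" by simp
  qed
  have J: "J \<subseteq> gauss_ints - {0}"
  proof -
    have "2 ^ k \<in> gauss_ints - {0}" for k
      unfolding gauss_ints_def pow by (simp del: of_real_power)
    then show ?thesis unfolding J_def by (rule image_subsetI)
  qed
  have summ: "summable (\<lambda>k. (2 powr (-p)) ^ k)"
    using p by (intro summable_geometric) (simp add: powr_minus field_simps)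
  have pw: "supnorm (2 ^ k) powr (-p) = (2 powr (-p)) ^ k" for k
    unfolding sn by (simp add: powr_power powr_powr mult.commute flip: powr_realpow)
  have "hausdorff_measure s {x. infinite {(q, r). q \<in> J \<and> r \<in> gauss_ints \<and>
                     supnorm (q * x - r) \<le> supnorm q powr (- 0)}} = 0"
  proof (rule hausdorff_measure_approx_null[OF _ J, where p = p])
    fix F assume F: "finite F" "F \<subseteq> J"
    define G where "G = (\<lambda>k::nat. 2 ^ k :: complex) -` F"
    have "F = (\<lambda>k. 2 ^ k) ` G" using F by (auto simp: G_def J_def)
    then have "(\<Sum>q\<in>F. supnorm q powr (-p)) = (\<Sum>k\<in>G. (2 powr (-p)) ^ k)"
      using inj by (simp add: sum.reindex pw inj_on_def)
    also have "\<dots> \<le> (\<Sum>k. (2 powr (-p)) ^ k)"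
      using F inj by (intro sum_le_suminf summ) (auto simp: G_def intro: finite_vimageI)
    finally show "(\<Sum>q\<in>F. supnorm q powr (-p)) \<le> (\<Sum>k. (2 powr (-p)) ^ k)" .
  qed (use p assms in \<open>auto simp: p_def field_simps\<close>)
  moreover have "infinite {(q, r). q \<in> J \<and> r \<in> gauss_ints \<and> supnorm (q * x - r) \<le> supnorm q powr (- 0)}"
    (is "infinite ?A") for x
  proof
    assume "finite ?A"
    then have "finite (fst ` ?A)" by simp
    moreover have "J \<subseteq> fst ` ?A"
    proof
      fix q assume q: "q \<in> J"
      let ?r = "Complex (of_int \<lfloor>Re (q * x)\<rfloor>) (of_int \<lfloor>Im (q * x)\<rfloor>)"
      have "supnorm (q * x - ?r) \<le> 1"
        unfolding supnorm_def minus_complex.simps complex.sel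
        by (intro max.boundedI; linarith)
      moreover have "q \<noteq> 0" using q J by blast
      then have "supnorm q \<noteq> 0" using supnorm_pos[of q] by simp
      moreover have "?r \<in> gauss_ints" by (simp add: gauss_ints_def)
      ultimately have "(q, ?r) \<in> ?A" using q by simp
      then show "q \<in> fst ` ?A" by force
    qed
    ultimately have "finite J" by (rule rev_finite_subset)
    then show False using inj by (auto simp: J_def dest: finite_imageD)
  qed
  ultimately have "hausdorff_measure s UNIV = 0" by auto
  then show ?thesis using hausdorff_measure_mono[of A UNIV s] by simp
qed

lemma hausdorff_measure_E_star_null:
  assumes "\<tau> > -1" "s > 4 / (1 + \<tau>)"
  shows "hausdorff_measure s (E_star \<tau>) = 0"
proof -
  \<comment> \<open>Summing over \<open>q\<close> and over \<open>r\<close> each costs 2, whence the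
    threshold 4. Half of the excess over 4 goes to \<open>q\<close>, so that \<open>p > 2\<close>,
    and the other half remains for \<open>r\<close>.\<close>
  define p where "p = 2 + (s * (1 + \<tau>) - 4) / 2"
  have gt: "s * (1 + \<tau>) > 4" using assms by (simp add: field_simps)
  have p: "p > 2" "s * (1 + \<tau>) > 2 + p" using gt by (auto simp: p_def field_simps)
  obtain B :: real where B:
    "\<And>F. finite F \<Longrightarrow> F \<subseteq> gauss_ints \<Longrightarrow> (\<Sum>z\<in>F. (1 + supnorm z) powr (-p)) \<le> B"
    using gauss_powr_sum_bounded[OF p(1)] by blast
  have "hausdorff_measure s {x. infinite {(q, r). q \<in> gauss_ints - {0} \<and> r \<in> gauss_ints \<and>
                     supnorm (q * x - r) \<le> supnorm q powr (- \<tau>)}} = 0"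
  proof (rule hausdorff_measure_approx_null[OF assms(1) subset_refl _ _ p(2)])
    fix F :: "complex set" assume F: "finite F" "F \<subseteq> gauss_ints - {0}"
    have "(\<Sum>q\<in>F. supnorm q powr (-p)) \<le> (\<Sum>q\<in>F. 2 powr p * (1 + supnorm q) powr (-p))"
    proof (rule sum_mono)
      fix q assume "q \<in> F"
      then have "1 \<le> supnorm q" using F gauss_supnorm_ge_1 by auto
      then have "supnorm q powr (-p) \<le> ((1 + supnorm q) / 2) powr (-p)"
        using p by (intro powr_mono2') auto
      also have "\<dots> = 2 powr p * (1 + supnorm q) powr (-p)"
        by (rule half_powr_minus) simp
      finally show "supnorm q powr (-p) \<le> 2 powr p * (1 + supnorm q) powr (-p)" .
    qed
    also have "\<dots> \<le> 2 powr p * B"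
      unfolding sum_distrib_left[symmetric] using F B by (intro mult_left_mono) auto
    finally show "(\<Sum>q\<in>F. supnorm q powr (-p)) \<le> 2 powr p * B" .
  qed (use p in auto)
  also have "{x. infinite {(q, r). q \<in> gauss_ints - {0} \<and> r \<in> gauss_ints \<and>
                     supnorm (q * x - r) \<le> supnorm q powr (- \<tau>)}} = E_star \<tau>"
    unfolding E_star_def by (intro Collect_cong arg_cong[where f = infinite]) auto
  finally show ?thesis .
qed

lemma hausdorff_dim_E_star_le:
  assumes "\<tau> > -1"
  shows "hausdorff_dim (E_star \<tau>) \<le> min (4 / (1 + \<tau>)) 2"
proof (rule dense_ge)
  fix s assume s: "min (4 / (1 + \<tau>)) 2 < s"
  have "0 < min (4 / (1 + \<tau>)) 2" using assms by auto
  then have "0 \<le> s" using s by linarith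
  moreover have "hausdorff_measure s (E_star \<tau>) = 0"
    using s hausdorff_measure_null_above_2 hausdorff_measure_E_star_null[OF assms] 
    by (auto simp: min_less_iff_disj)
  ultimately show "hausdorff_dim (E_star \<tau>) \<le> s"
    unfolding hausdorff_dim_def by (intro cInf_lower) auto
qed

section \<open>Fourier decay bounds the Hausdorff dimension from below\<close>

abbreviation wave :: "complex \<Rightarrow> complex \<Rightarrow> complex" where
  "wave \<xi> x \<equiv> cis (- 2 * pi * (Re \<xi> * Re x + Im \<xi> * Im x))"

section \<open>Measurability, Fubini and Fourier transforms of product measures\<close>

lemma borel_measurable_cis [measurable]:
  "f \<in> borel_measurable M \<Longrightarrow> (\<lambda>x. cis (f x)) \<in> borel_measurable M"
  unfolding cis_conv_exp by measurable

lemma borel_measurable_Complex [measurable (raw)]: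
  "f \<in> borel_measurable M \<Longrightarrow> g \<in> borel_measurable M \<Longrightarrow> (\<lambda>x. Complex (f x) (g x)) \<in> borel_measurable M"
  by (simp add: borel_measurable_complex_iff)

lemma borel_measurable_pair_Complex [measurable]:
  assumes "sets M = sets borel" "sets N = sets borel"
  shows "(\<lambda>(x, y). Complex x y) \<in> borel_measurable (M \<Otimes>\<^sub>M N)"
proof -
  have [measurable]: "fst \<in> borel_measurable (M \<Otimes>\<^sub>M N)" "snd \<in> borel_measurable (M \<Otimes>\<^sub>M N)"
    using assms by (auto intro: measurable_compose[OF measurable_fst] measurable_compose[OF measurable_snd]
      simp: measurable_cong_sets[OF assms(1) refl] measurable_cong_sets[OF assms(2) refl])
  show ?thesis unfolding case_prod_unfold by measurable
qed

lemma prob_space_integrable_bounded: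
  fixes f :: "'a \<Rightarrow> 'b :: {banach, second_countable_topology}"
  assumes "prob_space M" "f \<in> borel_measurable M" "\<And>x. norm (f x) \<le> B"
  shows "integrable M f"
proof -
  interpret prob_space M by fact
  show ?thesis using assms by (intro integrable_const_bound[of _ B]) auto
qed

lemma prob_space_Fubini_bounded:
  fixes f :: "'a \<Rightarrow> 'b \<Rightarrow> complex"
  assumes M: "prob_space M" and N: "prob_space N"
    and f: "case_prod f \<in> borel_measurable (M \<Otimes>\<^sub>M N)" "\<And>x y. cmod (f x y) \<le> B"
  shows "(LINT x|M. LINT y|N. f x y) = (LINT z|(M \<Otimes>\<^sub>M N). case_prod f z)"
    and "(LINT y|N. LINT x|M. f x y) = (LINT z|(M \<Otimes>\<^sub>M N). case_prod f z)"
proof -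
  interpret M: prob_space M by fact
  interpret N: prob_space N by fact
  interpret MN: pair_prob_space M N ..
  have int: "integrable (M \<Otimes>\<^sub>M N) (case_prod f)"
    by (rule prob_space_integrable_bounded[OF _ f(1), of B])
       (use f(2) MN.prob_space_axioms in \<open>auto simp: case_prod_unfold\<close>)
  show "(LINT x|M. LINT y|N. f x y) = (LINT z|(M \<Otimes>\<^sub>M N). case_prod f z)"
    by (rule MN.integral_fst[OF int])
  show "(LINT y|N. LINT x|M. f x y) = (LINT z|(M \<Otimes>\<^sub>M N). case_prod f z)"
    by (rule MN.integral_snd[OF int])
qed

lemma integral_prod_bounded:
  fixes f :: "'a \<Rightarrow> complex" and g :: "'b \<Rightarrow> complex"
  assumes "prob_space M" "prob_space N"
    and [measurable]: "f \<in> borel_measurable M" "g \<in> borel_measurable N"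
    and b: "\<And>x. cmod (f x) \<le> A" "\<And>x. cmod (g x) \<le> B"
  shows "(LINT (x, y)|(M \<Otimes>\<^sub>M N). f x * g y) = (LINT x|M. f x) * (LINT y|N. g y)"
proof -
  have A: "0 \<le> A" using b(1) norm_ge_zero order_trans by blast
  have "(LINT (x, y)|(M \<Otimes>\<^sub>M N). f x * g y) = (LINT x|M. LINT y|N. f x * g y)"
    using assms A by (intro prob_space_Fubini_bounded(1)[symmetric, of _ _ _ "A * B"])
      (auto simp: norm_mult intro!: mult_mono)
  then show ?thesis by simp
qed

lemma fourier_transform_norm_le_1:
  assumes "prob_space M" shows "cmod (fourier_transform M \<xi>) \<le> 1"
proof -
  interpret prob_space M by fact
  have "cmod (fourier_transform M \<xi>) \<le> (LINT x|M. cmod (wave \<xi> x))"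
    unfolding fourier_transform_def by (rule integral_norm_bound)
  then show ?thesis by (simp add: prob_space)
qed

text \<open>Fubini's theorem, since the exponential is symmetric in \<open>x\<close> and
  \<open>y\<close>. With a Gaussian as one of the measures it takes the place of Plancherel: the
  integral of a Gaussian becomes a Gaussian mean of a transform.\<close>

lemma fourier_transform_swap:
  assumes "prob_space M" "prob_space N" "sets M = sets borel" "sets N = sets borel"
  shows "(LINT x|M. fourier_transform N (\<rho> *\<^sub>R x)) = (LINT y|N. fourier_transform M (\<rho> *\<^sub>R y))"
proof -
  have f: "(\<lambda>(x, y). wave (\<rho> *\<^sub>R x) y) \<in> borel_measurable (M \<Otimes>\<^sub>M N)"
  proof -
    have "(\<lambda>(x, y). wave (\<rho> *\<^sub>R x) y) \<in> borel_measurable (borel \<Otimes>\<^sub>M borel)" by measurable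
    moreover have "sets (M \<Otimes>\<^sub>M N) = sets (borel \<Otimes>\<^sub>M borel)" 
      using assms by (intro sets_pair_measure_cong)
    ultimately show ?thesis using measurable_cong_sets by blast
  qed
  have "(LINT x|M. LINT y|N. wave (\<rho> *\<^sub>R x) y) = (LINT y|N. LINT x|M. wave (\<rho> *\<^sub>R x) y)"
    using prob_space_Fubini_bounded[OF assms(1,2) f, of 1] by simp
  then show ?thesis unfolding fourier_transform_def by (simp add: mult_ac)
qed

text \<open>Taken with the standard normal law for the energy estimate and with \<open>bump\<close>
  for the measure on which the construction starts.\<close>

definition plane_measure :: "real measure \<Rightarrow> complex measure" where
  "plane_measure N = distr (N \<Otimes>\<^sub>M N) borel (\<lambda>(x, y). Complex x y)"

lemma sets_plane_measure [simp]: "sets (plane_measure N) = sets borel"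
  by (simp add: plane_measure_def)

lemma prob_space_plane_measure:
  assumes "prob_space N" "sets N = sets borel"
  shows "prob_space (plane_measure N)"
proof -
  interpret N: prob_space N by fact
  interpret NN: pair_prob_space N N ..
  show ?thesis unfolding plane_measure_def
    by (rule NN.prob_space_distr[OF borel_measurable_pair_Complex[OF assms(2,2)]])
qed

lemma fourier_transform_plane_measure:
  assumes "prob_space N" "sets N = sets borel"
  shows "fourier_transform (plane_measure N) \<xi> =
    (LINT x|N. cis (- 2 * pi * Re \<xi> * x)) * (LINT x|N. cis (- 2 * pi * Im \<xi> * x))"
proof -
  have m: "(\<lambda>x. cis (c * x)) \<in> borel_measurable N" for c
    unfolding measurable_cong_sets[OF assms(2) refl] by measurable
  have "fourier_transform (plane_measure N) \<xi> = (LINT z|(N \<Otimes>\<^sub>M N). wave \<xi> (case z of (x, y) \<Rightarrow> Complex x y))"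
    unfolding fourier_transform_def plane_measure_def
    by (rule integral_distr[OF borel_measurable_pair_Complex[OF assms(2,2)]]) measurable
  also have "\<dots> = (LINT (x, y)|(N \<Otimes>\<^sub>M N). cis (- 2 * pi * Re \<xi> * x) * cis (- 2 * pi * Im \<xi> * y))"
    by (intro Bochner_Integration.integral_cong) (auto simp: cis_mult distrib_left mult.assoc)
  also have "\<dots> = (LINT x|N. cis (- 2 * pi * Re \<xi> * x)) * (LINT x|N. cis (- 2 * pi * Im \<xi> * x))"
    by (rule integral_prod_bounded[OF assms(1,1) m m, where A = 1 and B = 1]) auto
  finally show ?thesis .
qed

abbreviation heat :: "complex \<Rightarrow> real" where
  "heat z \<equiv> exp (- 2 * pi\<^sup>2 * (cmod z)\<^sup>2)"

lemma prob_space_std_normal: "prob_space std_normal_distribution"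
  using real_dist_normal_dist real_distribution.axioms(1) by blast

lemma fourier_transform_gaussian:
  "fourier_transform (plane_measure std_normal_distribution) \<xi> = of_real (heat \<xi>)"
proof -
  have c: "(LINT x|std_normal_distribution. cis (- 2 * pi * t * x)) = of_real (exp (- 2 * pi\<^sup>2 * t\<^sup>2))" for t
  proof -
    have "(LINT x|std_normal_distribution. cis (- 2 * pi * t * x)) = char std_normal_distribution (- 2 * pi * t)"
      unfolding char_def by (simp add: cis_conv_exp)
    also have "\<dots> = of_real (exp (- (- 2 * pi * t)\<^sup>2 / 2))"
      by (subst char_std_normal_distribution) simp
    also have "- (- 2 * pi * t)\<^sup>2 / 2 = - 2 * pi\<^sup>2 * t\<^sup>2" by (simp add: power2_eq_square)
    finally show ?thesis .
  qed
  have "fourier_transform (plane_measure std_normal_distribution) \<xi> =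
     of_real (exp (- 2 * pi\<^sup>2 * (Re \<xi>)\<^sup>2) * exp (- 2 * pi\<^sup>2 * (Im \<xi>)\<^sup>2))"
    by (subst fourier_transform_plane_measure[OF prob_space_std_normal]) (simp_all only: c of_real_mult, simp)
  also have "exp (- 2 * pi\<^sup>2 * (Re \<xi>)\<^sup>2) * exp (- 2 * pi\<^sup>2 * (Im \<xi>)\<^sup>2) = heat \<xi>"
    unfolding exp_add[symmetric] cmod_power2 by (simp add: algebra_simps)
  finally show ?thesis .
qed

text \<open>Near 0 the density is at most 1 and the power is integrable because
  \<open>a < 1\<close>; away from 0 the power is at most 1 and the density is integrable.\<close>

lemma nn_integral_powr_std_normal_finite:
  assumes "0 \<le> a" "a < 1"
  shows "(\<integral>\<^sup>+u. ennreal (\<bar>u\<bar> powr (-a)) \<partial>std_normal_distribution) < \<infinity>"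
proof -
  have hi: "((\<lambda>x::real. x powr (-a)) has_integral (1 powr (-a + 1) / (-a + 1))) {0..1}"
    by (rule has_integral_powr_from_0) (use assms in auto)
  have p: "((\<lambda>x::real. \<bar>x\<bar> powr (-a)) has_integral (1 / (1 - a))) {0..1}"
    by (rule has_integral_eq[OF _ hi[simplified, unfolded add.commute[of "-a"]], simplified]) auto
  have n: "((\<lambda>x::real. \<bar>x\<bar> powr (-a)) has_integral (1 / (1 - a))) {-1..0}"
    using has_integral_reflect_real[of "\<lambda>x::real. \<bar>x\<bar> powr (-a)" "1 / (1 - a)" 1 0] p by simp
  have "((\<lambda>x::real. \<bar>x\<bar> powr (-a)) has_integral (1 / (1 - a) + 1 / (1 - a))) {-1..1}"
    by (rule has_integral_combine[OF _ _ n p]) auto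
  then have fin: "(\<integral>\<^sup>+x. ennreal (indicator {-1..1} x * \<bar>x\<bar> powr (-a)) \<partial>lborel) = ennreal (1 / (1 - a) + 1 / (1 - a))"
    by (intro nn_integral_has_integral_lebesgue) auto
  have "(\<integral>\<^sup>+u. ennreal (\<bar>u\<bar> powr (-a)) \<partial>std_normal_distribution) =
      (\<integral>\<^sup>+u. ennreal (std_normal_density u) * ennreal (\<bar>u\<bar> powr (-a)) \<partial>lborel)"
    by (subst nn_integral_density) auto
  also have "\<dots> \<le> (\<integral>\<^sup>+u. ennreal (indicator {-1..1} u * \<bar>u\<bar> powr (-a)) + ennreal (std_normal_density u) \<partial>lborel)"
  proof (rule nn_integral_mono)
    fix u :: real
    have d1: "std_normal_density u \<le> 1"
    proof -
      have "1 \<le> sqrt (2 * pi)" using pi_gt3 by (intro real_le_rsqrt) auto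
      then have "1 / sqrt (2 * pi) \<le> 1" by simp
      then have "1 / sqrt (2 * pi) * exp (- u\<^sup>2 / 2) \<le> 1 * 1" by (intro mult_mono) auto
      then show ?thesis by (simp add: std_normal_density_def)
    qed
    have d0: "0 \<le> std_normal_density u" by simp
    have "std_normal_density u * \<bar>u\<bar> powr (-a) \<le> indicator {-1..1} u * \<bar>u\<bar> powr (-a) + std_normal_density u"
    proof (cases "\<bar>u\<bar> \<le> 1")
      case True
      then have "indicator {-1..1} u = (1::real)" by (auto simp: abs_le_iff)
      then show ?thesis using d0 d1 by (auto intro!: add_increasing2 mult_left_le_one_le)
    next
      case False
      then have "\<bar>u\<bar> powr (-a) \<le> 1" using assms by (simp add: powr_minus inverse_le_1_iff ge_one_powr_ge_zero)
      then show ?thesis using d0 by (auto intro!: add_increasing mult_left_le)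
    qed
    then show "ennreal (std_normal_density u) * ennreal (\<bar>u\<bar> powr (-a)) \<le>
      ennreal (indicator {-1..1} u * \<bar>u\<bar> powr (-a)) + ennreal (std_normal_density u)"
      by (simp flip: ennreal_mult' ennreal_plus add: ennreal_leI)
  qed
  also have "\<dots> = ennreal (1 / (1 - a) + 1 / (1 - a)) + (\<integral>\<^sup>+u. ennreal (std_normal_density u) \<partial>lborel)"
    by (subst nn_integral_add) (auto simp: fin)
  also have "(\<integral>\<^sup>+u. ennreal (std_normal_density u) \<partial>lborel) = 1"
    using prob_space.emeasure_space_1[OF prob_space_std_normal] by (simp add: emeasure_density)
  finally show ?thesis by (rule le_less_trans) simp
qed

text \<open>With independent standard normal \<open>u\<close> and \<open>v\<close>, the double integral is the expectation of
  \<open>|\<mu>^(\<rho>u, \<rho>v)|\<^sup>2\<close>. Since \<open>max |u| |v|\<close> is at least the geometric mean of \<open>|u|\<close> and \<open>|v|\<close>, the decay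
  hypothesis reduces everything to the moment of order \<open>-s/2 > -1\<close> of one normal variable.\<close>
lemma fourier_decay_energy:
  assumes M: "prob_space M" "sets M = sets borel"
    and s: "0 \<le> s" "s < 2"
    and decay: "\<And>\<xi>. \<xi> \<noteq> 0 \<Longrightarrow> (cmod (fourier_transform M \<xi>))\<^sup>2 * supnorm \<xi> powr s \<le> C"
  obtains K where "0 \<le> K" "\<And>\<rho>. 0 < \<rho> \<Longrightarrow>
    (\<integral>\<^sup>+x. \<integral>\<^sup>+y. ennreal (heat (\<rho> *\<^sub>R (x - y))) \<partial>M \<partial>M) \<le> ennreal (K * \<rho> powr (-s))"
proof -
  interpret M: prob_space M by fact
  interpret MM: pair_prob_space M M ..
  let ?N = std_normal_distribution
  let ?G = "plane_measure ?N"
  interpret N: prob_space ?N by (rule prob_space_std_normal)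
  interpret NN: pair_prob_space ?N ?N ..
  have G: "prob_space ?G" by (rule prob_space_plane_measure[OF prob_space_std_normal]) simp
  define \<phi> where "\<phi> = fourier_transform M"
  \<comment> \<open>The law of the difference of two independent points. Its transform is the
    squared modulus of \<phi>, and the energy is the integral of \<open>k\<close> against
    it.\<close>
  define D where "D = distr (M \<Otimes>\<^sub>M M) borel (\<lambda>(x, y). x - y)"
  have sMM: "sets (M \<Otimes>\<^sub>M M) = sets (borel \<Otimes>\<^sub>M borel)" using M by (intro sets_pair_measure_cong)
  have diff [measurable]: "(\<lambda>(x, y). x - y) \<in> borel_measurable (M \<Otimes>\<^sub>M M)"
    unfolding measurable_cong_sets[OF sMM refl] by measurable
  have D: "prob_space D" "sets D = sets borel"
    unfolding D_def by (auto intro: MM.prob_space_distr[OF diff])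
  have waveM [measurable]: "wave \<xi> \<in> borel_measurable M" for \<xi>
    unfolding measurable_cong_sets[OF M(2) refl] by measurable
  have waveM': "(\<lambda>x. cnj (wave \<xi> x)) \<in> borel_measurable M" for \<xi>
    by (rule measurable_compose[OF waveM borel_measurable_continuous_onI[OF continuous_on_cnj[OF continuous_on_id]]])
  have phi_meas [measurable]: "\<phi> \<in> borel_measurable borel"
  proof -
    have "(\<lambda>(\<xi>, x). wave \<xi> x) \<in> borel_measurable (borel \<Otimes>\<^sub>M borel)" by measurable
    moreover have "sets (borel \<Otimes>\<^sub>M M) = sets (borel \<Otimes>\<^sub>M borel)" using M by (intro sets_pair_measure_cong) auto
    ultimately have "(\<lambda>(\<xi>, x). wave \<xi> x) \<in> borel_measurable (borel \<Otimes>\<^sub>M M)"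
      using measurable_cong_sets by blast
    then show ?thesis unfolding \<phi>_def fourier_transform_def by (rule M.borel_measurable_lebesgue_integral)
  qed
  have fD: "fourier_transform D \<xi> = of_real ((cmod (\<phi> \<xi>))\<^sup>2)" for \<xi>
  proof -
    have "fourier_transform D \<xi> = (LINT z|(M \<Otimes>\<^sub>M M). wave \<xi> (case z of (x, y) \<Rightarrow> x - y))"
      unfolding fourier_transform_def D_def by (rule integral_distr[OF diff]) measurable
    also have "\<dots> = (LINT (x, y)|(M \<Otimes>\<^sub>M M). wave \<xi> x * cnj (wave \<xi> y))"
      by (intro Bochner_Integration.integral_cong) (auto simp: cis_mult cis_cnj algebra_simps)
    also have "\<dots> = \<phi> \<xi> * (LINT y|M. cnj (wave \<xi> y))"
      unfolding \<phi>_def fourier_transform_def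
      by (rule integral_prod_bounded[OF M(1,1) waveM waveM', where A = 1 and B = 1]) auto
    also have "(LINT y|M. cnj (wave \<xi> y)) = cnj (\<phi> \<xi>)"
      unfolding \<phi>_def fourier_transform_def by (rule integral_bounded_linear'[OF bounded_linear_cnj bounded_linear_cnj]) auto
    finally show ?thesis by (simp only: complex_norm_square)
  qed
  have C0: "0 \<le> C" using decay[of 1] by (smt (verit) mult_nonneg_nonneg powr_ge_zero zero_le_power2 one_neq_zero)
  let ?a = "s / 2"
  define k1 where "k1 = enn2real (\<integral>\<^sup>+u. ennreal (\<bar>u\<bar> powr (-?a)) \<partial>?N)"
  have k1: "(\<integral>\<^sup>+u. ennreal (\<bar>u\<bar> powr (-?a)) \<partial>?N) = ennreal k1" "0 \<le> k1"
    using nn_integral_powr_std_normal_finite[of ?a] s unfolding k1_def by auto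
  have "(\<integral>\<^sup>+x. \<integral>\<^sup>+y. ennreal (heat (\<rho> *\<^sub>R (x - y))) \<partial>M \<partial>M) \<le> ennreal (C * k1 * k1 * \<rho> powr (-s))"
    if \<rho>: "0 < \<rho>" for \<rho>
  proof -
    define k where "k z = heat (\<rho> *\<^sub>R z)" for z :: complex
    have k_meas [measurable]: "k \<in> borel_measurable borel" unfolding k_def by measurable
    have intD: "integrable D k"
    proof (rule prob_space_integrable_bounded[OF D(1), of _ 1])
      show "k \<in> borel_measurable D" unfolding measurable_cong_sets[OF D(2) refl] by (rule k_meas)
    qed (simp add: k_def)
    have intG: "integrable ?G (\<lambda>w. (cmod (\<phi> (\<rho> *\<^sub>R w)))\<^sup>2)"
    proof (rule prob_space_integrable_bounded[OF G, of _ 1])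
      show "(\<lambda>w. (cmod (\<phi> (\<rho> *\<^sub>R w)))\<^sup>2) \<in> borel_measurable ?G"
        unfolding measurable_cong_sets[OF sets_plane_measure refl] by measurable
    qed (simp add: \<phi>_def power_le_one fourier_transform_norm_le_1[OF M(1)])
    have kmMM: "(\<lambda>z. ennreal (k (case z of (x, y) \<Rightarrow> x - y))) \<in> borel_measurable (M \<Otimes>\<^sub>M M)"
      by (rule measurable_compose[OF diff]) measurable
    have "(\<integral>\<^sup>+x. \<integral>\<^sup>+y. ennreal (k (x - y)) \<partial>M \<partial>M) = (\<integral>\<^sup>+z. ennreal (k (case z of (x, y) \<Rightarrow> x - y)) \<partial>(M \<Otimes>\<^sub>M M))"
      using M.nn_integral_fst[OF kmMM] by simp
    also have "\<dots> = (\<integral>\<^sup>+z. ennreal (k z) \<partial>D)"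
      unfolding D_def by (rule nn_integral_distr[symmetric, OF diff]) measurable
    also have "\<dots> = ennreal (LINT z|D. k z)"
      using intD by (rule nn_integral_eq_integral) (simp add: k_def)
    also have "(LINT z|D. k z) = (LINT w|?G. (cmod (\<phi> (\<rho> *\<^sub>R w)))\<^sup>2)"
    proof -
      have "complex_of_real (LINT z|D. k z) = (LINT z|D. fourier_transform ?G (\<rho> *\<^sub>R z))"
        unfolding fourier_transform_gaussian using intD unfolding k_def by (rule integral_of_real[symmetric])
      also have "\<dots> = (LINT w|?G. fourier_transform D (\<rho> *\<^sub>R w))"
        by (rule fourier_transform_swap[OF D(1) G D(2)]) simp
      also have "\<dots> = complex_of_real (LINT w|?G. (cmod (\<phi> (\<rho> *\<^sub>R w)))\<^sup>2)"
        unfolding fD using intG by (rule integral_of_real)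
      finally show ?thesis using of_real_eq_iff by blast
    qed
    also have "ennreal (LINT w|?G. (cmod (\<phi> (\<rho> *\<^sub>R w)))\<^sup>2) = (\<integral>\<^sup>+w. ennreal ((cmod (\<phi> (\<rho> *\<^sub>R w)))\<^sup>2) \<partial>?G)"
      using intG by (rule nn_integral_eq_integral[symmetric]) simp
    also have "\<dots> = (\<integral>\<^sup>+z. ennreal ((cmod (\<phi> (\<rho> *\<^sub>R (case z of (u, v) \<Rightarrow> Complex u v))))\<^sup>2) \<partial>(?N \<Otimes>\<^sub>M ?N))"
      unfolding plane_measure_def
      by (rule nn_integral_distr) (auto intro!: borel_measurable_pair_Complex)
    also have "\<dots> = (\<integral>\<^sup>+u. \<integral>\<^sup>+v. ennreal ((cmod (\<phi> (\<rho> *\<^sub>R Complex u v)))\<^sup>2) \<partial>?N \<partial>?N)"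
    proof -
      have "(\<lambda>w. ennreal ((cmod (\<phi> (\<rho> *\<^sub>R w)))\<^sup>2)) \<in> borel_measurable borel" by measurable
      then have "(\<lambda>z. ennreal ((cmod (\<phi> (\<rho> *\<^sub>R (case z of (u, v) \<Rightarrow> Complex u v))))\<^sup>2)) \<in> borel_measurable (?N \<Otimes>\<^sub>M ?N)"
        by (rule measurable_compose[OF borel_measurable_pair_Complex, rotated 2]) auto
      from N.nn_integral_fst[OF this] show ?thesis by simp
    qed
    also have "\<dots> \<le> (\<integral>\<^sup>+u. \<integral>\<^sup>+v. ennreal (C * \<rho> powr (-s)) * (ennreal (\<bar>u\<bar> powr (-?a)) * ennreal (\<bar>v\<bar> powr (-?a))) \<partial>?N \<partial>?N)"
    proof -
      \<comment> \<open>Points on the axes must be discarded: \<open>0 powr (-s/2)\<close> is 0, so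
        the bound below could fail there. They form a null set.\<close>
      have ne0: "AE u in ?N. u \<noteq> 0"
        using AE_lborel_singleton[of "0::real"] by (subst AE_density) auto
      have bound: "(cmod (\<phi> (\<rho> *\<^sub>R Complex u v)))\<^sup>2 \<le> C * \<rho> powr (-s) * (\<bar>u\<bar> powr (-?a) * \<bar>v\<bar> powr (-?a))"
        if "u \<noteq> 0" "v \<noteq> 0" for u v
      proof -
        define m where "m = max \<bar>u\<bar> \<bar>v\<bar>"
        have m: "m > 0" "\<bar>u\<bar> \<le> m" "\<bar>v\<bar> \<le> m" using that by (auto simp: m_def)
        have sn: "supnorm (\<rho> *\<^sub>R Complex u v) = \<rho> * m"
          using \<rho> by (simp add: supnorm_def m_def abs_mult max_mult_distrib_left)
        have "(cmod (\<phi> (\<rho> *\<^sub>R Complex u v)))\<^sup>2 * (\<rho> * m) powr s \<le> C"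
          using decay[of "\<rho> *\<^sub>R Complex u v"] \<rho> that unfolding sn \<phi>_def by (simp add: complex_eq_iff)
        then have "(cmod (\<phi> (\<rho> *\<^sub>R Complex u v)))\<^sup>2 \<le> C * (\<rho> * m) powr (-s)"
          using \<rho> m by (simp add: powr_minus field_simps)
        also have "(\<rho> * m) powr (-s) = \<rho> powr (-s) * (m powr (-?a) * m powr (-?a))"
          using \<rho> m by (simp add: powr_mult flip: powr_add)
        also have "C * (\<rho> powr (-s) * (m powr (-?a) * m powr (-?a))) \<le>
           C * (\<rho> powr (-s) * (\<bar>u\<bar> powr (-?a) * \<bar>v\<bar> powr (-?a)))"
          using C0 m that s by (intro mult_left_mono mult_mono powr_mono2') auto
        finally show ?thesis by (simp only: mult.assoc)
      qed
      have bound': "ennreal ((cmod (\<phi> (\<rho> *\<^sub>R Complex u v)))\<^sup>2) \<le>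
          ennreal (C * \<rho> powr (-s)) * (ennreal (\<bar>u\<bar> powr (-?a)) * ennreal (\<bar>v\<bar> powr (-?a)))"
        if "u \<noteq> 0" "v \<noteq> 0" for u v
        using bound[OF that] C0 by (simp add: ennreal_leI flip: ennreal_mult)
      have "AE v in ?N. ennreal ((cmod (\<phi> (\<rho> *\<^sub>R Complex u v)))\<^sup>2) \<le>
          ennreal (C * \<rho> powr (-s)) * (ennreal (\<bar>u\<bar> powr (-?a)) * ennreal (\<bar>v\<bar> powr (-?a)))"
        if "u \<noteq> 0" for u
        using ne0 by eventually_elim (rule bound'[OF that])
      then have inner: "(\<integral>\<^sup>+v. ennreal ((cmod (\<phi> (\<rho> *\<^sub>R Complex u v)))\<^sup>2) \<partial>?N) \<le>
          (\<integral>\<^sup>+v. ennreal (C * \<rho> powr (-s)) * (ennreal (\<bar>u\<bar> powr (-?a)) * ennreal (\<bar>v\<bar> powr (-?a))) \<partial>?N)"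
        if "u \<noteq> 0" for u
        by (rule nn_integral_mono_AE) (rule that)
      show ?thesis
        by (rule nn_integral_mono_AE) (use ne0 in eventually_elim, rule inner)
    qed
    also have "\<dots> = ennreal (C * \<rho> powr (-s)) * (ennreal k1 * ennreal k1)"
      by (simp add: nn_integral_cmult nn_integral_multc k1)
    also have "\<dots> = ennreal (C * k1 * k1 * \<rho> powr (-s))"
      using C0 k1(2) by (simp add: mult_ac flip: ennreal_mult)
    finally show ?thesis unfolding k_def .
  qed
  then show ?thesis using that[of "C * k1 * k1"] C0 k1(2) by auto
qed

section \<open>Supports and the mass distribution principle\<close>

lemma open_Compl_measure_support:
  assumes "sets M = sets borel"
  shows "open (- measure_support M)"
  unfolding open_contains_ball
proof
  fix x assume "x \<in> - measure_support M"
  then obtain e where e: "e > 0" "emeasure M (ball x e) = 0"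
    by (auto simp: measure_support_def zero_less_iff_neq_zero)
  have "y \<in> - measure_support M" if y: "y \<in> ball x (e / 2)" for y
  proof -
    have "ball y (e / 2) \<subseteq> ball x e"
    proof
      fix z assume "z \<in> ball y (e / 2)"
      then show "z \<in> ball x e" using y dist_triangle[of x z y] by simp
    qed
    then have "emeasure M (ball y (e / 2)) \<le> emeasure M (ball x e)"
      using assms by (intro emeasure_mono) auto
    then show ?thesis using e by (auto simp: measure_support_def not_less intro!: exI[of _ "e / 2"])
  qed
  then show "\<exists>e>0. ball x e \<subseteq> - measure_support M" using e by (intro exI[of _ "e / 2"]) auto
qed

text \<open>The complement of the support is covered by null balls, and countably many of them
  suffice by Lindelof's theorem.\<close>

lemma AE_in_measure_support:
  assumes "sets M = sets borel"
  shows "AE x in M. x \<in> measure_support M"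
proof -
  define F where "F = {ball x e | x e. e > 0 \<and> emeasure M (ball x e) = 0}"
  obtain F' where F': "F' \<subseteq> F" "countable F'" "\<Union>F' = \<Union>F"
    using Lindelof[of F] by (auto simp: F_def)
  have "- measure_support M \<subseteq> \<Union>F"
    by (force simp: F_def measure_support_def zero_less_iff_neq_zero)
  moreover have "(\<Union>B\<in>F'. B) \<in> null_sets M"
    using F' assms by (intro null_sets_UN') (auto simp: F_def null_sets_def)
  ultimately show ?thesis
    using F'(3) by (intro AE_I'[of "\<Union>F'"]) auto
qed

lemma dyadic_scale:
  fixes d :: real
  assumes "0 < d" "d \<le> 1"
  obtains k :: nat where "d \<le> (1/2) ^ k" "(1/2) ^ k < 2 * d"
proof -
  obtain n :: nat where n: "(1/2) ^ n < d" using real_arch_pow_inv[of d "1/2"] assms by auto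
  define m where "m = (LEAST n::nat. (1/2) ^ n < d)"
  have m: "(1/2) ^ m < d" unfolding m_def by (rule LeastI[of _ n]) (rule n)
  have "m \<noteq> 0" using m assms by (cases m) auto
  then obtain k where k: "m = Suc k" by (cases m) auto
  have "\<not> (1/2) ^ k < d" using not_less_Least[of k "\<lambda>n. (1/2) ^ n < d"] k unfolding m_def by auto
  then show ?thesis using m k by (intro that[of k]) auto
qed

text \<open>Smoothed ball masses at scale 2^(-k), weighted by 2^(kt) and summed over
  \<open>k\<close>, have finite integral since \<open>t < s\<close>. The sum \<open>h\<close> is
  thus finite almost everywhere, hence bounded on a set \<open>Z\<close> of positive measure, where
  it dominates each of its terms.\<close>

lemma energy_imp_ball_bound:
  assumes M: "prob_space M" "sets M = sets borel"
    and s: "0 < t" "t < s" "s < 2"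
    and decay: "\<And>\<xi>. \<xi> \<noteq> 0 \<Longrightarrow> (cmod (fourier_transform M \<xi>))\<^sup>2 * supnorm \<xi> powr s \<le> C"
  obtains Z B where "Z \<in> sets borel" "0 < emeasure M Z" "0 \<le> B"
    "\<And>x d. x \<in> Z \<Longrightarrow> 0 \<le> d \<Longrightarrow> d \<le> 1 \<Longrightarrow> emeasure M (cball x d) \<le> ennreal (B * d powr t)"
proof -
  interpret M: prob_space M by fact
  obtain K where K: "0 \<le> K" "\<And>\<rho>. 0 < \<rho> \<Longrightarrow>
    (\<integral>\<^sup>+x. \<integral>\<^sup>+y. ennreal (heat (\<rho> *\<^sub>R (x - y))) \<partial>M \<partial>M) \<le> ennreal (K * \<rho> powr (-s))"
    using fourier_decay_energy[OF M _ s(3) decay] s by auto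
  define g where "g k x = (\<integral>\<^sup>+y. ennreal (heat ((2 ^ k) *\<^sub>R (x - y))) \<partial>M)" for k :: nat and x
  have g_meas [measurable]: "g k \<in> borel_measurable borel" for k
  proof -
    have "(\<lambda>(x, y). ennreal (heat ((2 ^ k) *\<^sub>R (x - y)))) \<in> borel_measurable (borel \<Otimes>\<^sub>M borel)"
      by measurable
    moreover have "sets (borel \<Otimes>\<^sub>M M) = sets (borel \<Otimes>\<^sub>M borel)" using M by (intro sets_pair_measure_cong) auto
    ultimately have "(\<lambda>(x, y). ennreal (heat ((2 ^ k) *\<^sub>R (x - y)))) \<in> borel_measurable (borel \<Otimes>\<^sub>M M)"
      using measurable_cong_sets by blast
    then show ?thesis unfolding g_def by (rule M.borel_measurable_nn_integral)
  qed
  have gM: "g k \<in> borel_measurable M" for k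
    using g_meas unfolding measurable_cong_sets[OF M(2) refl] .
  define h where "h x = (\<Sum>k. ennreal ((2 ^ k) powr t) * g k x)" for x
  have h_meas [measurable]: "h \<in> borel_measurable borel" unfolding h_def by measurable
  have "(\<integral>\<^sup>+x. h x \<partial>M) = (\<Sum>k. \<integral>\<^sup>+x. ennreal ((2 ^ k) powr t) * g k x \<partial>M)"
    unfolding h_def by (rule nn_integral_suminf) (use gM in measurable)
  also have "\<dots> = (\<Sum>k. ennreal ((2 ^ k) powr t) * (\<integral>\<^sup>+x. g k x \<partial>M))"
    by (simp add: nn_integral_cmult[OF gM])
  also have "\<dots> \<le> (\<Sum>k. ennreal (K * (2 powr (t - s)) ^ k))"
  proof (rule suminf_le)
    fix k
    have "ennreal ((2 ^ k) powr t) * (\<integral>\<^sup>+x. g k x \<partial>M) \<le> ennreal ((2 ^ k) powr t) * ennreal (K * (2 ^ k) powr (-s))"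
      unfolding g_def by (intro mult_left_mono K(2)) auto
    also have "\<dots> = ennreal (K * ((2 ^ k) powr t * (2 ^ k) powr (-s)))"
      using K(1) by (simp add: mult_ac flip: ennreal_mult)
    also have "(2 ^ k) powr t * (2 ^ k) powr (-s) = (2 powr (t - s)) ^ k"
      by (simp flip: powr_add add: powr_power powr_powr powr_realpow[symmetric] algebra_simps)
    finally show "ennreal ((2 ^ k) powr t) * (\<integral>\<^sup>+x. g k x \<partial>M) \<le> ennreal (K * (2 powr (t - s)) ^ k)" .
  qed auto
  also have "\<dots> < \<infinity>"
  proof -
    have "2 powr (t - s) < 2 powr 0" using s by (intro powr_less_mono) auto
    then have "summable (\<lambda>k. K * (2 powr (t - s)) ^ k)" by (intro summable_mult summable_geometric) auto
    then show ?thesis using K(1) by (subst suminf_ennreal2) auto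
  qed
  finally have fin: "(\<integral>\<^sup>+x. h x \<partial>M) \<noteq> \<infinity>" by simp
  have hM: "h \<in> borel_measurable M" using h_meas unfolding measurable_cong_sets[OF M(2) refl] .
  have AEh: "AE x in M. h x \<noteq> \<infinity>" by (rule nn_integral_PInf_AE[OF hM fin])
  have "\<exists>n::nat. emeasure M {x. h x \<le> of_nat n} \<noteq> 0"
  proof (rule ccontr)
    assume "\<not> ?thesis"
    then have "(\<Union>n::nat. {x. h x \<le> of_nat n}) \<in> null_sets M"
      using M(2) by (intro null_sets_UN) (auto simp: null_sets_def)
    then have "AE x in M. x \<notin> (\<Union>n::nat. {x. h x \<le> of_nat n})" by (rule AE_not_in)
    with AEh have "AE x in M. False"
    proof eventually_elim
      case (elim x)
      then obtain n :: nat where "h x < of_nat n" using ennreal_Ex_less_of_nat[of "h x"] by (auto simp: less_top)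
      then show ?case using elim by (auto dest: less_imp_le)
    qed
    then show False by simp
  qed
  then obtain n :: nat where n: "emeasure M {x. h x \<le> of_nat n} \<noteq> 0" by blast
  define Z where "Z = {x. h x \<le> of_nat n}"
  \<comment> \<open>The minimum of \<open>heat\<close> over the closed unit disc, so that
    \<open>c\<close> times the indicator of the ball of radius 2^(-k) lies below the integrand of
    \<open>g k\<close>.\<close>
  define c where "c = exp (- 2 * pi\<^sup>2)"
  have c: "c > 0" by (simp add: c_def)
  have ball: "measure M (cball x ((1/2) ^ k)) \<le> n / c * ((1/2) ^ k) powr t" if x: "x \<in> Z" for x k
  proof -
    have "ennreal (c * measure M (cball x ((1/2) ^ k))) = (\<integral>\<^sup>+y. ennreal c * indicator (cball x ((1/2) ^ k)) y \<partial>M)"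
      using c M(2) by (subst nn_integral_cmult_indicator) (auto simp: M.emeasure_eq_measure ennreal_mult)
    also have "\<dots> \<le> g k x"
      unfolding g_def
    proof (rule nn_integral_mono)
      fix y
      show "ennreal c * indicator (cball x ((1/2) ^ k)) y \<le> ennreal (heat ((2 ^ k) *\<^sub>R (x - y)))"
      proof (cases "y \<in> cball x ((1/2) ^ k)")
        case True
        then have "2 ^ k * dist x y \<le> 1" by (simp add: field_simps)
        then have "cmod ((2 ^ k) *\<^sub>R (x - y)) \<le> 1" unfolding norm_scaleR dist_norm by simp
        then have "(cmod ((2 ^ k) *\<^sub>R (x - y)))\<^sup>2 \<le> 1" by (simp add: power_le_one)
        then have "2 * pi\<^sup>2 * (cmod ((2 ^ k) *\<^sub>R (x - y)))\<^sup>2 \<le> 2 * pi\<^sup>2 * 1" by (intro mult_left_mono) auto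
        then show ?thesis using True by (simp add: c_def ennreal_leI)
      qed simp
    qed
    finally have "ennreal (c * measure M (cball x ((1/2) ^ k))) \<le> g k x" .
    then have "ennreal ((2 ^ k) powr t) * ennreal (c * measure M (cball x ((1/2) ^ k))) \<le> ennreal ((2 ^ k) powr t) * g k x"
      by (intro mult_left_mono) auto
    also have "\<dots> \<le> h x"
      unfolding h_def using sum_le_suminf[of "\<lambda>k. ennreal ((2 ^ k) powr t) * g k x" "{k}"] by simp
    also have "\<dots> \<le> ennreal (real n)" using x by (simp add: Z_def ennreal_of_nat_eq_real_of_nat)
    finally have "(2 ^ k) powr t * (c * measure M (cball x ((1/2) ^ k))) \<le> real n"
      using c by (simp flip: ennreal_mult)
    moreover have "(2 ^ k) powr t * ((1/2) ^ k) powr t = (1::real)"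
      by (simp flip: powr_mult power_mult_distrib)
    ultimately have "(2 ^ k) powr t * (c * measure M (cball x ((1/2) ^ k))) \<le> (2 ^ k) powr t * (real n * ((1/2) ^ k) powr t)"
      by (simp add: mult_ac)
    then have "c * measure M (cball x ((1/2) ^ k)) \<le> real n * ((1/2) ^ k) powr t"
      by (subst (asm) mult_le_cancel_left_pos) auto
    then show ?thesis using c by (simp add: field_simps)
  qed
  define B where "B = n / c * 2 powr t"
  have B: "0 \<le> B" using c by (simp add: B_def)
  have "emeasure M (cball x d) \<le> ennreal (B * d powr t)" if x: "x \<in> Z" and d: "0 \<le> d" "d \<le> 1" for x d
  proof (cases "d = 0")
    \<comment> \<open>Here \<open>0 powr t = 0\<close>, so points of \<open>Z\<close> must have no
      mass. Letting the dyadic radius shrink gives this, as \<open>t > 0\<close>.\<close>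
    case True
    have "measure M (cball x 0) \<le> n / c * ((1/2) powr t) ^ k" for k
    proof -
      have "measure M (cball x 0) \<le> measure M (cball x ((1/2) ^ k))"
        using M(2) by (intro M.finite_measure_mono) auto
      also have "\<dots> \<le> n / c * ((1/2) ^ k) powr t" by (rule ball[OF x])
      also have "((1/2) ^ k) powr t = ((1/2) powr t) ^ k"
        by (simp add: powr_power powr_powr powr_realpow[symmetric] mult.commute)
      finally show ?thesis .
    qed
    moreover have "(\<lambda>k. n / c * ((1/2) powr t) ^ k) \<longlonglongrightarrow> n / c * 0"
      using s gr_one_powr[of 2 t] by (intro tendsto_intros LIMSEQ_power_zero) (simp add: powr_divide)
    ultimately have "measure M (cball x 0) \<le> n / c * 0" by (intro LIMSEQ_le_const[of _ "n / c * 0"]) auto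
    then show ?thesis using True by (simp add: M.emeasure_eq_measure measure_le_0_iff)
  next
    case False
    then obtain k :: nat where k: "d \<le> (1/2) ^ k" "(1/2) ^ k < 2 * d" using dyadic_scale[of d] d by auto
    have "measure M (cball x d) \<le> measure M (cball x ((1/2) ^ k))"
      using M(2) k by (intro M.finite_measure_mono) auto
    also have "\<dots> \<le> n / c * ((1/2) ^ k) powr t" by (rule ball[OF x])
    also have "\<dots> \<le> n / c * (2 * d) powr t"
      using c k s d by (intro mult_left_mono powr_mono2) auto
    also have "\<dots> = B * d powr t" using d by (simp add: B_def powr_mult)
    finally show ?thesis by (simp add: M.emeasure_eq_measure ennreal_leI)
  qed
  moreover have "Z \<in> sets borel" unfolding Z_def by measurable
  ultimately show ?thesis using that B n unfolding Z_def by (metis not_gr_zero)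
qed

text \<open>The mass distribution principle. A cover of \<open>A\<close> of small cost would leave
  \<open>Z\<close> with at most half of its mass, because each piece that meets \<open>Z\<close>
  lies in a ball about a point of \<open>Z\<close> whose radius is the diameter of the
  piece.\<close>

lemma hausdorff_measure_pos:
  assumes M: "M \<in> compact_prob_measures A"
    and s: "0 \<le> t" "t < s" "s \<le> 2"
    and decay: "\<And>\<xi>. \<xi> \<noteq> 0 \<Longrightarrow> (cmod (fourier_transform M \<xi>))\<^sup>2 * supnorm \<xi> powr s \<le> C"
  shows "hausdorff_measure t A \<noteq> 0"
proof
  assume null: "hausdorff_measure t A = 0"
  have M': "prob_space M" "sets M = sets borel" "measure_support M \<subseteq> A"
    using M by (auto simp: compact_prob_measures_def)
  interpret M: prob_space M by fact
  \<comment> \<open>The strictly positive exponent \<open>t'\<close> is needed for \<open>t = 0\<close>, where \<open>0 powr 0 = 0\<close> makes points free.\<close>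
  define s' where "s' = t + 2 * (s - t) / 3"
  define t' where "t' = t + (s - t) / 3"
  have st: "0 < t'" "t < t'" "t' < s'" "s' < s" "s' < 2" using s by (auto simp: s'_def t'_def field_simps)
  \<comment> \<open>Lowering \<open>s\<close> to \<open>s'\<close> keeps the decay: for small
    frequencies the transform is at most 1 in modulus, whence \<open>max C 1\<close>. The strict
    bound \<open>s' < 2\<close> that the energy estimate demands is thus available even for
    \<open>s = 2\<close>.\<close>
  have decay': "(cmod (fourier_transform M \<xi>))\<^sup>2 * supnorm \<xi> powr s' \<le> max C 1" if "\<xi> \<noteq> 0" for \<xi>
  proof (cases "supnorm \<xi> \<le> 1")
    case True
    have "(cmod (fourier_transform M \<xi>))\<^sup>2 * supnorm \<xi> powr s' \<le> 1 * 1"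
      using True st fourier_transform_norm_le_1[OF M'(1)]
      by (intro mult_mono) (auto simp: power_le_one powr_le1)
    then show ?thesis by simp
  next
    case False
    then have "(cmod (fourier_transform M \<xi>))\<^sup>2 * supnorm \<xi> powr s' \<le> (cmod (fourier_transform M \<xi>))\<^sup>2 * supnorm \<xi> powr s"
      using st by (intro mult_left_mono powr_mono) auto
    then show ?thesis using decay[OF that] by simp
  qed
  obtain Z B where Z: "Z \<in> sets borel" "0 < emeasure M Z" "0 \<le> B"
    "\<And>x d. x \<in> Z \<Longrightarrow> 0 \<le> d \<Longrightarrow> d \<le> 1 \<Longrightarrow> emeasure M (cball x d) \<le> ennreal (B * d powr t')"
    using energy_imp_ball_bound[OF M'(1,2) st(1,3,5) decay'] by blast
  define m where "m = measure M Z"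
  have m: "m > 0" using Z(2) by (simp add: m_def M.emeasure_eq_measure)
  define \<epsilon> where "\<epsilon> = m / (2 * (B + 1))"
  have e: "\<epsilon> > 0" using m Z(3) by (simp add: \<epsilon>_def)
  have "hausdorff_pre t 1 A \<le> hausdorff_measure t A"
    unfolding hausdorff_measure_def by (rule SUP_upper) auto
  then have "hausdorff_pre t 1 A < ennreal \<epsilon>" using null e by simp
  then obtain C where C: "A \<subseteq> (\<Union>n. C n)" "\<And>n. bounded (C n)" "\<And>n. diameter (C n) \<le> 1"
    "(\<Sum>n. ennreal (diameter (C n) powr t)) < ennreal \<epsilon>"
    unfolding hausdorff_pre_def INF_less_iff by auto
  \<comment> \<open>The ball bound is known only for centres in \<open>Z\<close>, so a piece is
    replaced by a ball about one of its points in \<open>Z\<close>, or by the empty set if there is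
    none.\<close>
  define x where "x n = (SOME x. x \<in> C n \<inter> Z)" for n
  define V where "V n = (if C n \<inter> Z = {} then {} else cball (x n) (diameter (C n)))" for n
  have xn: "x n \<in> C n \<inter> Z" if "C n \<inter> Z \<noteq> {}" for n
    unfolding x_def some_in_eq by (rule that)
  have V: "emeasure M (V n) \<le> ennreal B * ennreal (diameter (C n) powr t)" for n
  proof (cases "C n \<inter> Z = {}")
    case False
    have d0: "0 \<le> diameter (C n)" by (rule diameter_ge_0[OF C(2)])
    have "emeasure M (V n) \<le> ennreal (B * diameter (C n) powr t')"
      using False xn[OF False] C(3) d0 by (auto simp: V_def intro!: Z(4))
    also have "\<dots> \<le> ennreal (B * diameter (C n) powr t)"
      using Z(3) d0 C(3)[of n] st by (intro ennreal_leI mult_left_mono powr_mono') auto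
    finally show ?thesis using Z(3) by (simp add: ennreal_mult)
  qed (simp add: V_def)
  have Vs: "V n \<in> sets M" for n using M'(2) by (simp add: V_def)
  have cover: "Z \<inter> measure_support M \<subseteq> (\<Union>n. V n)"
  proof
    fix z assume z: "z \<in> Z \<inter> measure_support M"
    then obtain n where n: "z \<in> C n" using C(1) M'(3) by blast
    then have "C n \<inter> Z \<noteq> {}" using z by auto
    moreover have "dist (x n) z \<le> diameter (C n)"
      using n xn[OF calculation] by (intro diameter_bounded_bound C(2)) auto
    ultimately have "z \<in> V n" by (simp add: V_def)
    then show "z \<in> (\<Union>n. V n)" by auto
  qed
  have Zm: "Z \<in> sets M" using Z(1) M'(2) by simp
  have "emeasure M Z \<le> emeasure M (\<Union>n. V n)"
  proof (rule emeasure_mono_AE)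
    show "AE z in M. z \<in> Z \<longrightarrow> z \<in> (\<Union>n. V n)"
      using AE_in_measure_support[OF M'(2)] by eventually_elim (use cover in auto)
  qed (use Vs in auto)
  also have "\<dots> \<le> (\<Sum>n. emeasure M (V n))"
    by (rule emeasure_subadditive_countably) (use Vs in auto)
  also have "\<dots> \<le> (\<Sum>n. ennreal B * ennreal (diameter (C n) powr t))"
    by (intro suminf_le V) auto
  also have "\<dots> = ennreal B * (\<Sum>n. ennreal (diameter (C n) powr t))" by simp
  also have "\<dots> \<le> ennreal B * ennreal \<epsilon>" using C(4) by (intro mult_left_mono) auto
  also have "\<dots> = ennreal (B * \<epsilon>)" using Z(3) e by (simp add: ennreal_mult)
  finally have "m \<le> B * \<epsilon>" using Z(3) e by (simp add: m_def M.emeasure_eq_measure)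
  also have "\<dots> \<le> (B + 1) * \<epsilon>" using e by (intro mult_right_mono) auto
  also have "\<dots> = m / 2" using Z(3) by (simp add: \<epsilon>_def field_simps)
  finally show False using m by simp
qed

lemma fourier_dim_exponent_le_hausdorff_dim:
  assumes "M \<in> compact_prob_measures A" "s \<le> 2"
    and "\<And>\<xi>. \<xi> \<noteq> 0 \<Longrightarrow> (cmod (fourier_transform M \<xi>))\<^sup>2 * supnorm \<xi> powr s \<le> C"
  shows "s \<le> hausdorff_dim A"
  unfolding hausdorff_dim_def
proof (rule cInf_greatest)
  show "{s. 0 \<le> s \<and> hausdorff_measure s A = 0} \<noteq> {}"
    using hausdorff_measure_null_above_2[of 3 A] by (auto intro!: exI[of _ 3])
  fix t assume "t \<in> {s. 0 \<le> s \<and> hausdorff_measure s A = 0}"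
  then show "s \<le> t" using hausdorff_measure_pos[OF assms(1) _ _ assms(2,3)] by force
qed

section \<open>The divisor bound in the Gaussian integers\<close>

text \<open>Divisibility with a Gaussian cofactor. The relation \<open>dvd\<close> of the field
  \<open>complex\<close> would be trivial.\<close>

definition gdvd :: "complex \<Rightarrow> complex \<Rightarrow> bool" where
  "gdvd q k \<longleftrightarrow> (\<exists>m\<in>gauss_ints. k = q * m)"

lemma gdvd_refl [simp]: "gdvd k k"
  unfolding gdvd_def by (rule bexI[of _ 1]) auto

lemma gdvd_trans: "gdvd a b \<Longrightarrow> gdvd b c \<Longrightarrow> gdvd a c"
  unfolding gdvd_def by (auto simp: mult.assoc intro: bexI[of _ "_ * _"])

lemma gdvd_mult_right: "gdvd a b \<Longrightarrow> c \<in> gauss_ints \<Longrightarrow> gdvd a (b * c)"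
  unfolding gdvd_def by (auto simp: mult.assoc intro: bexI[of _ "_ * _"])

lemma gdvd_add: "gdvd a b \<Longrightarrow> gdvd a c \<Longrightarrow> gdvd a (b + c)"
  unfolding gdvd_def by (auto simp: distrib_left[symmetric] intro: bexI[of _ "_ + _"])

lemma gauss_power_closed [simp]: "z \<in> gauss_ints \<Longrightarrow> z ^ n \<in> gauss_ints"
  by (induction n) auto

text \<open>The norm is an integer, so passing to \<open>nat\<close> through the floor loses nothing
  and gives a measure for minimal choices and for induction.\<close>

lemma gauss_cmod_sq:
  assumes "z \<in> gauss_ints"
  shows "real (nat \<lfloor>(cmod z)\<^sup>2\<rfloor>) = (cmod z)\<^sup>2"
proof -
  have "(cmod z)\<^sup>2 \<in> \<int>" using assms by (auto simp: cmod_power2 gauss_ints_def)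
  then obtain i where "(cmod z)\<^sup>2 = of_int i" by (auto elim: Ints_cases)
  moreover have "0 \<le> (cmod z)\<^sup>2" by simp
  ultimately show ?thesis by (simp del: zero_le_power2)
qed

lemma gauss_cmod_less_iff:
  assumes "x \<in> gauss_ints" "y \<in> gauss_ints"
  shows "nat \<lfloor>(cmod x)\<^sup>2\<rfloor> < nat \<lfloor>(cmod y)\<^sup>2\<rfloor> \<longleftrightarrow> cmod x < cmod y"
proof -
  have "nat \<lfloor>(cmod x)\<^sup>2\<rfloor> < nat \<lfloor>(cmod y)\<^sup>2\<rfloor> \<longleftrightarrow> (cmod x)\<^sup>2 < (cmod y)\<^sup>2"
    by (metis assms gauss_cmod_sq of_nat_less_iff)
  also have "\<dots> \<longleftrightarrow> cmod x < cmod y"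
    by (meson norm_ge_zero not_le power_mono power_strict_mono pos2)
  finally show ?thesis .
qed

lemma gauss_cmod_ge_1:
  assumes "z \<in> gauss_ints" "z \<noteq> 0"
  shows "1 \<le> cmod z"
  using gauss_supnorm_ge_1[OF assms] supnorm_le_cmod[of z] by linarith

lemma gauss_cmod_gt_1:
  assumes "z \<in> gauss_ints" "1 < cmod z"
  shows "sqrt 2 \<le> cmod z"
proof -
  have "nat \<lfloor>(cmod 1)\<^sup>2\<rfloor> < nat \<lfloor>(cmod z)\<^sup>2\<rfloor>"
    using assms gauss_cmod_less_iff[of 1 z] by simp
  then have "2 \<le> real (nat \<lfloor>(cmod z)\<^sup>2\<rfloor>)" by simp
  then have "2 \<le> (cmod z)\<^sup>2" using gauss_cmod_sq[OF assms(1)] by simp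
  then show ?thesis by (simp add: real_le_lsqrt)
qed

lemma gdvd_cmod_le: "gdvd q k \<Longrightarrow> k \<noteq> 0 \<Longrightarrow> cmod q \<le> cmod k"
  unfolding gdvd_def
  by (auto simp: norm_mult intro!: mult_left_mono[of 1 _ "cmod q", simplified] gauss_cmod_ge_1)

lemma gauss_arg_min:
  assumes "x \<in> gauss_ints" "P x"
  obtains d where "d \<in> gauss_ints" "P d" "\<And>y. y \<in> gauss_ints \<Longrightarrow> P y \<Longrightarrow> cmod d \<le> cmod y"
proof -
  obtain d where d: "d \<in> gauss_ints \<and> P d"
    "\<forall>y. y \<in> gauss_ints \<and> P y \<longrightarrow> nat \<lfloor>(cmod d)\<^sup>2\<rfloor> \<le> nat \<lfloor>(cmod y)\<^sup>2\<rfloor>"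
    using ex_has_least_nat[of "\<lambda>x. x \<in> gauss_ints \<and> P x" x "\<lambda>x. nat \<lfloor>(cmod x)\<^sup>2\<rfloor>"] assms by auto
  show ?thesis
    using d gauss_cmod_less_iff by (intro that[of d]) (meson not_le)+
qed

text \<open>Rounding both coordinates of \<open>x / y\<close> leaves an error of squared modulus at
  most 1/2, which is below 1.\<close>

lemma gauss_division:
  assumes "x \<in> gauss_ints" "y \<in> gauss_ints" "y \<noteq> 0"
  obtains q where "q \<in> gauss_ints" "cmod (x - q * y) < cmod y"
proof -
  define q where "q = Complex (of_int (round (Re (x / y)))) (of_int (round (Im (x / y))))"
  have "\<bar>Re (x / y - q)\<bar> \<le> 1 / 2" "\<bar>Im (x / y - q)\<bar> \<le> 1 / 2"
    unfolding q_def minus_complex.simps complex.sel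
    using of_int_round_abs_le by (simp_all add: abs_minus_commute)
  then have "\<bar>Re (x / y - q)\<bar>\<^sup>2 \<le> (1/2)\<^sup>2" "\<bar>Im (x / y - q)\<bar>\<^sup>2 \<le> (1/2)\<^sup>2"
    by (intro power_mono; simp)+
  then have "(cmod (x / y - q))\<^sup>2 < 1\<^sup>2"
    unfolding cmod_power2 by (simp add: power2_eq_square)
  then have "cmod (x / y - q) < 1"
    by (rule power_less_imp_less_base) simp
  then have "cmod (x / y - q) * cmod y < cmod y" using assms by simp
  moreover have "(x / y - q) * y = x - q * y" using assms by (simp add: field_simps)
  ultimately have "cmod (x - q * y) < cmod y" by (metis norm_mult)
  then show ?thesis by (intro that[of q]) (auto simp: q_def gauss_ints_def)
qed

lemma gauss_unit:
  assumes "z \<in> gauss_ints" "z \<noteq> 0" "cmod z \<le> 1"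
  shows "z * cnj z = 1"
proof -
  have "cmod z = 1" using gauss_cmod_ge_1 assms by force
  then show ?thesis by (simp add: complex_norm_square[symmetric])
qed

text \<open>Euclid's argument. A nonzero element \<open>d\<close> of least modulus in the ideal
  generated by \<open>p\<close> and \<open>x\<close> divides both. If \<open>d\<close> is a unit,
  Bezout's identity multiplied by \<open>y\<close> shows that \<open>p\<close> divides
  \<open>y\<close>; otherwise the minimality of \<open>p\<close> among the nonunit divisors of
  \<open>k\<close> makes \<open>d\<close> an associate of \<open>p\<close>, which then divides
  \<open>x\<close>.\<close>

lemma gauss_min_divisor_prime:
  assumes p: "p \<in> gauss_ints" "1 < cmod p" "gdvd p k"
    and min: "\<And>d. d \<in> gauss_ints \<Longrightarrow> gdvd d k \<Longrightarrow> 1 < cmod d \<Longrightarrow> cmod p \<le> cmod d"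
    and xy: "x \<in> gauss_ints" "y \<in> gauss_ints" "gdvd p (x * y)"
  shows "gdvd p x \<or> gdvd p y"
proof -
  define I where "I z \<longleftrightarrow> (\<exists>a\<in>gauss_ints. \<exists>b\<in>gauss_ints. z = a * p + b * x)" for z
  have p0: "p \<noteq> 0" using p by auto
  have Ip: "I p" unfolding I_def by (rule bexI[of _ 1], rule bexI[of _ 0]) auto
  have Ix: "I x" unfolding I_def by (rule bexI[of _ 0], rule bexI[of _ 1]) auto
  obtain d where d: "d \<in> gauss_ints" "d \<noteq> 0 \<and> I d"
    "\<And>y. y \<in> gauss_ints \<Longrightarrow> y \<noteq> 0 \<and> I y \<Longrightarrow> cmod d \<le> cmod y"
    using gauss_arg_min[of p "\<lambda>z. z \<noteq> 0 \<and> I z"] p Ip p0 by blast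
  obtain a b where ab: "a \<in> gauss_ints" "b \<in> gauss_ints" "d = a * p + b * x"
    using d(2) by (auto simp: I_def)
  have dvd: "gdvd d w" if w: "w \<in> gauss_ints" "I w" for w
  proof -
    obtain q where q: "q \<in> gauss_ints" "cmod (w - q * d) < cmod d"
      using gauss_division[OF w(1) d(1)] d(2) by auto
    obtain a' b' where w': "a' \<in> gauss_ints" "b' \<in> gauss_ints" "w = a' * p + b' * x"
      using w(2) by (auto simp: I_def)
    have "I (w - q * d)"
      unfolding I_def w'(3) ab(3)
      by (rule bexI[of _ "a' - q * a"], rule bexI[of _ "b' - q * b"])
         (use w' ab q in \<open>auto simp: algebra_simps\<close>)
    then have "w - q * d = 0" using d(3)[of "w - q * d"] q(2) gauss_ints_closed(4)[OF w(1) gauss_ints_closed(5)[OF q(1) d(1)]] by linarith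
    then show ?thesis unfolding gdvd_def using q by (auto simp: mult.commute)
  qed
  have "gdvd d p" "gdvd d x" using dvd p xy Ip Ix by auto
  show ?thesis
  proof (cases "cmod d \<le> 1")
    case True
    then have "d * cnj d = 1" using gauss_unit d by auto
    then have "y = (d * cnj d) * y" by simp
    also have "\<dots> = p * (a * cnj d * y) + (x * y) * (b * cnj d)"
      by (simp add: ab(3) algebra_simps)
    finally have "y = p * (a * cnj d * y) + (x * y) * (b * cnj d)" .
    moreover have "gdvd p (p * (a * cnj d * y) + (x * y) * (b * cnj d))"
      by (rule gdvd_add[OF gdvd_mult_right[OF gdvd_refl] gdvd_mult_right[OF xy(3)]])
         (use xy(1,2) ab(1,2) d(1) in simp_all)
    ultimately show ?thesis by metis
  next
    case False
    then have le: "cmod p \<le> cmod d"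
      using min[OF d(1)] gdvd_trans[OF \<open>gdvd d p\<close> p(3)] by auto
    obtain m where m: "m \<in> gauss_ints" "p = d * m" using \<open>gdvd d p\<close> by (auto simp: gdvd_def)
    have "cmod d * cmod m \<le> cmod d * 1" using le m by (simp add: norm_mult)
    then have "cmod m \<le> 1" using d by (subst (asm) mult_le_cancel_left_pos) auto
    then have "m * cnj m = 1" using m p0 by (intro gauss_unit) auto
    then have "d = p * cnj m" using m by (simp add: mult.assoc)
    then have "gdvd p d" using m unfolding gdvd_def by auto
    then show ?thesis using \<open>gdvd d x\<close> gdvd_trans by blast
  qed
qed

section \<open>The number of divisors of a Gaussian integer\<close>

definition gdivisors :: "complex \<Rightarrow> complex set" where
  "gdivisors k = {q \<in> gauss_ints. gdvd q k}"

lemma finite_gdivisors: "k \<noteq> 0 \<Longrightarrow> finite (gdivisors k)"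
  unfolding gdivisors_def
  by (rule finite_subset[OF _ finite_gauss_bounded[of "cmod k"]])
     (auto intro: order_trans[OF supnorm_le_cmod gdvd_cmod_le])

text \<open>One factor \<open>p\<close> is cancelled at a time, either from the divisor or from its
  cofactor; primality ensures that one of the two contains it.\<close>

lemma gdvd_prime_power_mult:
  assumes p: "p \<in> gauss_ints" "p \<noteq> 0"
    and prime: "\<And>x y. x \<in> gauss_ints \<Longrightarrow> y \<in> gauss_ints \<Longrightarrow> gdvd p (x * y) \<Longrightarrow> gdvd p x \<or> gdvd p y"
    and "q \<in> gauss_ints" "k \<in> gauss_ints" "gdvd q (p ^ a * k)"
  shows "\<exists>b\<le>a. \<exists>q'\<in>gdivisors k. q = p ^ b * q'"
  using assms(4,6)
proof (induction a arbitrary: q)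
  case 0
  then show ?case by (auto simp: gdivisors_def)
next
  case (Suc a)
  obtain m where m: "m \<in> gauss_ints" "p ^ Suc a * k = q * m" using Suc.prems by (auto simp: gdvd_def)
  have "gdvd p (q * m)" unfolding m(2)[symmetric] gdvd_def
    using p assms(5) by (auto simp: mult.assoc intro!: bexI[of _ "p ^ a * k"])
  then consider "gdvd p q" | "gdvd p m" using prime m Suc.prems by blast
  then show ?case
  proof cases
    case 1
    then obtain q1 where q1: "q1 \<in> gauss_ints" "q = p * q1" by (auto simp: gdvd_def)
    then have "p ^ a * k = q1 * m" using m p by (simp add: mult.assoc)
    then have "gdvd q1 (p ^ a * k)" using m by (auto simp: gdvd_def)
    then obtain b q' where "b \<le> a" "q' \<in> gdivisors k" "q1 = p ^ b * q'" using Suc.IH q1 by blast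
    then show ?thesis using q1 by (intro exI[of _ "Suc b"]) (auto simp: mult.assoc)
  next
    case 2
    then obtain m1 where m1: "m1 \<in> gauss_ints" "m = p * m1" by (auto simp: gdvd_def)
    then have "p * (p ^ a * k) = p * (q * m1)" using m by (simp add: algebra_simps)
    then have "p ^ a * k = q * m1" using p by simp
    then have "gdvd q (p ^ a * k)" using m1 by (auto simp: gdvd_def)
    then show ?thesis using Suc.IH Suc.prems(1) by (meson le_SucI)
  qed
qed

text \<open>Induction on the norm, splitting off the full power \<open>p ^ a\<close> of a least
  nonunit divisor, which multiplies the count by at most \<open>a + 1\<close>. For \<open>p\<close>
  outside \<open>S\<close> this is at most |p|^(a\<epsilon>), since |p|^\<epsilon> >= 2. Inside
  \<open>S\<close> a factor \<open>C\<close> is needed in addition, paid once for each element of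
  \<open>S\<close> that divides \<open>k\<close>, so at most \<open>card S\<close> times.
  \<open>U\<close> bounds the number of units.\<close>

lemma gauss_divisor_bound_aux:
  fixes U C :: real
  assumes eps: "\<epsilon> > 0" and C: "C \<ge> 1" "\<And>a::nat. real a + 1 \<le> C * (sqrt 2 powr \<epsilon>) ^ a"
    and S: "S = {p \<in> gauss_ints. supnorm p \<le> 2 powr (1/\<epsilon>)}"
    and U: "U = real (card {p \<in> gauss_ints. supnorm p \<le> 1})"
    and k: "k \<in> gauss_ints" "k \<noteq> 0"
  shows "real (card (gdivisors k)) \<le> U * C ^ card {p \<in> S. gdvd p k} * cmod k powr \<epsilon>"
  using k
proof (induction "nat \<lfloor>(cmod k)\<^sup>2\<rfloor>" arbitrary: k rule: less_induct)
  case less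
  note k = less.prems
  have finS: "finite S" unfolding S by (rule finite_gauss_bounded)
  have U0: "U \<ge> 0" by (simp add: U)
  show ?case
  proof (cases "cmod k \<le> 1")
    case True
    then have k1: "cmod k = 1" using gauss_cmod_ge_1[OF k] by simp
    have "card (gdivisors k) \<le> card {p \<in> gauss_ints. supnorm p \<le> 1}"
      using gdvd_cmod_le[OF _ k(2)] k1
      by (intro card_mono finite_gauss_bounded) (auto simp: gdivisors_def intro: order_trans[OF supnorm_le_cmod])
    then have "real (card (gdivisors k)) \<le> U * 1" by (simp add: U)
    also have "\<dots> \<le> U * C ^ card {p \<in> S. gdvd p k}"
      using U0 C by (intro mult_left_mono) auto
    finally show ?thesis by (simp add: k1)
  next
    case False
    obtain p where p: "p \<in> gauss_ints" "gdvd p k \<and> 1 < cmod p"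
      "\<And>d. d \<in> gauss_ints \<Longrightarrow> gdvd d k \<and> 1 < cmod d \<Longrightarrow> cmod p \<le> cmod d"
      using gauss_arg_min[of k "\<lambda>d. gdvd d k \<and> 1 < cmod d"] k False by auto
    have p0: "p \<noteq> 0" using p by auto
    have prime: "gdvd p x \<or> gdvd p y" if "x \<in> gauss_ints" "y \<in> gauss_ints" "gdvd p (x * y)" for x y
      using gauss_min_divisor_prime[of p k x y] p that by auto
    obtain N :: nat where N: "cmod k < cmod p ^ N" using real_arch_pow p by blast
    have bound: "n \<le> N" if "gdvd (p ^ n) k" for n
    proof (rule ccontr)
      assume "\<not> n \<le> N"
      then have "cmod p ^ N \<le> cmod p ^ n" using p by (intro power_increasing) auto
      also have "\<dots> \<le> cmod k" using gdvd_cmod_le[OF that k(2)] by (simp add: norm_power)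
      finally show False using N by simp
    qed
    \<comment> \<open>The multiplicity of \<open>p\<close> in \<open>k\<close>. Removing all of it
      leaves a \<open>k'\<close> that \<open>p\<close> does not divide, so that \<open>p\<close> is
      no longer counted for \<open>k'\<close> and the exponent of \<open>C\<close> drops.\<close>
    define a where "a = (GREATEST n. gdvd (p ^ n) k)"
    have a: "gdvd (p ^ a) k" unfolding a_def
      by (rule GreatestI_nat[of _ 1 N]) (use p bound in auto)
    have max: "n \<le> a" if "gdvd (p ^ n) k" for n unfolding a_def
      by (rule Greatest_le_nat[of _ _ N]) (use that bound in auto)
    have a1: "1 \<le> a" using max[of 1] p by simp
    obtain k' where k': "k' \<in> gauss_ints" "k = p ^ a * k'" using a by (auto simp: gdvd_def)
    have k'0: "k' \<noteq> 0" using k k' by auto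
    have ndvd: "\<not> gdvd p k'"
    proof
      assume "gdvd p k'"
      then obtain m where "m \<in> gauss_ints" "k' = p * m" by (auto simp: gdvd_def)
      then have "gdvd (p ^ Suc a) k" using k' by (auto simp: gdvd_def mult_ac)
      then show False using max[of "Suc a"] by simp
    qed
    have "1 < cmod p ^ a" using p a1 by (intro one_less_power) auto
    then have "cmod k' < cmod k"
      using k'0 unfolding k'(2) norm_mult norm_power by simp
    then have IH: "real (card (gdivisors k')) \<le> U * C ^ card {p \<in> S. gdvd p k'} * cmod k' powr \<epsilon>"
      using gauss_cmod_less_iff k k' k'0 by (intro less.hyps) auto
    have sub: "{q \<in> S. gdvd q k'} \<subseteq> {q \<in> S. gdvd q k}"
    proof -
      have "gdvd k' k" unfolding gdvd_def k'(2) using p by (auto simp: mult.commute intro!: bexI[of _ "p ^ a"])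
      then show ?thesis using gdvd_trans by blast
    qed
    have "gdivisors k \<subseteq> (\<lambda>(b, q). p ^ b * q) ` ({..a} \<times> gdivisors k')"
    proof
      fix q assume "q \<in> gdivisors k"
      then have "q \<in> gauss_ints" "gdvd q (p ^ a * k')" using k' by (auto simp: gdivisors_def)
      then obtain b q' where "b \<le> a" "q' \<in> gdivisors k'" "q = p ^ b * q'"
        using gdvd_prime_power_mult[OF p(1) p0 prime _ k'(1)] by blast
      then show "q \<in> (\<lambda>(b, q). p ^ b * q) ` ({..a} \<times> gdivisors k')" by force
    qed
    then have "card (gdivisors k) \<le> card ({..a} \<times> gdivisors k')"
      using finite_gdivisors[OF k'0] by (intro surj_card_le) auto
    then have "card (gdivisors k) \<le> (a + 1) * card (gdivisors k')" by (simp add: card_cartesian_product)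
    then have "real (card (gdivisors k)) \<le> (real a + 1) * real (card (gdivisors k'))"
      by (metis of_nat_1 of_nat_add of_nat_le_iff of_nat_mult)
    also have "\<dots> \<le> (real a + 1) * (U * C ^ card {p \<in> S. gdvd p k'} * cmod k' powr \<epsilon>)"
      by (intro mult_left_mono IH) auto
    finally have 1: "real (card (gdivisors k)) \<le> U * ((real a + 1) * C ^ card {p \<in> S. gdvd p k'}) * cmod k' powr \<epsilon>"
      by (simp add: mult_ac)
    have 2: "(real a + 1) * C ^ card {p \<in> S. gdvd p k'} \<le> C ^ card {p \<in> S. gdvd p k} * (cmod p powr \<epsilon>) ^ a"
    proof (cases "p \<in> S")
      case True
      have "{q \<in> S. gdvd q k'} \<subset> {q \<in> S. gdvd q k}" using sub True ndvd p by blast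
      then have "card {q \<in> S. gdvd q k'} < card {q \<in> S. gdvd q k}" using finS by (intro psubset_card_mono) auto
      then have "C * C ^ card {p \<in> S. gdvd p k'} \<le> C ^ card {q \<in> S. gdvd q k}"
        unfolding power_Suc[symmetric] using C by (intro power_increasing) auto
      moreover have "real a + 1 \<le> C * (cmod p powr \<epsilon>) ^ a"
      proof -
        have "(sqrt 2 powr \<epsilon>) ^ a \<le> (cmod p powr \<epsilon>) ^ a"
          using gauss_cmod_gt_1[OF p(1)] p eps by (intro power_mono powr_mono2) auto
        then show ?thesis using C(2)[of a] C(1) by (meson mult_left_mono order_trans zero_le_one)
      qed
      ultimately have "(C * C ^ card {p \<in> S. gdvd p k'}) * (real a + 1) \<le> C ^ card {q \<in> S. gdvd q k} * (C * (cmod p powr \<epsilon>) ^ a)"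
        using C by (intro mult_mono) auto
      then have "C * ((real a + 1) * C ^ card {p \<in> S. gdvd p k'}) \<le> C * (C ^ card {q \<in> S. gdvd q k} * (cmod p powr \<epsilon>) ^ a)"
        by (simp add: mult_ac)
      then show ?thesis using C by (subst (asm) mult_le_cancel_left_pos) auto
    next
      case False
      then have "2 powr (1/\<epsilon>) < cmod p" using p(1) supnorm_le_cmod[of p] unfolding S by auto
      then have "(2 powr (1/\<epsilon>)) powr \<epsilon> \<le> cmod p powr \<epsilon>" using eps by (intro powr_mono2) auto
      then have "2 \<le> cmod p powr \<epsilon>" using eps by (simp add: powr_powr)
      then have "2 ^ a \<le> (cmod p powr \<epsilon>) ^ a" by (intro power_mono) auto
      moreover have "real a + 1 \<le> 2 ^ a"
        using Bernoulli_inequality[of 1 a] by (simp add: add.commute)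
      ultimately have "real a + 1 \<le> (cmod p powr \<epsilon>) ^ a" by linarith
      moreover have "C ^ card {p \<in> S. gdvd p k'} \<le> C ^ card {p \<in> S. gdvd p k}"
        using sub finS C by (intro power_increasing card_mono) auto
      ultimately have "(real a + 1) * C ^ card {p \<in> S. gdvd p k'} \<le> (cmod p powr \<epsilon>) ^ a * C ^ card {p \<in> S. gdvd p k}"
        using C by (intro mult_mono) auto
      then show ?thesis by (simp add: mult.commute)
    qed
    have "real (card (gdivisors k)) \<le> U * (C ^ card {p \<in> S. gdvd p k} * (cmod p powr \<epsilon>) ^ a) * cmod k' powr \<epsilon>"
      using 1 2 U0 by (meson mult_left_mono mult_right_mono order_trans powr_ge_zero)
    also have "\<dots> = U * C ^ card {p \<in> S. gdvd p k} * ((cmod p powr \<epsilon>) ^ a * cmod k' powr \<epsilon>)"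
      by (simp only: mult.assoc)
    also have "(cmod p powr \<epsilon>) ^ a = (cmod p ^ a) powr \<epsilon>"
      using p0 by (simp add: powr_powr mult.commute flip: powr_realpow)
    also have "(cmod p ^ a) powr \<epsilon> * cmod k' powr \<epsilon> = cmod k powr \<epsilon>"
      by (simp add: k'(2) norm_mult norm_power powr_mult)
    finally show ?thesis .
  qed
qed

lemma gauss_divisor_bound:
  assumes "\<epsilon> > 0"
  obtains D :: real where "0 \<le> D" "\<And>k. k \<in> gauss_ints \<Longrightarrow> k \<noteq> 0 \<Longrightarrow> real (card (gdivisors k)) \<le> D * cmod k powr \<epsilon>"
proof -
  \<comment> \<open>\<open>sqrt 2\<close> bounds the modulus of every nonunit from below. By
    Bernoulli's inequality its powers grow at least like \<open>1 + a * x\<close>, and a factor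
    \<open>C\<close> with \<open>C \<ge> 1\<close> and \<open>C * x \<ge> 1\<close> lifts this above
    \<open>a + 1\<close>.\<close>
  define x where "x = sqrt 2 powr \<epsilon> - 1"
  have x: "x > 0" using assms by (simp add: x_def)
  define C where "C = max 1 (1 / x)"
  have C: "C \<ge> 1" "C * x \<ge> 1" using x by (auto simp: C_def field_simps max_def)
  have Ca: "real a + 1 \<le> C * (sqrt 2 powr \<epsilon>) ^ a" for a :: nat
  proof -
    have "1 + real a * x \<le> (sqrt 2 powr \<epsilon>) ^ a"
      using Bernoulli_inequality[of x a] x by (simp add: x_def)
    then have "C * (1 + real a * x) \<le> C * (sqrt 2 powr \<epsilon>) ^ a" using C by (intro mult_left_mono) auto
    moreover have "C * (1 + real a * x) = C + real a * (C * x)" by (simp add: algebra_simps)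
    moreover have "real a * 1 \<le> real a * (C * x)" using C by (intro mult_left_mono) auto
    ultimately show ?thesis using C by linarith
  qed
  define S where "S = {p \<in> gauss_ints. supnorm p \<le> 2 powr (1/\<epsilon>)}"
  define U where "U = real (card {p \<in> gauss_ints. supnorm p \<le> 1})"
  have finS: "finite S" unfolding S_def by (rule finite_gauss_bounded)
  show ?thesis
  proof (rule that[of "U * C ^ card S"])
    show "0 \<le> U * C ^ card S" using C by (simp add: U_def)
    fix k assume k: "k \<in> gauss_ints" "k \<noteq> 0"
    have "real (card (gdivisors k)) \<le> U * C ^ card {p \<in> S. gdvd p k} * cmod k powr \<epsilon>"
      using gauss_divisor_bound_aux[OF assms C(1) Ca S_def U_def k] .
    also have "\<dots> \<le> U * C ^ card S * cmod k powr \<epsilon>"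
      using C finS by (intro mult_right_mono mult_left_mono power_increasing card_mono) (auto simp: U_def)
    finally show "real (card (gdivisors k)) \<le> U * C ^ card S * cmod k powr \<epsilon>" .
  qed
qed

section \<open>Weak limits in the plane\<close>

text \<open>Even, of period 2, equal to 0 on [0, 1/3] and to 1 on [2/3, 1], because the cosine takes
  the values 1/2 and -1/2 at pi/3 and 2 pi/3. On [0, 1] it thus detects whether the leading ternary
  digit is 0 or 2.\<close>

definition zigzag :: "real \<Rightarrow> real" where
  "zigzag t = max 0 (min 1 (1/2 - cos (pi * t)))"

text \<open>Schoenberg's space-filling curve: the even and the odd ternary digits of \<open>t\<close> are read
  off as the binary digits of the two coordinates.\<close>
definition schoenberg :: "nat \<Rightarrow> real \<Rightarrow> real" where
  "schoenberg j t = (\<Sum>k. zigzag (3 ^ (2 * k + j) * t) / 2 ^ Suc k)"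

lemma continuous_schoenberg: "continuous_on UNIV (schoenberg j)"
proof -
  have "uniform_limit UNIV (\<lambda>n t. \<Sum>k<n. zigzag (3 ^ (2 * k + j) * t) / 2 ^ Suc k)
     (\<lambda>t. \<Sum>k. zigzag (3 ^ (2 * k + j) * t) / 2 ^ Suc k) sequentially"
  proof (rule Weierstrass_m_test)
    show "norm (zigzag (3 ^ (2 * k + j) * t) / 2 ^ Suc k) \<le> (1/2) ^ Suc k" for k t
      by (simp add: zigzag_def field_simps)
    show "summable (\<lambda>k. (1/2) ^ Suc k :: real)"
      by (subst summable_Suc_iff) (simp add: summable_geometric)
  qed
  moreover have "continuous_on UNIV (\<lambda>t. \<Sum>k<n. zigzag (3 ^ (2 * k + j) * t) / 2 ^ Suc k)" for n
    unfolding zigzag_def by (intro continuous_intros) auto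
  ultimately show ?thesis
    unfolding schoenberg_def by (intro uniform_limit_theorem[where F = sequentially]) auto
qed

lemma zigzag_digit:
  assumes "c = (0::real) \<or> c = 1" "0 \<le> u" "u \<le> 1"
  shows "zigzag (2 * of_int N + 2 * c / 3 + u / 3) = c"
proof -
  define v where "v = 2 * c / 3 + u / 3"
  have "cos (pi * (2 * of_int N + 2 * c / 3 + u / 3)) = cos (pi * v + 2 * pi * of_int N)"
    by (simp add: v_def algebra_simps)
  also have "\<dots> = cos (pi * v)"
    unfolding cos_add by simp
  finally have eq: "cos (pi * (2 * of_int N + 2 * c / 3 + u / 3)) = cos (pi * v)" .
  consider "c = 0" | "c = 1" using assms by auto
  then show ?thesis
  proof cases
    case 1
    then have "0 \<le> pi * v" "pi * v \<le> pi / 3" using assms by (auto simp: v_def)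
    then have "cos (pi / 3) \<le> cos (pi * v)" by (intro cos_monotone_0_pi_le) auto
    then show ?thesis using 1 unfolding zigzag_def eq by (simp add: cos_60)
  next
    case 2
    then have "2 * (pi / 3) \<le> pi * v" "pi * v \<le> pi" using assms by (auto simp: v_def)
    then have "cos (pi * v) \<le> cos (2 * (pi / 3))" by (intro cos_monotone_0_pi_le) auto
    also have "\<dots> = - (1/2)" by (simp add: cos_120)
    finally show ?thesis using 2 unfolding zigzag_def eq by simp
  qed
qed

text \<open>The witness has the ternary digits \<open>2 * c i\<close>. Multiplication by
  \<open>3 ^ k\<close> shifts them, and the integer that splits off is even because all digits are,
  so that \<open>zigzag\<close>, of period 2, sees only the tail.\<close>

lemma ternary_digits:
  fixes c :: "nat \<Rightarrow> real"
  assumes c: "\<And>i. c i = 0 \<or> c i = 1"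
  obtains t where "0 \<le> t" "t \<le> 1" "\<And>k. zigzag (3 ^ k * t) = c k"
proof -
  define T where "T k = (\<Sum>i. 2 * c (i + k) / 3 ^ Suc i)" for k
  have c01: "0 \<le> c i" "c i \<le> 1" for i using c[of i] by auto
  have geo: "(\<lambda>i. 2 * (1/3) ^ Suc i) sums (1::real)"
  proof -
    have "(\<lambda>i. (2/3) * (1/3) ^ i) sums ((2/3) * (1 / (1 - 1/3)) :: real)"
      by (intro sums_mult geometric_sums) simp
    then show ?thesis by simp
  qed
  have le: "2 * c i / 3 ^ Suc j \<le> 2 * (1/3) ^ Suc j" for i j
    using c01[of i] by (simp add: field_simps)
  have summ: "summable (\<lambda>i. 2 * c (i + k) / 3 ^ Suc i)" for k
    using le c01 by (intro summable_comparison_test'[OF sums_summable[OF geo], of 0]) auto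
  have T01: "0 \<le> T k" "T k \<le> 1" for k
  proof -
    show "0 \<le> T k" unfolding T_def using c01 summ by (intro suminf_nonneg) auto
    have "T k \<le> (\<Sum>i. 2 * (1/3) ^ Suc i)"
      unfolding T_def by (intro suminf_le le summ sums_summable[OF geo])
    then show "T k \<le> 1" using sums_unique[OF geo] by simp
  qed
  have rec: "T k = 2 * c k / 3 + T (Suc k) / 3" for k
  proof -
    have "T k = 2 * c (0 + k) / 3 ^ Suc 0 + (\<Sum>i. 2 * c (Suc i + k) / 3 ^ Suc (Suc i))"
      unfolding T_def using suminf_split_head[OF summ[of k]] by simp
    also have "(\<Sum>i. 2 * c (Suc i + k) / 3 ^ Suc (Suc i)) = (\<Sum>i. 2 * c (i + Suc k) / 3 ^ Suc i / 3)"
      by (intro suminf_cong) simp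
    also have "\<dots> = T (Suc k) / 3"
      unfolding T_def by (rule suminf_divide[OF summ])
    finally show ?thesis by simp
  qed
  have "\<exists>N. 3 ^ k * T 0 = 2 * of_int N + T k" for k
  proof (induction k)
    case 0
    show ?case by (rule exI[of _ 0]) simp
  next
    case (Suc k)
    then obtain N where "3 ^ k * T 0 = 2 * of_int N + T k" by blast
    then have "3 ^ Suc k * T 0 = 3 * (2 * of_int N + T k)" by (simp only: power_Suc mult.assoc)
    also have "\<dots> = 2 * (3 * of_int N + c k) + T (Suc k)" using rec[of k] by simp
    finally have "3 ^ Suc k * T 0 = 2 * (3 * of_int N + c k) + T (Suc k)" .
    then show ?case using c[of k]
      by (intro exI[of _ "3 * N + (if c k = 0 then 0 else 1)"]) auto
  qed
  then have "zigzag (3 ^ k * T 0) = c k" for k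
    using zigzag_digit[OF c T01] by (metis rec add.assoc)
  then show ?thesis using that T01 by blast
qed

lemma binary_digits:
  fixes x :: real
  assumes "0 \<le> x" "x < 1"
  obtains c where "\<And>i. c i = 0 \<or> c i = (1::real)" "(\<lambda>k. c k / 2 ^ Suc k) sums x"
proof -
  define c where "c i = real_of_int (\<lfloor>2 ^ Suc i * x\<rfloor> - 2 * \<lfloor>2 ^ i * x\<rfloor>)" for i
  have c01: "c i = 0 \<or> c i = 1" for i
  proof -
    have "0 \<le> \<lfloor>2 ^ Suc i * x\<rfloor> - 2 * \<lfloor>2 ^ i * x\<rfloor>" "\<lfloor>2 ^ Suc i * x\<rfloor> - 2 * \<lfloor>2 ^ i * x\<rfloor> \<le> 1"
      unfolding power_Suc mult.assoc by linarith+
    then have "\<lfloor>2 ^ Suc i * x\<rfloor> - 2 * \<lfloor>2 ^ i * x\<rfloor> = 0 \<or> \<lfloor>2 ^ Suc i * x\<rfloor> - 2 * \<lfloor>2 ^ i * x\<rfloor> = 1" by linarith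
    then show ?thesis unfolding c_def by (auto simp del: of_int_diff)
  qed
  \<comment> \<open>The digits telescope to the dyadic truncations of \<open>x\<close>.\<close>
  have part: "(\<Sum>k<n. c k / 2 ^ Suc k) = real_of_int \<lfloor>2 ^ n * x\<rfloor> / 2 ^ n" for n
  proof (induction n)
    case 0
    then show ?case using assms by (simp add: floor_eq_iff)
  next
    case (Suc n)
    then show ?case by (simp add: c_def field_simps)
  qed
  have "(\<lambda>n. real_of_int \<lfloor>2 ^ n * x\<rfloor> / 2 ^ n) \<longlonglongrightarrow> x"
  proof (rule tendsto_sandwich)
    show "\<forall>\<^sub>F n in sequentially. x - (1/2) ^ n \<le> real_of_int \<lfloor>2 ^ n * x\<rfloor> / 2 ^ n"
    proof (rule always_eventually, rule allI)
      fix n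
      have "2 ^ n * x - 1 \<le> real_of_int \<lfloor>2 ^ n * x\<rfloor>" by linarith
      then have "(2 ^ n * x - 1) / 2 ^ n \<le> real_of_int \<lfloor>2 ^ n * x\<rfloor> / 2 ^ n" by (intro divide_right_mono) auto
      then show "x - (1/2) ^ n \<le> real_of_int \<lfloor>2 ^ n * x\<rfloor> / 2 ^ n" by (simp add: diff_divide_distrib power_divide)
    qed
    show "\<forall>\<^sub>F n in sequentially. real_of_int \<lfloor>2 ^ n * x\<rfloor> / 2 ^ n \<le> x"
      by (rule always_eventually) (simp add: field_simps)
    have "(\<lambda>n. x - (1/2) ^ n) \<longlonglongrightarrow> x - 0"
      by (intro tendsto_intros LIMSEQ_power_zero) simp
    then show "(\<lambda>n. x - (1/2) ^ n) \<longlonglongrightarrow> x" by simp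
  qed simp
  then have "(\<lambda>k. c k / 2 ^ Suc k) sums x" unfolding sums_def part .
  then show ?thesis using that c01 by blast
qed

lemma space_filling_curve:
  obtains h :: "real \<Rightarrow> complex" where "continuous_on UNIV h" "{z. supnorm z \<le> 1/2} \<subseteq> h ` {0..1}"
proof
  \<comment> \<open>The curve is stretched so that on the target square
    \<open>(Re z + 1) / 2\<close> and \<open>(Im z + 1) / 2\<close> lie in [1/4, 3/4], away from the
    endpoint 1 that \<open>binary_digits\<close> excludes.\<close>
  define h where "h t = Complex (2 * schoenberg 0 t - 1) (2 * schoenberg 1 t - 1)" for t
  show "continuous_on UNIV h"
    unfolding h_def by (intro continuous_intros continuous_schoenberg)
  show "{z. supnorm z \<le> 1/2} \<subseteq> h ` {0..1}"
  proof
    fix z assume "z \<in> {z. supnorm z \<le> 1/2}"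
    then have z: "\<bar>Re z\<bar> \<le> 1/2" "\<bar>Im z\<bar> \<le> 1/2" by (auto simp: supnorm_def)
    have "0 \<le> (Re z + 1) / 2" "(Re z + 1) / 2 < 1" using z unfolding abs_le_iff by auto
    then obtain a where a: "\<And>i. a i = 0 \<or> a i = (1::real)" "(\<lambda>k. a k / 2 ^ Suc k) sums ((Re z + 1) / 2)"
      using binary_digits by metis
    have "0 \<le> (Im z + 1) / 2" "(Im z + 1) / 2 < 1" using z unfolding abs_le_iff by auto
    then obtain b where b: "\<And>i. b i = 0 \<or> b i = (1::real)" "(\<lambda>k. b k / 2 ^ Suc k) sums ((Im z + 1) / 2)"
      using binary_digits by metis
    define c where "c i = (if even i then a (i div 2) else b (i div 2))" for i
    obtain t where t: "0 \<le> t" "t \<le> 1" "\<And>k. zigzag (3 ^ k * t) = c k"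
      using ternary_digits[of c] a(1) b(1) unfolding c_def by metis
    have "schoenberg 0 t = (Re z + 1) / 2" "schoenberg 1 t = (Im z + 1) / 2"
      unfolding schoenberg_def t(3) using sums_unique[OF a(2)] sums_unique[OF b(2)] by (simp_all add: c_def)
    then have "h t = z" by (auto simp: h_def complex_eq_iff)
    then show "z \<in> h ` {0..1}" using t by auto
  qed
qed

text \<open>The least preimage is selected. A sublevel set of \<open>g\<close> is then the
  continuous image of a compact set, hence closed, together with the complement of the range if
  \<open>c\<close> is nonnegative.\<close>

lemma borel_right_inverse:
  fixes h :: "real \<Rightarrow> 'a :: t2_space"
  assumes h: "continuous_on UNIV h"
  obtains g where "g \<in> borel_measurable borel" "\<And>x. g x \<in> {0..1}"
    "\<And>x. x \<in> h ` {0..1} \<Longrightarrow> h (g x) = x"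
proof -
  define g where "g x = (if x \<in> h ` {0..1} then Inf {t \<in> {0..1}. h t = x} else 0)" for x
  have min: "g x \<in> {t \<in> {0..1}. h t = x}" "\<And>t. t \<in> {0..1} \<Longrightarrow> h t = x \<Longrightarrow> g x \<le> t"
    if x: "x \<in> h ` {0..1}" for x
  proof -
    have "closed ({0..1} \<inter> h -` {x})"
      using h by (intro closed_Int continuous_closed_vimage) (auto simp: continuous_on_eq_continuous_at)
    moreover have "{0..1} \<inter> h -` {x} = {t \<in> {0..1}. h t = x}" by auto
    ultimately have cl: "closed {t \<in> {0..1}. h t = x}" by simp
    have bb: "bdd_below {t \<in> {0..1}. h t = x}" by (rule bdd_belowI[of _ 0]) auto
    show "g x \<in> {t \<in> {0..1}. h t = x}"
    proof -
      have "{t \<in> {0..1}. h t = x} \<noteq> {}" using x by auto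
      then have "Inf {t \<in> {0..1}. h t = x} \<in> {t \<in> {0..1}. h t = x}"
        by (rule closed_contains_Inf[OF _ bb cl])
      then show ?thesis using x unfolding g_def by simp
    qed
    show "g x \<le> t" if "t \<in> {0..1}" "h t = x" for t
      using that x bb unfolding g_def by (auto intro: cInf_lower)
  qed
  have "g x \<in> {0..1}" for x
    using min(1)[of x] by (cases "x \<in> h ` {0..1}") (blast, simp add: g_def)
  moreover have "h (g x) = x" if "x \<in> h ` {0..1}" for x using min(1)[OF that] by auto
  moreover have "g \<in> borel_measurable borel"
  proof (rule borel_measurableI_le)
    fix c
    have "{x \<in> space borel. g x \<le> c} = h ` ({0..1} \<inter> {..c}) \<union> (if 0 \<le> c then - (h ` {0..1}) else {})"
    proof (intro set_eqI iffI)
      fix x assume "x \<in> {x \<in> space borel. g x \<le> c}"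
      then have c: "g x \<le> c" by simp
      show "x \<in> h ` ({0..1} \<inter> {..c}) \<union> (if 0 \<le> c then - (h ` {0..1}) else {})"
      proof (cases "x \<in> h ` {0..1}")
        case True
        then have "g x \<in> {0..1} \<inter> {..c}" "x = h (g x)" using min(1)[of x] c by auto
        then have "x \<in> h ` ({0..1} \<inter> {..c})" by (rule rev_image_eqI)
        then show ?thesis by (rule UnI1)
      next
        case False
        then show ?thesis using c by (simp add: g_def)
      qed
    next
      fix x assume "x \<in> h ` ({0..1} \<inter> {..c}) \<union> (if 0 \<le> c then - (h ` {0..1}) else {})"
      then consider t where "t \<in> {0..1}" "t \<le> c" "x = h t" | "0 \<le> c" "x \<notin> h ` {0..1}"
        by (auto split: if_splits)
      then show "x \<in> {x \<in> space borel. g x \<le> c}"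
      proof cases
        case 1
        then have "x \<in> h ` {0..1}" by simp
        then have "g x \<le> t" using 1 by (intro min(2)) simp_all
        then show ?thesis using 1 by simp
      qed (simp add: g_def)
    qed
    moreover have "compact (h ` S)" if "compact S" for S
      using that by (intro compact_continuous_image continuous_on_subset[OF h]) auto
    then have "closed (h ` ({0..1} \<inter> {..c}))" "closed (h ` {0..1})"
      by (simp_all add: compact_imp_closed compact_Int_closed)
    ultimately show "{x \<in> space borel. g x \<le> c} \<in> sets borel"
      by (simp add: borel_closed borel_open open_Compl)
  qed
  ultimately show ?thesis using that by blast
qed

text \<open>The measures are transported to the line by a Borel right inverse \<open>g\<close> of a continuous surjection
  \<open>h\<close>, where Helly's theorem applies; \<open>h\<close> carries the limit back. That \<open>g\<close> is not continuous does no harm,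
  because only test functions of the form \<open>f \<circ> h\<close> occur.\<close>
lemma weak_limit_in_plane:
  fixes \<mu> :: "nat \<Rightarrow> complex measure"
  assumes prob: "\<And>n. prob_space (\<mu> n)" and sets: "\<And>n. sets (\<mu> n) = sets borel"
    and supp: "\<And>n. AE x in \<mu> n. supnorm x \<le> 1/2"
  obtains r M where "strict_mono (r :: nat \<Rightarrow> nat)" "prob_space M" "sets M = sets borel"
    "\<And>(f :: complex \<Rightarrow> complex) B. continuous_on UNIV f \<Longrightarrow> (\<And>x. cmod (f x) \<le> B) \<Longrightarrow>
        (\<lambda>n. LINT x|\<mu> (r n). f x) \<longlonglongrightarrow> (LINT x|M. f x)"
proof -
  obtain h :: "real \<Rightarrow> complex" where h: "continuous_on UNIV h" "{z. supnorm z \<le> 1/2} \<subseteq> h ` {0..1}"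
    by (rule space_filling_curve)
  obtain g where g: "g \<in> borel_measurable borel" "\<And>x. g x \<in> {0..1}"
    "\<And>x. x \<in> h ` {0..1} \<Longrightarrow> h (g x) = x"
    using borel_right_inverse[OF h(1)] by blast
  have hm: "h \<in> borel_measurable borel" using h(1) by (rule borel_measurable_continuous_onI)
  have gm [measurable]: "g \<in> borel_measurable (\<mu> n)" for n
    using g(1) by (subst measurable_cong_sets[OF sets refl])
  define \<nu> where "\<nu> n = distr (\<mu> n) borel g" for n
  have rd: "real_distribution (\<nu> n)" for n
    unfolding \<nu>_def by (rule prob_space.real_distribution_distr[OF prob gm])
  have "tight \<nu>"
    unfolding tight_def
  proof (intro conjI allI impI rd)
    fix \<epsilon> :: real assume "\<epsilon> > 0"
    have "measure (\<nu> n) {-1<..1} = 1" for n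
    proof -
      have "measure (\<nu> n) {-1<..1} = measure (\<mu> n) (g -` {-1<..1} \<inter> space (\<mu> n))"
        unfolding \<nu>_def by (rule measure_distr) (use gm in auto)
      also have "g x \<in> {-1<..1}" for x using g(2)[of x] by simp
      then have "g -` {-1<..1} \<inter> space (\<mu> n) = space (\<mu> n)" by auto
      finally show ?thesis by (simp add: prob_space.prob_space[OF prob])
    qed
    then show "\<exists>a b. a < b \<and> (\<forall>n. 1 - \<epsilon> < measure (\<nu> n) {a<..b})"
      using \<open>\<epsilon> > 0\<close> by (intro exI[of _ "-1"] exI[of _ 1]) auto
  qed
  then obtain r N where r: "strict_mono r" "real_distribution N" "weak_conv_m (\<nu> \<circ> id \<circ> r) N"
    using tight_imp_convergent_subsubsequence[of \<nu> id] by (auto simp: strict_mono_id)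
  interpret N: real_distribution N by fact
  have hN: "h \<in> borel_measurable N" using hm by simp
  define M where "M = distr N borel h"
  have "(\<lambda>n. LINT x|\<mu> (r n). f x) \<longlonglongrightarrow> (LINT x|M. f x)"
    if f: "continuous_on UNIV f" "\<And>x. cmod (f x) \<le> B" for f :: "complex \<Rightarrow> complex" and B
  proof -
    have fm [measurable]: "f \<in> borel_measurable borel" using f(1) by (rule borel_measurable_continuous_onI)
    have "(\<lambda>n. integral\<^sup>L ((\<nu> \<circ> id \<circ> r) n) (\<lambda>t. f (h t))) \<longlonglongrightarrow> integral\<^sup>L N (\<lambda>t. f (h t))"
    proof (rule weak_conv_imp_integral_bdd_continuous_conv[OF _ r(2,3)])
      show "isCont (\<lambda>t. f (h t)) x" for x
        using continuous_on_compose2[OF f(1) h(1) subset_UNIV] by (simp add: continuous_on_eq_continuous_at)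
    qed (use rd f(2) in auto)
    moreover have "integral\<^sup>L N (\<lambda>t. f (h t)) = (LINT x|M. f x)"
      unfolding M_def using hN by (subst integral_distr) auto
    moreover have "integral\<^sup>L ((\<nu> \<circ> id \<circ> r) n) (\<lambda>t. f (h t)) = (LINT x|\<mu> (r n). f x)" for n
    proof -
      have "integral\<^sup>L ((\<nu> \<circ> id \<circ> r) n) (\<lambda>t. f (h t)) = (LINT x|\<mu> (r n). f (h (g x)))"
        unfolding \<nu>_def o_def id_def using hm by (subst integral_distr) auto
      also have "\<dots> = (LINT x|\<mu> (r n). f x)"
      proof (rule integral_cong_AE)
        show "AE x in \<mu> (r n). f (h (g x)) = f x"
          using supp[of "r n"] by eventually_elim (use g(3) h(2) in auto)
        show "(\<lambda>x. f (h (g x))) \<in> borel_measurable (\<mu> (r n))" using hm by measurable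
        show "f \<in> borel_measurable (\<mu> (r n))" using fm by (subst measurable_cong_sets[OF sets refl])
      qed
      finally show ?thesis .
    qed
    ultimately show ?thesis by simp
  qed
  moreover have "prob_space M" unfolding M_def by (rule N.prob_space_distr[OF hN])
  moreover have "sets M = sets borel" by (simp add: M_def)
  ultimately show ?thesis using that r(1) by blast
qed

section \<open>Smooth periodic bumps and their Fourier series\<close>

text \<open>The raised cosine: total mass 1, an elementary transform, and decay of order |t|^(-3),
  so that its coefficients remain summable after multiplication by the weight
  \<open>1 + \<bar>t\<bar>\<close>.\<close>

definition bump :: "real measure" where
  "bump = density lborel (\<lambda>x. ennreal (indicator {-1/2..1/2} x * (1 + cos (2 * pi * x))))"

definition bump_hat :: "real \<Rightarrow> complex" where
  "bump_hat t = (LINT x|bump. cis (- 2 * pi * t * x))"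

lemma sets_bump [simp]: "sets bump = sets borel"
  by (simp add: bump_def)

lemma one_plus_cos_nonneg: "0 \<le> 1 + cos (x::real)"
  using cos_ge_minus_one[of x] by linarith

lemma prob_space_bump: "prob_space bump"
proof
  have "((\<lambda>x. x + sin (2 * pi * x) / (2 * pi)) has_real_derivative 1 + cos (2 * pi * x)) (at x)" for x
    by (auto intro!: derivative_eq_intros)
  then have "(\<integral>\<^sup>+x. ennreal (1 + cos (2 * pi * x)) * indicator {-1/2..1/2} x \<partial>lborel) =
     ennreal ((1/2 + sin (2 * pi * (1/2)) / (2 * pi)) - (-1/2 + sin (2 * pi * (-1/2)) / (2 * pi)))"
    by (intro nn_integral_FTC_Icc) (auto simp: one_plus_cos_nonneg)
  also have "\<dots> = 1" by simp
  finally have "(\<integral>\<^sup>+x. ennreal (1 + cos (2 * pi * x)) * indicator {-1/2..1/2} x \<partial>lborel) = 1" .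
  moreover have "ennreal (indicator {-1/2..1/2} x * (1 + cos (2 * pi * x))) = ennreal (1 + cos (2 * pi * x)) * indicator {-1/2..1/2} x" for x
    by (simp add: indicator_def)
  ultimately show "emeasure bump (space bump) = 1"
    unfolding bump_def by (simp add: emeasure_density)
qed

lemma AE_bump: "AE x in bump. \<bar>x\<bar> \<le> 1/2"
  unfolding bump_def by (subst AE_density) (auto simp: indicator_def split: if_splits)

lemma bump_hat_0 [simp]: "bump_hat 0 = 1"
proof -
  interpret prob_space bump by (rule prob_space_bump)
  show ?thesis by (simp add: bump_hat_def prob_space)
qed

lemma bump_hat_le_1: "cmod (bump_hat t) \<le> 1"
proof -
  interpret prob_space bump by (rule prob_space_bump)
  have "cmod (bump_hat t) \<le> (LINT x|bump. cmod (cis (- 2 * pi * t * x)))"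
    unfolding bump_hat_def by (rule integral_norm_bound)
  then show ?thesis by (simp add: prob_space)
qed

text \<open>The raised cosine vanishes to second order at the endpoints, whence cubic decay: at \<open>\<plusminus>1/2\<close> the
  three exponentials of the integrand agree up to sign, and the reciprocals of \<open>t\<close>, \<open>t + 1\<close>, \<open>t - 1\<close> combine
  to \<open>-1/(t(t\<^sup>2-1))\<close>.\<close>
lemma bump_hat_tail:
  assumes t: "2 \<le> \<bar>t\<bar>"
  shows "cmod (bump_hat t) \<le> 1 / \<bar>t * (t\<^sup>2 - 1)\<bar>"
proof -
  define e where "e s x = cis (- 2 * pi * s * x)" for s x :: real
  define P where "P s x = (\<i> / (2 * pi * s)) * e s x" for s x :: real
  \<comment> \<open>A primitive of the integrand: (1 + cos(2 pi x)) times the exponential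
    \<open>e t\<close> is \<open>e t\<close> plus half of \<open>e (t + 1)\<close> and half of
    \<open>e (t - 1)\<close>.\<close>
  define F where "F x = P t x + (1/2) * P (t + 1) x + (1/2) * P (t - 1) x" for x
  have ne: "t \<noteq> 0" "t + 1 \<noteq> 0" "t - 1 \<noteq> 0" using t by auto
  have P: "(P s has_vector_derivative e s x) (at x within A)" if "s \<noteq> 0" for s x A
  proof -
    define c where "c = - (2 * pi * s) * \<i>"
    have "((\<lambda>z. (\<i> / (2 * pi * s)) * exp (c * z)) has_field_derivative (\<i> / (2 * pi * s)) * (c * exp (c * of_real x))) (at (of_real x))"
      using that by (auto intro!: derivative_eq_intros)
    then have "((\<lambda>z. (\<i> / (2 * pi * s)) * exp (c * of_real z)) has_vector_derivative (\<i> / (2 * pi * s)) * (c * exp (c * of_real x))) (at x within A)"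
      by (rule has_vector_derivative_real_field)
    moreover have "exp (c * of_real z) = e s z" for z by (simp add: c_def e_def cis_conv_exp mult_ac)
    moreover have "(\<i> / (2 * pi * s)) * (c * e s x) = e s x" using that by (simp add: c_def)
    ultimately show ?thesis by (simp add: P_def[abs_def])
  qed
  have "(F has_vector_derivative e t x + (1/2) * e (t + 1) x + (1/2) * e (t - 1) x) (at x within A)" for x A
    unfolding F_def by (intro has_vector_derivative_add has_vector_derivative_mult_right P ne)
  then have "has_bochner_integral lborel
     (\<lambda>x. indicator {-1/2..1/2} x *\<^sub>R (e t x + (1/2) * e (t + 1) x + (1/2) * e (t - 1) x)) (F (1/2) - F (-1/2))"
    by (intro has_bochner_integral_FTC_Icc) (simp, assumption, unfold e_def cis_conv_exp, intro continuous_intros)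
  moreover have "e t x + (1/2) * e (t + 1) x + (1/2) * e (t - 1) x = of_real (1 + cos (2 * pi * x)) * e t x" for x
    unfolding e_def by (simp add: complex_eq_iff algebra_simps cos_add sin_add cos_diff sin_diff
        add_divide_distrib diff_divide_distrib)
  ultimately have "(LBINT x. (indicator {-1/2..1/2} x * (1 + cos (2 * pi * x))) *\<^sub>R e t x) = F (1/2) - F (-1/2)"
    by (simp add: has_bochner_integral_iff scaleR_conv_of_real mult.assoc)
  moreover have "bump_hat t = (LBINT x. (indicator {-1/2..1/2} x * (1 + cos (2 * pi * x))) *\<^sub>R e t x)"
    unfolding bump_hat_def bump_def e_def
    by (subst integral_density) (auto simp: one_plus_cos_nonneg)
  ultimately have eq: "bump_hat t = F (1/2) - F (-1/2)" by simp
  have F: "F x = (\<i> / (2 * pi)) * e t x * of_real (- 1 / (t * (t\<^sup>2 - 1)))" if "x = 1/2 \<or> x = -1/2" for x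
  proof -
    have "e (t + 1) x = - e t x" "e (t - 1) x = - e t x"
      using that unfolding e_def by (auto simp: complex_eq_iff algebra_simps cos_add sin_add cos_diff sin_diff)
    then have "F x = (\<i> / (2 * pi)) * e t x * of_real (1 / t - 1 / (2 * (t + 1)) - 1 / (2 * (t - 1)))"
      unfolding F_def P_def by (simp add: algebra_simps)
    also have "1 / t - 1 / (2 * (t + 1)) - 1 / (2 * (t - 1)) = - 1 / (t * (t\<^sup>2 - 1))"
    proof -
      have "t\<^sup>2 - 1 = (t + 1) * (t - 1)" by (simp add: power2_eq_square algebra_simps)
      then show ?thesis using ne by (simp add: divide_simps) (simp add: algebra_simps)
    qed
    finally show ?thesis .
  qed
  have n: "cmod (F x) \<le> (1/2) * (1 / \<bar>t * (t\<^sup>2 - 1)\<bar>)" if "x = 1/2 \<or> x = -1/2" for x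
  proof -
    have "cmod (F x) = 1 / (2 * pi) * (1 / \<bar>t * (t\<^sup>2 - 1)\<bar>)"
      unfolding F[OF that] norm_mult norm_of_real e_def by (simp add: norm_divide)
    also have "\<dots> \<le> (1/2) * (1 / \<bar>t * (t\<^sup>2 - 1)\<bar>)"
      using pi_gt3 by (intro mult_right_mono) auto
    finally show ?thesis .
  qed
  have "cmod (bump_hat t) \<le> cmod (F (1/2)) + cmod (F (-1/2))"
    unfolding eq by (rule norm_triangle_ineq4)
  also have "\<dots> \<le> 1 / \<bar>t * (t\<^sup>2 - 1)\<bar>" using n[of "1/2"] n[of "-1/2"] by simp
  finally show ?thesis .
qed

text \<open>27 is \<open>3 ^ 3\<close>, which the trivial bound 1 requires for |t| < 2; the tail
  estimate has room to spare.\<close>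

lemma bump_hat_bound: "cmod (bump_hat t) \<le> 27 / (1 + \<bar>t\<bar>) ^ 3"
proof (cases "\<bar>t\<bar> < 2")
  case True
  then have "(1 + \<bar>t\<bar>) ^ 3 \<le> 3 ^ 3" by (intro power_mono) auto
  then have "1 \<le> 27 / (1 + \<bar>t\<bar>) ^ 3" by (simp add: field_simps)
  then show ?thesis using bump_hat_le_1[of t] by linarith
next
  case False
  define u where "u = \<bar>t\<bar>"
  have u: "2 \<le> u" using False by (simp add: u_def)
  have "4 \<le> u\<^sup>2" using power_mono[of 2 u 2] u by simp
  have "\<bar>t * (t\<^sup>2 - 1)\<bar> = u * (u\<^sup>2 - 1)"
    using \<open>4 \<le> u\<^sup>2\<close> by (simp add: abs_mult u_def)
  moreover have "(1 + u) ^ 3 \<le> 27 * (u * (u\<^sup>2 - 1))"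
  proof -
    have "(1 + u) ^ 3 \<le> (u + u) ^ 3" using u by (intro power_mono) auto
    also have "\<dots> = 8 * (u * u\<^sup>2)" by (simp add: power3_eq_cube power2_eq_square)
    also have "\<dots> \<le> 27 * (u * (u\<^sup>2 - 1))"
    proof -
      have "8 * u\<^sup>2 \<le> 27 * (u\<^sup>2 - 1)" using \<open>4 \<le> u\<^sup>2\<close> by simp
      then have "u * (8 * u\<^sup>2) \<le> u * (27 * (u\<^sup>2 - 1))" using u by (intro mult_left_mono) auto
      then show ?thesis by (simp add: algebra_simps)
    qed
    finally show ?thesis .
  qed
  moreover have "0 < u * (u\<^sup>2 - 1)" using u \<open>4 \<le> u\<^sup>2\<close> by (intro mult_pos_pos) auto
  ultimately have "1 / \<bar>t * (t\<^sup>2 - 1)\<bar> \<le> 27 / (1 + u) ^ 3"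
    using u by (subst frac_le_eq) (auto simp: divide_le_0_iff)
  then show ?thesis using bump_hat_tail[of t] False by (simp add: u_def)
qed

lemma cube_cancel: "0 < v \<Longrightarrow> c / v ^ 3 * v = c / v\<^sup>2" for v c :: real
  by (simp add: power3_eq_cube power2_eq_square)

lemma bump_hat_weighted_bound: "cmod (bump_hat t) * (1 + \<bar>t\<bar>) \<le> 27 / (1 + \<bar>t\<bar>)\<^sup>2"
proof -
  have "cmod (bump_hat t) * (1 + \<bar>t\<bar>) \<le> 27 / (1 + \<bar>t\<bar>) ^ 3 * (1 + \<bar>t\<bar>)"
    by (intro mult_right_mono bump_hat_bound) auto
  also have "\<dots> = 27 / (1 + \<bar>t\<bar>)\<^sup>2"
    using cube_cancel[of "1 + \<bar>t\<bar>" 27] by simp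
  finally show ?thesis .
qed

lemma Ints_inverse_square_sum_bounded:
  obtains B :: real where "\<And>F. finite F \<Longrightarrow> F \<subseteq> \<int> \<Longrightarrow> (\<Sum>x\<in>F. 1 / (1 + \<bar>x\<bar>)\<^sup>2) \<le> B" "0 \<le> B"
proof -
  obtain B :: real where B: "\<And>F. finite F \<Longrightarrow> F \<subseteq> \<int> \<Longrightarrow> (\<Sum>x\<in>F. (1 + \<bar>x\<bar>) powr (-2)) \<le> B" "0 \<le> B"
    using Ints_powr_sum_bounded[of 2] by auto
  have "(1 + \<bar>x\<bar>) powr (-2) = 1 / (1 + \<bar>x\<bar>)\<^sup>2" for x :: real
    by (simp add: powr_minus powr_numeral divide_inverse)
  then show ?thesis using that[of B] B by simp
qed

text \<open>Recentring at the floor of \<open>t\<close> makes the bound uniform in \<open>t\<close>: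
  distances to \<open>t\<close> and to its floor differ by at most 1, which costs a factor 4 in the
  squared weights, and 108 is 4 times 27.\<close>

lemma bump_hat_translates_bounded:
  obtains B where "\<And>F t. finite F \<Longrightarrow> F \<subseteq> \<int> \<Longrightarrow> (\<Sum>x\<in>F. cmod (bump_hat (t - x)) * (1 + \<bar>t - x\<bar>)) \<le> B" "0 \<le> B"
proof -
  obtain B :: real where B: "\<And>F. finite F \<Longrightarrow> F \<subseteq> \<int> \<Longrightarrow> (\<Sum>x\<in>F. 1 / (1 + \<bar>x\<bar>)\<^sup>2) \<le> B" "0 \<le> B"
    using Ints_inverse_square_sum_bounded by blast
  have "(\<Sum>x\<in>F. cmod (bump_hat (t - x)) * (1 + \<bar>t - x\<bar>)) \<le> 108 * B" if F: "finite F" "F \<subseteq> \<int>" for F t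
  proof -
    define f where "f = real_of_int \<lfloor>t\<rfloor>"
    have f: "f \<in> \<int>" "\<bar>t - f\<bar> \<le> 1" unfolding f_def by (simp, linarith)
    have "(\<Sum>x\<in>F. cmod (bump_hat (t - x)) * (1 + \<bar>t - x\<bar>)) \<le> (\<Sum>x\<in>F. 108 * (1 / (1 + \<bar>x - f\<bar>)\<^sup>2))"
    proof (rule sum_mono)
      fix x
      have "\<bar>x - f\<bar> \<le> \<bar>t - f\<bar> + \<bar>t - x\<bar>"
        using abs_triangle_ineq4[of "t - f" "t - x"] by simp
      also have "\<dots> \<le> 1 + \<bar>t - x\<bar>" using f(2) by (rule add_right_mono)
      finally have "1 + \<bar>x - f\<bar> \<le> 1 + (1 + \<bar>t - x\<bar>)" by (rule add_left_mono)
      also have "\<dots> \<le> 2 * (1 + \<bar>t - x\<bar>)" by simp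
      finally have "1 + \<bar>x - f\<bar> \<le> 2 * (1 + \<bar>t - x\<bar>)" .
      then have "(1 + \<bar>x - f\<bar>)\<^sup>2 \<le> (2 * (1 + \<bar>t - x\<bar>))\<^sup>2" by (intro power_mono) auto
      also have "\<dots> = 4 * (1 + \<bar>t - x\<bar>)\<^sup>2" unfolding power_mult_distrib by simp
      finally have "27 / (1 + \<bar>t - x\<bar>)\<^sup>2 \<le> 108 * (1 / (1 + \<bar>x - f\<bar>)\<^sup>2)"
        by (simp add: divide_simps add_nonneg_eq_0_iff)
      then show "cmod (bump_hat (t - x)) * (1 + \<bar>t - x\<bar>) \<le> 108 * (1 / (1 + \<bar>x - f\<bar>)\<^sup>2)"
        using bump_hat_weighted_bound[of "t - x"] by linarith
    qed
    also have "\<dots> = 108 * (\<Sum>y\<in>(\<lambda>x. x - f) ` F. 1 / (1 + \<bar>y\<bar>)\<^sup>2)"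
      by (subst sum.reindex) (auto simp: sum_distrib_left inj_on_def)
    also have "\<dots> \<le> 108 * B" using F f by (intro mult_left_mono B) auto
    finally show ?thesis .
  qed
  then show ?thesis using that[of "108 * B"] B by auto
qed

text \<open>Dilation by \<delta> loses a factor \<delta>^(-3). The bound therefore depends on the
  kernel in question, but only its finiteness enters later.\<close>

lemma bump_hat_dilates_bounded:
  assumes "0 < \<delta>" "\<delta> \<le> 1"
  obtains B where "\<And>F. finite F \<Longrightarrow> F \<subseteq> \<int> \<Longrightarrow> (\<Sum>x\<in>F. cmod (bump_hat (\<delta> * x)) * (1 + \<bar>x\<bar>)) \<le> B" "0 \<le> B"
proof -
  obtain B :: real where B: "\<And>F. finite F \<Longrightarrow> F \<subseteq> \<int> \<Longrightarrow> (\<Sum>x\<in>F. 1 / (1 + \<bar>x\<bar>)\<^sup>2) \<le> B" "0 \<le> B"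
    using Ints_inverse_square_sum_bounded by blast
  have "(\<Sum>x\<in>F. cmod (bump_hat (\<delta> * x)) * (1 + \<bar>x\<bar>)) \<le> 27 / \<delta> ^ 3 * B" if F: "finite F" "F \<subseteq> \<int>" for F
  proof -
    have "(\<Sum>x\<in>F. cmod (bump_hat (\<delta> * x)) * (1 + \<bar>x\<bar>)) \<le> (\<Sum>x\<in>F. 27 / \<delta> ^ 3 * (1 / (1 + \<bar>x\<bar>)\<^sup>2))"
    proof (rule sum_mono)
      fix x
      have "\<delta> * (1 + \<bar>x\<bar>) \<le> 1 + \<bar>\<delta> * x\<bar>" using assms by (simp add: abs_mult algebra_simps)
      then have "(\<delta> * (1 + \<bar>x\<bar>)) ^ 3 \<le> (1 + \<bar>\<delta> * x\<bar>) ^ 3" using assms by (intro power_mono) auto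
      then have "27 / (1 + \<bar>\<delta> * x\<bar>) ^ 3 \<le> 27 / (\<delta> * (1 + \<bar>x\<bar>)) ^ 3"
        using assms by (intro divide_left_mono mult_pos_pos zero_less_power) (auto simp: add_pos_nonneg)
      then have "cmod (bump_hat (\<delta> * x)) * (1 + \<bar>x\<bar>) \<le> 27 / (\<delta> * (1 + \<bar>x\<bar>)) ^ 3 * (1 + \<bar>x\<bar>)"
        using bump_hat_bound[of "\<delta> * x"] by (intro mult_right_mono) auto
      also have "\<dots> = 27 / \<delta> ^ 3 * (1 / (1 + \<bar>x\<bar>)\<^sup>2)"
        using cube_cancel[of "1 + \<bar>x\<bar>" "27 / \<delta> ^ 3"] by (simp add: power_mult_distrib)
      finally show "cmod (bump_hat (\<delta> * x)) * (1 + \<bar>x\<bar>) \<le> 27 / \<delta> ^ 3 * (1 / (1 + \<bar>x\<bar>)\<^sup>2)" .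
    qed
    also have "\<dots> \<le> 27 / \<delta> ^ 3 * B"
      unfolding sum_distrib_left[symmetric] using assms F by (intro mult_left_mono B) auto
    finally show ?thesis .
  qed
  then show ?thesis using that[of "27 / \<delta> ^ 3 * B"] B assms by auto
qed

section \<open>Fejer means and the periodized bump\<close>

lemma Cesaro_mean_tendsto:
  fixes a :: "nat \<Rightarrow> complex"
  assumes "a \<longlonglongrightarrow> L"
  shows "(\<lambda>N. (\<Sum>n<N. a n) / of_nat N) \<longlonglongrightarrow> L"
proof (rule LIMSEQ_I)
  fix e :: real assume e: "0 < e"
  obtain N0 where N0: "\<And>n. n \<ge> N0 \<Longrightarrow> norm (a n - L) < e / 2"
    using LIMSEQ_D[OF assms, of "e / 2"] e by auto
  define A where "A = (\<Sum>n<N0. norm (a n - L))"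
  have A: "0 \<le> A" by (auto simp: A_def intro: sum_nonneg)
  obtain N1 :: nat where N1: "2 * A / e < real N1" using reals_Archimedean2 by blast
  show "\<exists>no. \<forall>n\<ge>no. norm ((\<Sum>k<n. a k) / of_nat n - L) < e"
  proof (intro exI allI impI)
    fix N assume N: "max (max N0 N1) 1 \<le> N"
    have "norm (\<Sum>n<N. a n - L) \<le> (\<Sum>n<N. norm (a n - L))" by (rule norm_sum)
    also have "\<dots> = A + (\<Sum>n\<in>{N0..<N}. norm (a n - L))"
      unfolding A_def using N by (subst sum.union_disjoint[symmetric]) (auto intro!: sum.cong)
    also have "(\<Sum>n\<in>{N0..<N}. norm (a n - L)) \<le> (\<Sum>n\<in>{N0..<N}. e / 2)"
      using N0 by (intro sum_mono less_imp_le) auto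
    also have "\<dots> \<le> real N * (e / 2)" using e by (simp add: mult_right_mono)
    finally have 1: "norm (\<Sum>n<N. a n - L) \<le> A + real N * (e / 2)" by simp
    have "2 * A / e < real N" using N N1 by (meson less_le_trans max.bounded_iff of_nat_le_iff)
    then have 2: "A < real N * (e / 2)" using e by (simp add: field_simps)
    have "(\<Sum>k<N. a k) / of_nat N - L = (\<Sum>n<N. a n - L) / of_nat N"
      using N by (simp add: sum_subtractf field_simps)
    then have "norm ((\<Sum>k<N. a k) / of_nat N - L) = norm (\<Sum>n<N. a n - L) / real N"
      by (simp add: norm_divide)
    also have "\<dots> < e" using 1 2 N by (simp add: field_simps)
    finally show "norm ((\<Sum>k<N. a k) / of_nat N - L) < e" .
  qed
qed

lemma sum_symmetric_int:
  fixes f :: "int \<Rightarrow> 'a :: comm_monoid_add"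
  shows "(\<Sum>m\<in>{-int (Suc n)..int (Suc n)}. f m) =
    (\<Sum>m\<in>{-int n..int n}. f m) + (f (int (Suc n)) + f (- int (Suc n)))"
proof -
  have "{-int (Suc n)..int (Suc n)} = insert (int (Suc n)) (insert (- int (Suc n)) {-int n..int n})"
    by auto
  then show ?thesis by (simp add: ac_simps)
qed

text \<open>For \<open>N > 0\<close> this is \<open>N\<close> times the usual Fejer kernel.\<close>

abbreviation fejer :: "nat \<Rightarrow> real \<Rightarrow> real" where
  "fejer N \<theta> \<equiv> (cmod (\<Sum>j<N. cis (of_nat j * \<theta>)))\<^sup>2"

text \<open>Induction on \<open>N\<close>: adding a term \<open>z\<close> of modulus 1 to the
  exponential sum \<open>S\<close> increases its squared modulus by
  \<open>1 + 2 * Re (S * cnj z)\<close>, which is the Dirichlet kernel \<open>D N\<close>.\<close>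

lemma Fejer_kernel:
  "(\<Sum>n<N. \<Sum>m\<in>{-int n..int n}. cis (of_int m * \<theta>)) = of_real (fejer N \<theta>)"
proof -
  define D where "D n = 1 + 2 * (\<Sum>i<n. cos (real (Suc i) * \<theta>))" for n
  have D: "(\<Sum>m\<in>{-int n..int n}. cis (of_int m * \<theta>)) = of_real (D n)" for n
  proof (induction n)
    case 0
    then show ?case by (simp add: D_def)
  next
    case (Suc n)
    have "cis (of_int (int (Suc n)) * \<theta>) + cis (of_int (- int (Suc n)) * \<theta>) = of_real (2 * cos (real (Suc n) * \<theta>))"
      by (simp add: complex_eq_iff left_diff_distrib distrib_right cos_diff cos_add sin_diff sin_add)
    then show ?case unfolding sum_symmetric_int Suc by (simp only: D_def of_real_add[symmetric]) (simp add: algebra_simps)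
  qed
  have "(\<Sum>n<N. D n) = fejer N \<theta>"
  proof (induction N)
    case 0
    then show ?case by simp
  next
    case (Suc N)
    define S where "S = (\<Sum>j<N. cis (of_nat j * \<theta>))"
    define z where "z = cis (of_nat N * \<theta>)"
    have "(cmod (S + z))\<^sup>2 = (cmod S)\<^sup>2 + (cmod z)\<^sup>2 + 2 * Re (S * cnj z)"
      unfolding cmod_power2 by (simp add: power2_eq_square algebra_simps)
    moreover have "cmod z = 1" by (simp add: z_def)
    moreover have "Re (S * cnj z) = (\<Sum>i<N. cos (real (Suc i) * \<theta>))"
    proof -
      have "Re (S * cnj z) = (\<Sum>j<N. cos (real (N - j) * \<theta>))"
        unfolding S_def z_def sum_distrib_right Re_sum cis_cnj cis_mult
        by (intro sum.cong) (auto simp: of_nat_diff algebra_simps cos_diff)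
      also have "\<dots> = (\<Sum>i<N. cos (real (N - (N - Suc i)) * \<theta>))"
        by (rule sum.nat_diff_reindex[symmetric])
      also have "\<dots> = (\<Sum>i<N. cos (real (Suc i) * \<theta>))"
        by (intro sum.cong refl) (simp only: lessThan_iff Suc_leI diff_diff_cancel)
      finally show ?thesis .
    qed
    ultimately have "(cmod (S + z))\<^sup>2 = (cmod S)\<^sup>2 + D N" by (simp add: D_def)
    then show ?case using Suc by (simp add: S_def z_def)
  qed
  then show ?thesis by (simp only: D of_real_sum[symmetric])
qed

text \<open>A geometric sum whose numerator has modulus at most 2. The bound does not depend on
  \<open>N\<close>, so division by \<open>N\<close> makes it vanish in the limit.\<close>

lemma Fejer_kernel_bound:
  assumes "cos \<theta> \<le> \<gamma>" "\<gamma> < 1"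
  shows "fejer N \<theta> \<le> 2 / (1 - \<gamma>)"
proof -
  have ne: "cis \<theta> \<noteq> 1" using assms by (auto simp: complex_eq_iff)
  have sq: "(cmod (1 - cis \<theta>))\<^sup>2 = 2 - 2 * cos \<theta>"
    unfolding cmod_power2 using sin_cos_squared_add[of \<theta>] by (simp add: power2_eq_square algebra_simps)
  have "(\<Sum>j<N. cis (of_nat j * \<theta>)) = (\<Sum>j<N. cis \<theta> ^ j)" by (simp add: Complex.DeMoivre)
  also have "\<dots> = (1 - cis \<theta> ^ N) / (1 - cis \<theta>)" using ne by (simp add: sum_gp_strict)
  finally have "fejer N \<theta> = (cmod (1 - cis \<theta> ^ N))\<^sup>2 / (2 - 2 * cos \<theta>)"
    by (simp add: norm_divide power_divide sq)
  also have "\<dots> \<le> 2\<^sup>2 / (2 - 2 * \<gamma>)"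
  proof (intro frac_le power_mono)
    show "cmod (1 - cis \<theta> ^ N) \<le> 2"
      using norm_triangle_ineq4[of 1 "cis \<theta> ^ N"] by (simp add: norm_power)
  qed (use assms in auto)
  also have "\<dots> = 2 / (1 - \<gamma>)" using assms by (simp add: field_simps)
  finally show ?thesis .
qed

definition bump_series :: "real \<Rightarrow> nat \<Rightarrow> real \<Rightarrow> complex" where
  "bump_series \<delta> n x = (\<Sum>m\<in>{-int n..int n}. bump_hat (\<delta> * of_int m) * cis (of_int m * (2 * pi * x)))"

lemma bump_coeff_sum_le:
  assumes "\<And>F. finite F \<Longrightarrow> F \<subseteq> \<int> \<Longrightarrow> (\<Sum>x\<in>F. cmod (bump_hat (\<delta> * x)) * (1 + \<bar>x\<bar>)) \<le> B"
  shows "(\<Sum>m\<in>{-int n..int n}. cmod (bump_hat (\<delta> * of_int m))) \<le> B"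
proof -
  have "(\<Sum>m\<in>{-int n..int n}. cmod (bump_hat (\<delta> * of_int m)) * 1)
      \<le> (\<Sum>m\<in>{-int n..int n}. cmod (bump_hat (\<delta> * of_int m)) * (1 + \<bar>of_int m\<bar>))"
    by (intro sum_mono mult_left_mono) auto
  also have "\<dots> = (\<Sum>y\<in>real_of_int ` {-int n..int n}. cmod (bump_hat (\<delta> * y)) * (1 + \<bar>y\<bar>))"
    by (subst sum.reindex) (auto simp: inj_on_def)
  also have "\<dots> \<le> B" by (rule assms) auto
  finally show ?thesis by simp
qed

lemma bump_series_norm_le:
  assumes "\<And>F. finite F \<Longrightarrow> F \<subseteq> \<int> \<Longrightarrow> (\<Sum>x\<in>F. cmod (bump_hat (\<delta> * x)) * (1 + \<bar>x\<bar>)) \<le> B"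
  shows "cmod (bump_series \<delta> n x) \<le> B"
proof -
  have "cmod (bump_series \<delta> n x) \<le> (\<Sum>m\<in>{-int n..int n}. cmod (bump_hat (\<delta> * of_int m)))"
    unfolding bump_series_def by (rule order_trans[OF norm_sum]) (simp add: norm_mult)
  also have "\<dots> \<le> B" by (rule bump_coeff_sum_le[OF assms])
  finally show ?thesis .
qed

lemma bump_series_convergent:
  assumes "0 < \<delta>" "\<delta> \<le> 1"
  shows "convergent (\<lambda>n. bump_series \<delta> n x)"
proof -
  define f where "f m = bump_hat (\<delta> * of_int m) * cis (of_int m * (2 * pi * x))" for m
  obtain B where B: "\<And>F. finite F \<Longrightarrow> F \<subseteq> \<int> \<Longrightarrow> (\<Sum>x\<in>F. cmod (bump_hat (\<delta> * x)) * (1 + \<bar>x\<bar>)) \<le> B" "0 \<le> B"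
    using bump_hat_dilates_bounded[OF assms] by blast
  \<comment> \<open>Pairing the frequencies m and -m turns the symmetric sums into partial sums of
    an ordinary series, which converges absolutely.\<close>
  define g where "g i = f (int (Suc i)) + f (- int (Suc i))" for i
  have eq: "bump_series \<delta> n x = f 0 + (\<Sum>i<n. g i)" for n
  proof (induction n)
    case 0
    then show ?case by (simp add: bump_series_def f_def)
  next
    case (Suc n)
    then show ?case unfolding bump_series_def f_def[symmetric] sum_symmetric_int
      by (simp add: g_def f_def[symmetric] add.assoc)
  qed
  have "summable (\<lambda>i. norm (g i))"
  proof (rule summableI_nonneg_bounded[of _ B])
    fix n
    have "(\<Sum>i<n. norm (g i)) \<le> (\<Sum>m\<in>{-int n..int n}. norm (f m))"
    proof (induction n)
      case (Suc n)
      have "norm (g n) \<le> norm (f (int (Suc n))) + norm (f (- int (Suc n)))"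
        unfolding g_def by (rule norm_triangle_ineq)
      then show ?case using Suc unfolding sum_symmetric_int by simp
    qed simp
    also have "\<dots> \<le> B" using bump_coeff_sum_le[OF B(1)] by (simp add: f_def norm_mult)
    finally show "(\<Sum>i<n. norm (g i)) \<le> B" .
  qed simp
  then have "summable g" by (rule summable_norm_cancel)
  then have "convergent (\<lambda>n. f 0 + (\<Sum>i<n. g i))"
    by (intro convergent_add convergent_const) (simp add: summable_iff_convergent)
  then show ?thesis by (simp add: eq)
qed

text \<open>This is the periodization of the bump scaled to width \<open>\<delta>\<close>. Its sign and its support are read off
  from the Fejer means of the series, which converge to the same limit, so no Poisson summation is
  needed.\<close>
definition bump_periodic :: "real \<Rightarrow> real \<Rightarrow> complex" where
  "bump_periodic \<delta> x = lim (\<lambda>n. bump_series \<delta> n x)"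

lemma bump_series_tendsto:
  "0 < \<delta> \<Longrightarrow> \<delta> \<le> 1 \<Longrightarrow> (\<lambda>n. bump_series \<delta> n x) \<longlonglongrightarrow> bump_periodic \<delta> x"
  using bump_series_convergent convergent_LIMSEQ_iff unfolding bump_periodic_def by blast

text \<open>Each coefficient is an integral over \<open>bump\<close>. Exchanging it with the finite
  sums leaves the Fejer kernel, averaged over the translates
  \<open>x - \<delta> * t\<close>.\<close>

lemma bump_series_Cesaro:
  "(\<Sum>n<N. bump_series \<delta> n x) = of_real (LINT t|bump. fejer N (2 * pi * (x - \<delta> * t)))"
proof -
  have m [measurable]: "(\<lambda>t. cis (a * (2 * pi * (x - \<delta> * t)))) \<in> borel_measurable bump" for a
    unfolding measurable_cong_sets[OF sets_bump refl] by measurable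
  have int: "integrable bump (\<lambda>t. cis (of_int m * (2 * pi * (x - \<delta> * t))))" for m
    by (rule prob_space_integrable_bounded[OF prob_space_bump m, where B = 1]) simp
  have term_eq: "bump_hat (\<delta> * of_int m) * cis (of_int m * (2 * pi * x)) = (LINT t|bump. cis (of_int m * (2 * pi * (x - \<delta> * t))))" for m
    unfolding bump_hat_def integral_mult_left_zero[symmetric]
    by (intro Bochner_Integration.integral_cong) (auto simp: cis_mult algebra_simps)
  have "(\<Sum>n<N. bump_series \<delta> n x) = (LINT t|bump. (\<Sum>n<N. \<Sum>m\<in>{-int n..int n}. cis (of_int m * (2 * pi * (x - \<delta> * t)))))"
    unfolding bump_series_def term_eq by (simp add: Bochner_Integration.integral_sum int Bochner_Integration.integrable_sum)
  also have "\<dots> = (LINT t|bump. of_real (fejer N (2 * pi * (x - \<delta> * t))))"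
    unfolding Fejer_kernel ..
  also have "\<dots> = of_real (LINT t|bump. fejer N (2 * pi * (x - \<delta> * t)))"
    by (rule integral_complex_of_real)
  finally show ?thesis .
qed

lemma bump_periodic_nonneg:
  assumes "0 < \<delta>" "\<delta> \<le> 1"
  shows "bump_periodic \<delta> x = of_real (Re (bump_periodic \<delta> x))" "0 \<le> Re (bump_periodic \<delta> x)"
proof -
  define I where "I N = (LINT t|bump. fejer N (2 * pi * (x - \<delta> * t))) / real N" for N
  have "(\<lambda>N. complex_of_real (I N)) \<longlonglongrightarrow> bump_periodic \<delta> x"
    using Cesaro_mean_tendsto[OF bump_series_tendsto[OF assms, of x]] unfolding bump_series_Cesaro I_def by simp
  then have Re: "I \<longlonglongrightarrow> Re (bump_periodic \<delta> x)" and Im: "(\<lambda>N. 0) \<longlonglongrightarrow> Im (bump_periodic \<delta> x)"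
    by (auto dest: tendsto_Re tendsto_Im)
  have "Im (bump_periodic \<delta> x) = 0" by (rule LIMSEQ_unique[OF Im tendsto_const])
  then show "bump_periodic \<delta> x = of_real (Re (bump_periodic \<delta> x))" by (simp add: complex_eq_iff)
  have "0 \<le> I N" for N unfolding I_def by (intro divide_nonneg_nonneg Bochner_Integration.integral_nonneg) auto
  then show "0 \<le> Re (bump_periodic \<delta> x)" using Re by (intro LIMSEQ_le_const) auto
qed

text \<open>The cosine hypothesis says that \<open>x\<close> is farther than \<delta> from every
  integer. As |t| <= 1/2 on the bump, \<open>x - \<delta> * t\<close> keeps distance at least
  \<delta>/2; there the kernel is bounded independently of \<open>N\<close>, and the Fejer means
  tend to 0.\<close>

lemma bump_periodic_eq_0:
  assumes d: "0 < \<delta>" "\<delta> \<le> 1/2" and x: "cos (2 * pi * x) < cos (2 * pi * \<delta>)"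
  shows "bump_periodic \<delta> x = 0"
proof -
  interpret prob_space bump by (rule prob_space_bump)
  define \<gamma> where "\<gamma> = cos (pi * \<delta>)"
  have pd: "0 < pi * \<delta>" "pi * \<delta> \<le> pi / 2" using d by auto
  have g1: "\<gamma> < 1" using cos_monotone_0_pi[of 0 "pi * \<delta>"] pd unfolding \<gamma>_def by simp
  have g0: "0 \<le> \<gamma>" unfolding \<gamma>_def using pd by (intro cos_ge_zero) linarith+
  have sd: "0 \<le> sin (pi * \<delta>)" using pd by (intro sin_ge_zero) auto
  have far: "cos (2 * pi * (x - \<delta> * t)) \<le> \<gamma>" if t: "\<bar>t\<bar> \<le> 1/2" for t
  proof (rule ccontr)
    assume far: "\<not> ?thesis"
    define A where "A = 2 * pi * (x - \<delta> * t)"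
    define B where "B = 2 * pi * \<delta> * t"
    have cA: "\<gamma> \<le> cos A" using far by (simp add: A_def)
    have "\<bar>B\<bar> \<le> pi * \<delta>"
      using t d by (simp add: B_def abs_mult)
    then have cB: "\<gamma> \<le> cos B" unfolding \<gamma>_def
      using cos_monotone_0_pi_le[of "\<bar>B\<bar>" "pi * \<delta>"] pd by simp
    have s: "\<bar>sin y\<bar> \<le> sin (pi * \<delta>)" if "\<gamma> \<le> cos y" for y
    proof -
      have "\<gamma>\<^sup>2 \<le> (cos y)\<^sup>2" using that g0 by (intro power_mono) auto
      then have "(sin y)\<^sup>2 \<le> (sin (pi * \<delta>))\<^sup>2" unfolding \<gamma>_def sin_squared_eq by simp
      then show ?thesis using sd by (metis abs_of_nonneg abs_le_square_iff)
    qed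
    have "sin A * sin B \<le> \<bar>sin A\<bar> * \<bar>sin B\<bar>" by (simp flip: abs_mult)
    also have "\<dots> \<le> sin (pi * \<delta>) * sin (pi * \<delta>)" using s[OF cA] s[OF cB] sd by (intro mult_mono) auto
    finally have "sin A * sin B \<le> sin (pi * \<delta>) * sin (pi * \<delta>)" .
    moreover have "\<gamma> * \<gamma> \<le> cos A * cos B" using cA cB g0 by (intro mult_mono) auto
    moreover have "cos (2 * pi * x) = cos A * cos B - sin A * sin B"
      unfolding cos_add[symmetric] by (simp add: A_def B_def algebra_simps)
    moreover have "cos (2 * pi * \<delta>) = \<gamma> * \<gamma> - sin (pi * \<delta>) * sin (pi * \<delta>)"
      unfolding \<gamma>_def cos_add[symmetric] by (simp add: algebra_simps)
    ultimately show False using x by linarith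
  qed
  have bnd: "(LINT t|bump. fejer N (2 * pi * (x - \<delta> * t))) \<le> 2 / (1 - \<gamma>)" for N
  proof -
    have m: "(\<lambda>t. fejer N (2 * pi * (x - \<delta> * t))) \<in> borel_measurable bump"
      unfolding measurable_cong_sets[OF sets_bump refl] by measurable
    have ae: "AE t in bump. fejer N (2 * pi * (x - \<delta> * t)) \<le> 2 / (1 - \<gamma>)"
      using AE_bump by eventually_elim (rule Fejer_kernel_bound[OF far g1])
    have "integrable bump (\<lambda>t. fejer N (2 * pi * (x - \<delta> * t)))"
      by (rule integrable_const_bound[OF _ m, of "2 / (1 - \<gamma>)"]) (use ae in simp)
    then show ?thesis using integral_le_const[OF _ ae] by simp
  qed
  have "(\<lambda>N. (\<Sum>n<N. bump_series \<delta> n x) / of_nat N) \<longlonglongrightarrow> 0"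
  proof (rule Lim_null_comparison)
    have "norm ((\<Sum>n<N. bump_series \<delta> n x) / of_nat N) \<le> 2 / (1 - \<gamma>) / real N" for N
    proof -
      have "0 \<le> (LINT t|bump. fejer N (2 * pi * (x - \<delta> * t)))"
        by (intro Bochner_Integration.integral_nonneg) auto
      then show ?thesis using bnd[of N]
        unfolding bump_series_Cesaro norm_divide norm_of_real norm_of_nat by (intro divide_right_mono) auto
    qed
    then show "\<forall>\<^sub>F N in sequentially. norm ((\<Sum>n<N. bump_series \<delta> n x) / of_nat N) \<le> 2 / (1 - \<gamma>) / real N"
      by simp
    show "(\<lambda>N. 2 / (1 - \<gamma>) / real N) \<longlonglongrightarrow> 0" by (rule lim_const_over_n)
  qed
  moreover have "(\<lambda>N. (\<Sum>n<N. bump_series \<delta> n x) / of_nat N) \<longlonglongrightarrow> bump_periodic \<delta> x"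
    using d by (intro Cesaro_mean_tendsto bump_series_tendsto) auto
  ultimately show ?thesis using LIMSEQ_unique by blast
qed

section \<open>Kaufman's kernel\<close>

abbreviation base :: "complex measure" where
  "base \<equiv> plane_measure bump"

definition ghat :: "(complex \<Rightarrow> real) \<Rightarrow> complex \<Rightarrow> complex" where
  "ghat G \<xi> = (LINT x|base. of_real (G x) * wave \<xi> x)"

text \<open>The summability carried along the construction: it survives multiplication by the kernels, and it
  is exactly what the perturbation estimate consumes.\<close>
definition rough_bound :: "(complex \<Rightarrow> real) \<Rightarrow> real \<Rightarrow> bool" where
  "rough_bound G W \<longleftrightarrow> (\<forall>\<xi> S. finite S \<longrightarrow> S \<subseteq> gauss_ints \<longrightarrow>
     (\<Sum>k\<in>S. cmod (ghat G (\<xi> - k)) * (1 + cmod (\<xi> - k))) \<le> W)"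

text \<open>\<open>2 * M\<close> bounds the \<open>supnorm\<close> of all denominators of level
  \<open>M\<close>, so for nonnegative \<tau> this tolerance is admissible for each of them.\<close>

definition scale :: "real \<Rightarrow> nat \<Rightarrow> real" where
  "scale \<tau> M = (2 * real M) powr (-\<tau>)"

text \<open>The first coordinate alone keeps the size above \<open>M\<close>, so a box can replace
  an annulus. It has exactly \<open>M * M\<close> points, the number by which \<open>kernel\<close>
  divides, so the constant Fourier coefficient of the kernel is 1.\<close>

definition denominators :: "nat \<Rightarrow> complex set" where
  "denominators M = (\<lambda>(a, b). Complex (real a) (real b)) ` ({M<..2*M} \<times> {0<..M})"

definition kernel :: "real \<Rightarrow> nat \<Rightarrow> complex \<Rightarrow> real" where
  "kernel \<tau> M x = (\<Sum>q\<in>denominators M.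
     Re (bump_periodic (scale \<tau> M) (Re (q * x))) * Re (bump_periodic (scale \<tau> M) (Im (q * x)))) / (real M)\<^sup>2"

definition gauss_box :: "nat \<Rightarrow> complex set" where
  "gauss_box n = (\<lambda>(i, j). Complex (of_int i) (of_int j)) ` ({-int n..int n} \<times> {-int n..int n})"

definition kernel_coeff :: "real \<Rightarrow> complex \<Rightarrow> complex" where
  "kernel_coeff \<delta> m = bump_hat (\<delta> * Re m) * bump_hat (\<delta> * Im m)"

lemma prob_space_base: "prob_space base"
  by (rule prob_space_plane_measure[OF prob_space_bump]) simp

lemma fourier_transform_base: "fourier_transform base \<xi> = bump_hat (Re \<xi>) * bump_hat (Im \<xi>)"
  unfolding bump_hat_def by (rule fourier_transform_plane_measure[OF prob_space_bump]) simp

lemma AE_base: "AE x in base. supnorm x \<le> 1/2"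
proof -
  interpret prob_space bump by (rule prob_space_bump)
  interpret pair_prob_space bump bump ..
  have C: "(\<lambda>(x, y). Complex x y) \<in> borel_measurable (bump \<Otimes>\<^sub>M bump)"
    by (rule borel_measurable_pair_Complex) simp_all
  have "(\<lambda>z. supnorm z) \<in> borel_measurable borel" unfolding supnorm_def by measurable
  then have m: "{z \<in> space borel. supnorm z \<le> 1/2} \<in> sets borel" by measurable
  have "AE x in bump. AE y in bump. supnorm (case (x, y) of (x, y) \<Rightarrow> Complex x y) \<le> 1/2"
    using AE_bump
  proof eventually_elim
    case (elim x)
    show ?case using AE_bump by eventually_elim (use elim in \<open>simp add: supnorm_def\<close>)
  qed
  then have "AE z in bump \<Otimes>\<^sub>M bump. supnorm (case z of (x, y) \<Rightarrow> Complex x y) \<le> 1/2"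
    using measurable_sets[OF C m] by (intro AE_pair_measure) (auto simp: vimage_def Int_def conj_commute)
  then show ?thesis
    unfolding plane_measure_def by (subst AE_distr_iff[OF C]) (use m in auto)
qed

lemma one_plus_cmod_le: "1 + cmod z \<le> (1 + \<bar>Re z\<bar>) * (1 + \<bar>Im z\<bar>)"
proof -
  have "(1 + \<bar>Re z\<bar>) * (1 + \<bar>Im z\<bar>) = 1 + \<bar>Re z\<bar> + \<bar>Im z\<bar> + \<bar>Re z\<bar> * \<bar>Im z\<bar>" by (simp add: algebra_simps)
  moreover have "0 \<le> \<bar>Re z\<bar> * \<bar>Im z\<bar>" by simp
  ultimately show ?thesis using cmod_le[of z] by linarith
qed

lemma one_plus_cmod_mult_le: "1 + cmod (w * z) \<le> (1 + cmod w) * (1 + cmod z)"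
  by (simp add: norm_mult algebra_simps)

text \<open>The weight is submultiplicative. This moves it between a frequency and its translates,
  and trades decay in \<open>k\<close> for decay in \<xi>.\<close>

lemma one_plus_cmod_add_le: "1 + cmod (w + z) \<le> (1 + cmod w) * (1 + cmod z)"
proof -
  have "(1 + cmod w) * (1 + cmod z) = 1 + cmod w + cmod z + cmod w * cmod z" by (simp add: algebra_simps)
  moreover have "0 \<le> cmod w * cmod z" by simp
  ultimately show ?thesis using norm_triangle_ineq[of w z] by linarith
qed

lemma rough_bound_1:
  obtains W where "rough_bound (\<lambda>_. 1) W"
proof -
  obtain B where B: "\<And>F t. finite F \<Longrightarrow> F \<subseteq> \<int> \<Longrightarrow> (\<Sum>x\<in>F. cmod (bump_hat (t - x)) * (1 + \<bar>t - x\<bar>)) \<le> B" "0 \<le> B"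
    using bump_hat_translates_bounded by blast
  have "(\<Sum>k\<in>S. cmod (ghat (\<lambda>_. 1) (\<xi> - k)) * (1 + cmod (\<xi> - k))) \<le> B * B"
    if S: "finite S" "S \<subseteq> gauss_ints" for \<xi> S
  proof -
    define f where "f t x = cmod (bump_hat (t - x)) * (1 + \<bar>t - x\<bar>)" for t x
    have "(\<Sum>k\<in>S. cmod (ghat (\<lambda>_. 1) (\<xi> - k)) * (1 + cmod (\<xi> - k))) \<le> (\<Sum>k\<in>S. f (Re \<xi>) (Re k) * f (Im \<xi>) (Im k))"
    proof (rule sum_mono)
      fix k
      have "ghat (\<lambda>_. 1) (\<xi> - k) = bump_hat (Re \<xi> - Re k) * bump_hat (Im \<xi> - Im k)"
        using fourier_transform_base[of "\<xi> - k"] by (simp add: ghat_def fourier_transform_def)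
      then have "cmod (ghat (\<lambda>_. 1) (\<xi> - k)) * (1 + cmod (\<xi> - k)) \<le>
         cmod (bump_hat (Re \<xi> - Re k)) * cmod (bump_hat (Im \<xi> - Im k)) * ((1 + \<bar>Re \<xi> - Re k\<bar>) * (1 + \<bar>Im \<xi> - Im k\<bar>))"
        using one_plus_cmod_le[of "\<xi> - k"] by (simp add: norm_mult mult_left_mono)
      then show "cmod (ghat (\<lambda>_. 1) (\<xi> - k)) * (1 + cmod (\<xi> - k)) \<le> f (Re \<xi>) (Re k) * f (Im \<xi>) (Im k)"
        by (simp only: f_def mult_ac)
    qed
    also have "\<dots> \<le> (\<Sum>x\<in>Re ` S. f (Re \<xi>) x) * (\<Sum>y\<in>Im ` S. f (Im \<xi>) y)"
      using S by (intro gauss_sum_prod_le) (auto simp: f_def)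
    also have "\<dots> \<le> B * B"
      using S B unfolding f_def
      by (intro mult_mono B sum_nonneg) (auto simp: gauss_ints_def)
    finally show ?thesis .
  qed
  then show ?thesis using that[of "B * B"] by (simp add: rough_bound_def)
qed

lemma rough_bound_nonneg: "rough_bound G W \<Longrightarrow> 0 \<le> W"
  unfolding rough_bound_def by (metis finite.emptyI empty_subsetI sum.empty)

lemma scale_bounds:
  assumes "\<tau> \<ge> 1" "M \<ge> 1"
  shows "0 < scale \<tau> M" "scale \<tau> M \<le> 1/2"
proof -
  show "0 < scale \<tau> M" using assms by (simp add: scale_def)
  have "(2 * real M) powr (-\<tau>) \<le> (2 * real M) powr (-1)" using assms by (intro powr_mono) auto
  also have "\<dots> \<le> 2 powr (-1)" using assms by (intro powr_mono2') auto
  finally show "scale \<tau> M \<le> 1/2" by (simp add: scale_def powr_minus)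
qed

lemma finite_denominators [simp]: "finite (denominators M)"
  by (simp add: denominators_def)

lemma card_denominators: "card (denominators M) = M\<^sup>2"
  unfolding denominators_def by (subst card_image) (auto simp: inj_on_def power2_eq_square)

lemma denominators_props:
  assumes "q \<in> denominators M"
  shows "q \<in> gauss_ints" "q \<noteq> 0" "real M \<le> supnorm q" "supnorm q \<le> 2 * real M" "cmod q \<le> 3 * real M"
proof -
  obtain a b where ab: "q = Complex (real a) (real b)" "M < a" "a \<le> 2 * M" "0 < b" "b \<le> M"
    using assms by (auto simp: denominators_def)
  show "q \<in> gauss_ints" using ab by (simp add: gauss_ints_def)
  show "q \<noteq> 0" using ab by (simp add: complex_eq_iff)
  show "real M \<le> supnorm q" "supnorm q \<le> 2 * real M" using ab by (auto simp: supnorm_def)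
  show "cmod q \<le> 3 * real M" using cmod_le[of q] ab by simp
qed

lemma finite_gauss_box [simp]: "finite (gauss_box n)"
  by (simp add: gauss_box_def)

lemma gauss_box_subset: "gauss_box n \<subseteq> gauss_ints"
  by (auto simp: gauss_box_def gauss_ints_def)

lemma zero_in_gauss_box: "0 \<in> gauss_box n"
  unfolding gauss_box_def by (rule image_eqI[of _ _ "(0, 0)"]) (auto simp: complex_eq_iff)

lemma sum_gauss_box:
  "(\<Sum>m\<in>gauss_box n. f (Re m) (Im m)) = (\<Sum>i\<in>{-int n..int n}. \<Sum>j\<in>{-int n..int n}. f (of_int i) (of_int j))"
  unfolding gauss_box_def sum.cartesian_product
  by (subst sum.reindex) (auto simp: inj_on_def intro!: sum.cong)

text \<open>Multiplication by \<open>cnj q\<close> is the adjoint of multiplication by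
  \<open>q\<close> for the real inner product of the plane. This is why a function that is periodic
  in \<open>q * x\<close> has its frequencies at the points \<open>cnj q * m\<close>.\<close>

lemma sum_gauss_box_wave:
  "(\<Sum>m\<in>gauss_box n. kernel_coeff \<delta> m * wave (- (cnj q * m)) x) =
     bump_series \<delta> n (Re (q * x)) * bump_series \<delta> n (Im (q * x))"
proof -
  define f where "f u v = bump_hat (\<delta> * u) * cis (u * (2 * pi * Re (q * x))) * (bump_hat (\<delta> * v) * cis (v * (2 * pi * Im (q * x))))" for u v
  have "(\<Sum>m\<in>gauss_box n. kernel_coeff \<delta> m * wave (- (cnj q * m)) x) = (\<Sum>m\<in>gauss_box n. f (Re m) (Im m))"
  proof (rule sum.cong)
    fix m
    have "wave (- (cnj q * m)) x = cis (Re m * (2 * pi * Re (q * x))) * cis (Im m * (2 * pi * Im (q * x)))"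
      unfolding cis_mult by (rule arg_cong[where f = cis]) (simp add: algebra_simps)
    then show "kernel_coeff \<delta> m * wave (- (cnj q * m)) x = f (Re m) (Im m)"
      by (simp only: kernel_coeff_def f_def mult_ac)
  qed simp
  also have "\<dots> = (\<Sum>i\<in>{-int n..int n}. \<Sum>j\<in>{-int n..int n}. f (of_int i) (of_int j))"
    by (rule sum_gauss_box)
  also have "\<dots> = bump_series \<delta> n (Re (q * x)) * bump_series \<delta> n (Im (q * x))"
    unfolding f_def bump_series_def sum_product ..
  finally show ?thesis .
qed

lemma kernel_nonneg:
  assumes "\<tau> \<ge> 1" "M \<ge> 1"
  shows "0 \<le> kernel \<tau> M x"
  unfolding kernel_def
  using scale_bounds[OF assms] by (intro divide_nonneg_nonneg sum_nonneg mult_nonneg_nonneg bump_periodic_nonneg) auto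

abbreviation kernel_partial :: "real \<Rightarrow> nat \<Rightarrow> nat \<Rightarrow> complex \<Rightarrow> complex" where
  "kernel_partial \<tau> M n x \<equiv> (\<Sum>q\<in>denominators M. \<Sum>m\<in>gauss_box n. kernel_coeff (scale \<tau> M) m * wave (- (cnj q * m)) x) / (of_nat M)\<^sup>2"

lemma kernel_partial_tendsto:
  assumes "\<tau> \<ge> 1" "M \<ge> 1"
  shows "(\<lambda>n. kernel_partial \<tau> M n x)
     \<longlonglongrightarrow> of_real (kernel \<tau> M x)"
proof -
  let ?\<delta> = "scale \<tau> M"
  have d: "0 < ?\<delta>" "?\<delta> \<le> 1" using scale_bounds[OF assms] by auto
  have "(\<lambda>n. (\<Sum>q\<in>denominators M. bump_series ?\<delta> n (Re (q * x)) * bump_series ?\<delta> n (Im (q * x))) / (of_nat M)\<^sup>2)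
     \<longlonglongrightarrow> (\<Sum>q\<in>denominators M. bump_periodic ?\<delta> (Re (q * x)) * bump_periodic ?\<delta> (Im (q * x))) / (of_nat M)\<^sup>2"
    using assms by (intro tendsto_intros bump_series_tendsto d) auto
  also have "(\<Sum>q\<in>denominators M. bump_periodic ?\<delta> (Re (q * x)) * bump_periodic ?\<delta> (Im (q * x))) / (of_nat M)\<^sup>2 = of_real (kernel \<tau> M x)"
    unfolding kernel_def using bump_periodic_nonneg(1)[OF d] by simp
  finally show ?thesis unfolding sum_gauss_box_wave .
qed

lemma kernel_partial_bounded:
  assumes "\<tau> \<ge> 1" "M \<ge> 1"
  obtains B where "0 \<le> B" "\<And>n x. cmod (kernel_partial \<tau> M n x) \<le> B"
proof -
  let ?\<delta> = "scale \<tau> M"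
  have d: "0 < ?\<delta>" "?\<delta> \<le> 1" using scale_bounds[OF assms] by auto
  obtain B where B: "\<And>F. finite F \<Longrightarrow> F \<subseteq> \<int> \<Longrightarrow> (\<Sum>x\<in>F. cmod (bump_hat (?\<delta> * x)) * (1 + \<bar>x\<bar>)) \<le> B" "0 \<le> B"
    using bump_hat_dilates_bounded[OF d] by blast
  have "cmod (kernel_partial \<tau> M n x)
     \<le> (\<Sum>q\<in>denominators M. B * B) / (real M)\<^sup>2" for n x
    unfolding norm_divide norm_power norm_of_nat sum_gauss_box_wave
    by (intro divide_right_mono order_trans[OF norm_sum] sum_mono)
       (auto simp: norm_mult intro!: mult_mono bump_series_norm_le[OF B(1)] B(2))
  then show ?thesis using that[of "(\<Sum>q\<in>denominators M. B * B) / (real M)\<^sup>2"] B(2) by (auto intro: sum_nonneg)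
qed

lemma kernel_bounded:
  assumes "\<tau> \<ge> 1" "M \<ge> 1"
  obtains B where "\<And>x. \<bar>kernel \<tau> M x\<bar> \<le> B"
proof -
  obtain B where B: "\<And>n x. cmod (kernel_partial \<tau> M n x) \<le> B"
    using kernel_partial_bounded[OF assms] by blast
  have "cmod (of_real (kernel \<tau> M x)) \<le> B" for x
    by (rule LIMSEQ_le_const2[OF tendsto_norm[OF kernel_partial_tendsto[OF assms, of x]]]) (use B in auto)
  then show ?thesis using that by auto
qed

lemma borel_measurable_kernel:
  assumes "\<tau> \<ge> 1" "M \<ge> 1"
  shows "kernel \<tau> M \<in> borel_measurable borel"
proof -
  have "(\<lambda>x. complex_of_real (kernel \<tau> M x)) \<in> borel_measurable borel"
    by (rule borel_measurable_LIMSEQ_metric[OF _ kernel_partial_tendsto[OF assms]]) measurable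
  then have "(\<lambda>x. Re (complex_of_real (kernel \<tau> M x))) \<in> borel_measurable borel" by measurable
  then show ?thesis by simp
qed

section \<open>Multiplication of a density by the kernel\<close>

definition admissible :: "(complex \<Rightarrow> real) \<Rightarrow> bool" where
  "admissible G \<longleftrightarrow> G \<in> borel_measurable borel \<and> (\<forall>x. 0 \<le> G x) \<and> (\<exists>B. \<forall>x. G x \<le> B) \<and> (\<exists>W. rough_bound G W)"

lemma integral_double_sum:
  fixes h :: "'b \<Rightarrow> 'a \<Rightarrow> complex"
  assumes "\<And>\<eta>. integrable N (h \<eta>)"
  shows "(LINT x|N. (\<Sum>q\<in>Q. \<Sum>m\<in>B. c m * h (\<eta> q m) x) / K) = (\<Sum>q\<in>Q. \<Sum>m\<in>B. c m * (LINT x|N. h (\<eta> q m) x)) / K"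
  by (simp add: Bochner_Integration.integral_sum assms)

text \<open>Dominated convergence. The later estimates can then be made on finite frequency sums,
  uniformly in the truncation \<open>n\<close>.\<close>

lemma ghat_kernel_tendsto:
  assumes \<tau>: "\<tau> \<ge> 1" "M \<ge> 1" and G: "G \<in> borel_measurable borel" "\<And>x. \<bar>G x\<bar> \<le> A"
  shows "(\<lambda>n. (\<Sum>q\<in>denominators M. \<Sum>m\<in>gauss_box n. kernel_coeff (scale \<tau> M) m * ghat G (\<xi> - cnj q * m)) / (of_nat M)\<^sup>2)
    \<longlonglongrightarrow> ghat (\<lambda>x. G x * kernel \<tau> M x) \<xi>"
proof -
  note [measurable] = G(1)
  have A: "0 \<le> A" using G(2)[of 0] by linarith
  define P where "P n x = kernel_partial \<tau> M n x" for n x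
  obtain B where B: "0 \<le> B" "\<And>n x. cmod (P n x) \<le> B"
    using kernel_partial_bounded[OF \<tau>] unfolding P_def by blast
  have Gw_meas: "(\<lambda>x. of_real (G x) * wave \<eta> x) \<in> borel_measurable base" for \<eta>
    unfolding measurable_cong_sets[OF sets_plane_measure refl] by measurable
  have Gw: "integrable base (\<lambda>x. of_real (G x) * wave \<eta> x)" for \<eta>
    by (rule prob_space_integrable_bounded[OF prob_space_base Gw_meas, where B = A]) (use G(2) in \<open>simp add: norm_mult\<close>)
  have int: "(LINT x|base. of_real (G x) * wave \<xi> x * P n x) =
     (\<Sum>q\<in>denominators M. \<Sum>m\<in>gauss_box n. kernel_coeff (scale \<tau> M) m * ghat G (\<xi> - cnj q * m)) / (of_nat M)\<^sup>2" for n
  proof -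
    have "of_real (G x) * wave \<xi> x * P n x = (\<Sum>q\<in>denominators M. \<Sum>m\<in>gauss_box n.
       kernel_coeff (scale \<tau> M) m * (of_real (G x) * wave (\<xi> - cnj q * m) x)) / (of_nat M)\<^sup>2" for x
    proof -
      have "wave \<xi> x * wave (- (cnj q * m)) x = wave (\<xi> - cnj q * m) x" for q m
        unfolding cis_mult by (rule arg_cong[where f = cis]) (simp add: algebra_simps)
      then have "wave \<xi> x * (kernel_coeff (scale \<tau> M) m * wave (- (cnj q * m)) x) = kernel_coeff (scale \<tau> M) m * wave (\<xi> - cnj q * m) x" for q m
        by (metis mult.left_commute)
      then have "wave \<xi> x * P n x = (\<Sum>q\<in>denominators M. \<Sum>m\<in>gauss_box n.
         kernel_coeff (scale \<tau> M) m * wave (\<xi> - cnj q * m) x) / (of_nat M)\<^sup>2"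
        unfolding P_def times_divide_eq_right sum_distrib_left by presburger
      then show ?thesis
        by (simp only: mult.assoc) (simp add: sum_distrib_left mult_ac)
    qed
    then show ?thesis unfolding ghat_def
      by (simp only: integral_double_sum[where h = "\<lambda>\<eta> x. of_real (G x) * wave \<eta> x", OF Gw])
  qed
  have "(\<lambda>n. LINT x|base. of_real (G x) * wave \<xi> x * P n x) \<longlonglongrightarrow> (LINT x|base. of_real (G x) * wave \<xi> x * of_real (kernel \<tau> M x))"
  proof (rule integral_dominated_convergence[where w = "\<lambda>_. A * B"])
    interpret prob_space base by (rule prob_space_base)
    show "integrable base (\<lambda>_. A * B)" by simp
    show "(\<lambda>x. of_real (G x) * wave \<xi> x * of_real (kernel \<tau> M x)) \<in> borel_measurable base"
      unfolding measurable_cong_sets[OF sets_plane_measure refl] 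
      using borel_measurable_kernel[OF \<tau>] by measurable
    show "(\<lambda>x. of_real (G x) * wave \<xi> x * P n x) \<in> borel_measurable base" for n
      unfolding measurable_cong_sets[OF sets_plane_measure refl] P_def by measurable
    show "AE x in base. (\<lambda>n. of_real (G x) * wave \<xi> x * P n x) \<longlonglongrightarrow> of_real (G x) * wave \<xi> x * of_real (kernel \<tau> M x)"
      unfolding P_def by (intro AE_I2 tendsto_intros kernel_partial_tendsto \<tau>)
    show "AE x in base. norm (of_real (G x) * wave \<xi> x * P n x) \<le> A * B" for n
      using G(2) B A by (auto simp: norm_mult intro!: mult_mono)
  qed
  then show ?thesis unfolding int by (simp add: ghat_def mult_ac)
qed

text \<open>\<open>rough_bound\<close> is uniform in \<xi>, which absorbs the shift by
  \<open>cnj q * m\<close>. Moving the weight to the shifted frequency costs at most the factors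
  \<open>1 + cmod q\<close> and \<open>1 + cmod m\<close>, and the coefficients remain summable
  against the latter. The new constant may be huge compared with \<open>W\<close>.\<close>

lemma rough_bound_kernel:
  assumes \<tau>: "\<tau> \<ge> 1" "M \<ge> 1" and G: "G \<in> borel_measurable borel" "\<And>x. \<bar>G x\<bar> \<le> A" and W: "rough_bound G W"
  obtains W' where "rough_bound (\<lambda>x. G x * kernel \<tau> M x) W'"
proof -
  let ?\<delta> = "scale \<tau> M"
  let ?Q = "denominators M"
  let ?c = "\<lambda>m. cmod (kernel_coeff ?\<delta> m)"
  have W0: "0 \<le> W" by (rule rough_bound_nonneg[OF W])
  have d: "0 < ?\<delta>" "?\<delta> \<le> 1" using scale_bounds[OF \<tau>] by auto
  obtain B where B: "\<And>F. finite F \<Longrightarrow> F \<subseteq> \<int> \<Longrightarrow> (\<Sum>x\<in>F. cmod (bump_hat (?\<delta> * x)) * (1 + \<bar>x\<bar>)) \<le> B" "0 \<le> B"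
    using bump_hat_dilates_bounded[OF d] by blast
  define P where "P n \<xi> = (\<Sum>q\<in>?Q. \<Sum>m\<in>gauss_box n. kernel_coeff ?\<delta> m * ghat G (\<xi> - cnj q * m)) / (of_nat M)\<^sup>2" for n \<xi>
  have P: "(\<lambda>n. P n \<xi>) \<longlonglongrightarrow> ghat (\<lambda>x. G x * kernel \<tau> M x) \<xi>" for \<xi>
    unfolding P_def by (rule ghat_kernel_tendsto[OF \<tau> G])
  define W' where "W' = (\<Sum>q\<in>?Q. (1 + cmod q) * (B * B) * W) / (real M)\<^sup>2"
  have coeff: "(\<Sum>m\<in>gauss_box n. ?c m * (1 + cmod m)) \<le> B * B" for n
  proof -
    define f where "f x = cmod (bump_hat (?\<delta> * x)) * (1 + \<bar>x\<bar>)" for x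
    have "(\<Sum>m\<in>gauss_box n. ?c m * (1 + cmod m)) \<le> (\<Sum>m\<in>gauss_box n. f (Re m) * f (Im m))"
    proof (rule sum_mono)
      fix m
      have "?c m * (1 + cmod m) \<le> ?c m * ((1 + \<bar>Re m\<bar>) * (1 + \<bar>Im m\<bar>))"
        by (intro mult_left_mono one_plus_cmod_le) auto
      then show "?c m * (1 + cmod m) \<le> f (Re m) * f (Im m)"
        unfolding kernel_coeff_def f_def norm_mult by (simp only: mult_ac)
    qed
    also have "\<dots> \<le> (\<Sum>x\<in>Re ` gauss_box n. f x) * (\<Sum>y\<in>Im ` gauss_box n. f y)"
      by (intro gauss_sum_prod_le) (auto simp: f_def)
    also have "\<dots> \<le> B * B"
      unfolding f_def by (intro mult_mono B sum_nonneg) (auto simp: gauss_box_def)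
    finally show ?thesis .
  qed
  have bound: "(\<Sum>k\<in>S. cmod (P n (\<xi> - k)) * (1 + cmod (\<xi> - k))) \<le> W'" if S: "finite S" "S \<subseteq> gauss_ints" for n \<xi> S
  proof -
    define g where "g \<eta> = cmod (ghat G \<eta>) * (1 + cmod \<eta>)" for \<eta>
    have "cmod (P n (\<xi> - k)) * (1 + cmod (\<xi> - k)) \<le>
      (\<Sum>q\<in>?Q. \<Sum>m\<in>gauss_box n. ?c m * (1 + cmod (cnj q * m)) * g ((\<xi> - cnj q * m) - k)) / (real M)\<^sup>2" for k
    proof -
      have "cmod (P n (\<xi> - k)) * (1 + cmod (\<xi> - k)) \<le>
         (\<Sum>q\<in>?Q. \<Sum>m\<in>gauss_box n. ?c m * cmod (ghat G (\<xi> - k - cnj q * m))) / (real M)\<^sup>2 * (1 + cmod (\<xi> - k))"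
        unfolding P_def norm_divide norm_power norm_of_nat
        by (intro mult_right_mono divide_right_mono order_trans[OF norm_sum] sum_mono) (auto simp: norm_mult)
      also have "\<dots> = (\<Sum>q\<in>?Q. \<Sum>m\<in>gauss_box n. ?c m * cmod (ghat G (\<xi> - k - cnj q * m)) * (1 + cmod (\<xi> - k))) / (real M)\<^sup>2"
        by (simp add: sum_distrib_right)
      also have "\<dots> \<le> (\<Sum>q\<in>?Q. \<Sum>m\<in>gauss_box n. ?c m * (1 + cmod (cnj q * m)) * g ((\<xi> - cnj q * m) - k)) / (real M)\<^sup>2"
      proof (intro divide_right_mono sum_mono)
        fix q m
        have "1 + cmod (\<xi> - k) \<le> (1 + cmod (cnj q * m)) * (1 + cmod (\<xi> - k - cnj q * m))"
          using one_plus_cmod_add_le[of "cnj q * m" "\<xi> - k - cnj q * m"] by simp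
        then have "?c m * cmod (ghat G (\<xi> - k - cnj q * m)) * (1 + cmod (\<xi> - k)) \<le>
           ?c m * cmod (ghat G (\<xi> - k - cnj q * m)) * ((1 + cmod (cnj q * m)) * (1 + cmod (\<xi> - k - cnj q * m)))"
          by (intro mult_left_mono) auto
        moreover have eq: "(\<xi> - cnj q * m) - k = \<xi> - k - cnj q * m" by simp
        ultimately show "?c m * cmod (ghat G (\<xi> - k - cnj q * m)) * (1 + cmod (\<xi> - k)) \<le>
           ?c m * (1 + cmod (cnj q * m)) * g ((\<xi> - cnj q * m) - k)"
          unfolding g_def eq by (simp only: mult_ac)
      qed simp
      finally show ?thesis .
    qed
    then have "(\<Sum>k\<in>S. cmod (P n (\<xi> - k)) * (1 + cmod (\<xi> - k))) \<le>
      (\<Sum>k\<in>S. (\<Sum>q\<in>?Q. \<Sum>m\<in>gauss_box n. ?c m * (1 + cmod (cnj q * m)) * g ((\<xi> - cnj q * m) - k)) / (real M)\<^sup>2)"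
      by (rule sum_mono)
    also have "\<dots> = (\<Sum>q\<in>?Q. \<Sum>m\<in>gauss_box n. ?c m * (1 + cmod (cnj q * m)) * (\<Sum>k\<in>S. g ((\<xi> - cnj q * m) - k))) / (real M)\<^sup>2"
    proof -
      have "(\<Sum>k\<in>S. \<Sum>q\<in>?Q. \<Sum>m\<in>gauss_box n. h q m k) = (\<Sum>q\<in>?Q. \<Sum>m\<in>gauss_box n. \<Sum>k\<in>S. h q m k)" for h :: "complex \<Rightarrow> complex \<Rightarrow> complex \<Rightarrow> real"
        by (subst sum.swap, rule sum.cong[OF refl], rule sum.swap)
      then show ?thesis by (simp only: sum_divide_distrib[symmetric] sum_distrib_left)
    qed
    also have "\<dots> \<le> (\<Sum>q\<in>?Q. \<Sum>m\<in>gauss_box n. (1 + cmod q) * (?c m * (1 + cmod m)) * W) / (real M)\<^sup>2"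
    proof (intro divide_right_mono sum_mono)
      fix q m
      have sW: "(\<Sum>k\<in>S. g ((\<xi> - cnj q * m) - k)) \<le> W"
        using W S unfolding rough_bound_def g_def by blast
      have "?c m * (1 + cmod (cnj q * m)) \<le> ?c m * ((1 + cmod (cnj q)) * (1 + cmod m))"
        by (intro mult_left_mono one_plus_cmod_mult_le) auto
      then have c: "?c m * (1 + cmod (cnj q * m)) \<le> (1 + cmod q) * (?c m * (1 + cmod m))"
        by (simp only: complex_mod_cnj mult_ac)
      show "?c m * (1 + cmod (cnj q * m)) * (\<Sum>k\<in>S. g ((\<xi> - cnj q * m) - k)) \<le>
         (1 + cmod q) * (?c m * (1 + cmod m)) * W"
        by (rule mult_mono[OF c sW]) (auto simp: g_def intro!: sum_nonneg mult_nonneg_nonneg)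
    qed simp
    also have "\<dots> = (\<Sum>q\<in>?Q. (1 + cmod q) * (\<Sum>m\<in>gauss_box n. ?c m * (1 + cmod m)) * W) / (real M)\<^sup>2"
      by (simp only: sum_distrib_left sum_distrib_right)
    also have "\<dots> \<le> W'"
      unfolding W'_def using W0 coeff[of n] by (intro divide_right_mono sum_mono mult_right_mono mult_left_mono) auto
    finally show ?thesis .
  qed
  have "(\<Sum>k\<in>S. cmod (ghat (\<lambda>x. G x * kernel \<tau> M x) (\<xi> - k)) * (1 + cmod (\<xi> - k))) \<le> W'"
    if S: "finite S" "S \<subseteq> gauss_ints" for \<xi> S
  proof (rule LIMSEQ_le_const2)
    show "(\<lambda>n. \<Sum>k\<in>S. cmod (P n (\<xi> - k)) * (1 + cmod (\<xi> - k))) \<longlonglongrightarrow>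
      (\<Sum>k\<in>S. cmod (ghat (\<lambda>x. G x * kernel \<tau> M x) (\<xi> - k)) * (1 + cmod (\<xi> - k)))"
      by (intro tendsto_intros P)
    show "\<exists>N. \<forall>n\<ge>N. (\<Sum>k\<in>S. cmod (P n (\<xi> - k)) * (1 + cmod (\<xi> - k))) \<le> W'"
      using bound[OF S] by blast
  qed
  then show ?thesis using that[of W'] by (simp add: rough_bound_def)
qed

lemma kernel_coeff_0 [simp]: "kernel_coeff \<delta> 0 = 1"
  by (simp add: kernel_coeff_def)

lemma powr_le_one_plus:
  fixes u b :: real
  assumes "0 \<le> u" "0 \<le> b" "b \<le> 1"
  shows "u powr b \<le> 1 + u"
proof (cases "u \<le> 1")
  case True
  then have "u powr b \<le> 1" using assms by (intro powr_le1) auto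
  then show ?thesis using assms by simp
next
  case False
  then have "u powr b \<le> u powr 1" using assms by (intro powr_mono) auto
  then show ?thesis using False by simp
qed

text \<open>Linear decay in each coordinate is enough: the product of the two factors
  \<open>1 + \<bar>\<delta> * Re m\<bar>\<close> and \<open>1 + \<bar>\<delta> * Im m\<bar>\<close>
  is at least 1 + \<delta>|m|, which dominates every power of \<delta>|m| with exponent in [0, 1].
  The constant is 27 squared.\<close>

lemma kernel_coeff_bound:
  assumes b: "0 \<le> b" "b \<le> 1" and d: "0 < \<delta>" and m: "m \<noteq> 0"
  shows "cmod (kernel_coeff \<delta> m) \<le> 729 * (\<delta> * cmod m) powr (-b)"
proof -
  have le: "cmod (bump_hat t) \<le> 27 / (1 + \<bar>t\<bar>)" for t
  proof -
    have "(1 + \<bar>t\<bar>) ^ 1 \<le> (1 + \<bar>t\<bar>) ^ 3" by (intro power_increasing) auto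
    then have "27 / (1 + \<bar>t\<bar>) ^ 3 \<le> 27 / (1 + \<bar>t\<bar>)" by (intro divide_left_mono) (auto simp: add_pos_nonneg)
    then show ?thesis using bump_hat_bound[of t] by linarith
  qed
  have pos: "0 < \<delta> * cmod m" using d m by simp
  have "cmod (kernel_coeff \<delta> m) \<le> 27 / (1 + \<bar>\<delta> * Re m\<bar>) * (27 / (1 + \<bar>\<delta> * Im m\<bar>))"
    unfolding kernel_coeff_def norm_mult by (intro mult_mono le) auto
  also have "\<dots> = 729 / ((1 + \<bar>\<delta> * Re m\<bar>) * (1 + \<bar>\<delta> * Im m\<bar>))" by simp
  also have "\<dots> \<le> 729 / (\<delta> * cmod m) powr b"
  proof (rule divide_left_mono)
    have "(\<delta> * cmod m) powr b \<le> 1 + cmod (\<delta> *\<^sub>R m)"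
      using powr_le_one_plus[of "\<delta> * cmod m" b] pos b d by simp
    also have "\<dots> \<le> (1 + \<bar>\<delta> * Re m\<bar>) * (1 + \<bar>\<delta> * Im m\<bar>)"
      using one_plus_cmod_le[of "\<delta> *\<^sub>R m"] by simp
    finally show "(\<delta> * cmod m) powr b \<le> (1 + \<bar>\<delta> * Re m\<bar>) * (1 + \<bar>\<delta> * Im m\<bar>)" .
    show "0 < (1 + \<bar>\<delta> * Re m\<bar>) * (1 + \<bar>\<delta> * Im m\<bar>) * (\<delta> * cmod m) powr b"
      using pos by (intro mult_pos_pos) (auto simp: add_pos_nonneg)
  qed simp
  finally show ?thesis by (simp add: powr_minus divide_inverse)
qed

text \<open>Kaufman's lemma: multiplication by the kernel perturbs the Fourier transform by a term of
  order \<open>|\<xi>|\<^sup>-\<^sup>a\<close>, with a gain of a power of \<open>M\<close>. A nonzero frequency \<open>k\<close> receives a contribution from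
  every \<open>q\<close> dividing it, and the divisor bound limits the number of those.\<close>
lemma ghat_kernel_diff_bound:
  assumes \<tau>: "\<tau> \<ge> 1" and ab: "0 \<le> a" "a < b" "b \<le> 1"
  obtains C where "0 \<le> C" "\<And>M G A W \<xi>. M \<ge> 1 \<Longrightarrow> G \<in> borel_measurable borel \<Longrightarrow> (\<And>x. \<bar>G x\<bar> \<le> A) \<Longrightarrow> rough_bound G W \<Longrightarrow>
     cmod (ghat (\<lambda>x. G x * kernel \<tau> M x) \<xi> - ghat G \<xi>) \<le> C * real M powr ((1 + \<tau>) * b - 2) * W * (1 + cmod \<xi>) powr (-a)"
proof -
  obtain D :: real where D: "0 \<le> D" "\<And>k. k \<in> gauss_ints \<Longrightarrow> k \<noteq> 0 \<Longrightarrow> real (card (gdivisors k)) \<le> D * cmod k powr (b - a)"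
    using gauss_divisor_bound[of "b - a"] ab by auto
  \<comment> \<open>729 is from the coefficient bound, 3 from |q| <= 3M and
    \<open>2 powr \<tau>\<close> from the width; the remaining power of \<open>M\<close> is kept
    apart as \<open>?R\<close>.\<close>
  define C1 where "C1 = 729 * (3 * 2 powr \<tau>) powr b"
  have C1: "0 \<le> C1" by (simp add: C1_def)
  have main: "cmod (ghat (\<lambda>x. G x * kernel \<tau> M x) \<xi> - ghat G \<xi>) \<le> 2 * D * C1 * real M powr ((1 + \<tau>) * b - 2) * W * (1 + cmod \<xi>) powr (-a)"
    if M: "M \<ge> 1" and G: "G \<in> borel_measurable borel" "\<And>x. \<bar>G x\<bar> \<le> A" and W: "rough_bound G W" for M G A W \<xi>
  proof -
    let ?\<delta> = "scale \<tau> M"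
    let ?Q = "denominators M"
    let ?c = "\<lambda>m. cmod (kernel_coeff ?\<delta> m)"
    let ?R = "real M powr ((1 + \<tau>) * b)"
    let ?w = "(1 + cmod \<xi>) powr (-a)"
    have d: "0 < ?\<delta>" using scale_bounds[OF \<tau> M] by simp
    have W0: "0 \<le> W" by (rule rough_bound_nonneg[OF W])
    define P where "P n = (\<Sum>q\<in>?Q. \<Sum>m\<in>gauss_box n. kernel_coeff ?\<delta> m * ghat G (\<xi> - cnj q * m)) / (of_nat M)\<^sup>2" for n
    have P: "P \<longlonglongrightarrow> ghat (\<lambda>x. G x * kernel \<tau> M x) \<xi>"
      unfolding P_def by (rule ghat_kernel_tendsto[OF \<tau> M G])
    have "cmod (P n - ghat G \<xi>) \<le> 2 * D * C1 * real M powr ((1 + \<tau>) * b - 2) * W * ?w" for n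
    proof -
      define T where "T = ?Q \<times> (gauss_box n - {0})"
      define \<kappa> where "\<kappa> = (\<lambda>(q, m). cnj q * m :: complex)"
      \<comment> \<open>The pairs are to be regrouped by the frequency that they produce, so that
        only the number of pairs per frequency has to be controlled.\<close>
      define K where "K = \<kappa> ` T"
      have finT: "finite T" by (simp add: T_def)
      have K: "finite K" "K \<subseteq> gauss_ints - {0}"
      proof -
        show "finite K" using finT by (simp add: K_def)
        show "K \<subseteq> gauss_ints - {0}"
        proof
          fix k assume "k \<in> K"
          then obtain q m where qm: "q \<in> ?Q" "m \<in> gauss_box n" "m \<noteq> 0" "k = cnj q * m"
            by (auto simp: K_def T_def \<kappa>_def)
          then have "m \<in> gauss_ints" using gauss_box_subset by blast
          then have "k \<in> gauss_ints" using qm denominators_props(1) by simp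
          moreover have "k \<noteq> 0" using qm denominators_props(2) by simp
          ultimately show "k \<in> gauss_ints - {0}" by simp
        qed
      qed
      \<comment> \<open>The number of denominators equals the divisor of the average and the
        coefficient at 0 is 1, so the terms with \<open>m = 0\<close> contribute exactly
        \<open>ghat G \<xi>\<close>.\<close>
      have "P n - ghat G \<xi> = (\<Sum>q\<in>?Q. \<Sum>m\<in>gauss_box n - {0}. kernel_coeff ?\<delta> m * ghat G (\<xi> - cnj q * m)) / (of_nat M)\<^sup>2"
      proof -
        have "(\<Sum>m\<in>gauss_box n. kernel_coeff ?\<delta> m * ghat G (\<xi> - cnj q * m)) = ghat G \<xi> +
           (\<Sum>m\<in>gauss_box n - {0}. kernel_coeff ?\<delta> m * ghat G (\<xi> - cnj q * m))" for q
          by (subst sum.remove[OF finite_gauss_box zero_in_gauss_box]) simp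
        then show ?thesis unfolding P_def using M
          by (simp add: sum.distrib card_denominators add_divide_distrib)
      qed
      also have "cmod \<dots> \<le> (\<Sum>q\<in>?Q. \<Sum>m\<in>gauss_box n - {0}. ?c m * cmod (ghat G (\<xi> - cnj q * m))) / (real M)\<^sup>2"
        unfolding norm_divide norm_power norm_of_nat
        by (intro divide_right_mono order_trans[OF norm_sum] sum_mono) (auto simp: norm_mult)
      also have "(\<Sum>q\<in>?Q. \<Sum>m\<in>gauss_box n - {0}. ?c m * cmod (ghat G (\<xi> - cnj q * m)))
          = (\<Sum>p\<in>T. ?c (snd p) * cmod (ghat G (\<xi> - \<kappa> p)))"
        unfolding T_def \<kappa>_def sum.cartesian_product by (intro sum.cong) auto
      also have "\<dots> = (\<Sum>k\<in>K. \<Sum>p\<in>{p\<in>T. \<kappa> p = k}. ?c (snd p) * cmod (ghat G (\<xi> - \<kappa> p)))"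
        unfolding K_def by (rule sum.image_gen[OF finT])
      also have "\<dots> \<le> (\<Sum>k\<in>K. 2 * D * C1 * ?R * ?w * (cmod (ghat G (\<xi> - k)) * (1 + cmod (\<xi> - k))))"
      proof (rule sum_mono)
        fix k assume "k \<in> K"
        then have k: "k \<in> gauss_ints" "k \<noteq> 0" using K by auto
        have k1: "1 \<le> cmod k" by (rule gauss_cmod_ge_1[OF k])
        have coeff: "?c (snd p) \<le> C1 * ?R * cmod k powr (-b)" if p: "p \<in> T" "\<kappa> p = k" for p
        proof -
          obtain q m where qm: "p = (q, m)" by (cases p)
          have q: "q \<in> ?Q" and m: "m \<noteq> 0" and km: "k = cnj q * m" using p qm by (auto simp: T_def \<kappa>_def)
          have cq: "0 < cmod q" "cmod q \<le> 3 * real M" using denominators_props[OF q] by auto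
          have "cmod k = cmod q * cmod m" by (simp add: km norm_mult)
          also have "\<dots> \<le> 3 * real M * cmod m" using cq by (intro mult_right_mono) auto
          finally have "cmod k / (3 * real M) \<le> cmod m" using M by (simp add: field_simps)
          then have "?\<delta> * (cmod k / (3 * real M)) \<le> ?\<delta> * cmod m" using d by (intro mult_left_mono) auto
          then have "(?\<delta> * cmod m) powr (-b) \<le> (?\<delta> * (cmod k / (3 * real M))) powr (-b)"
            using ab d M k by (intro powr_mono2') auto
          also have "?\<delta> * (cmod k / (3 * real M)) = cmod k * (3 * 2 powr \<tau> * real M powr (1 + \<tau>)) powr (-1)"
            using M by (simp add: scale_def powr_minus powr_mult powr_add field_simps)
          also have "(cmod k * (3 * 2 powr \<tau> * real M powr (1 + \<tau>)) powr (-1)) powr (-b) =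
             cmod k powr (-b) * ((3 * 2 powr \<tau>) powr b * ?R)"
          proof -
            define Y where "Y = 3 * 2 powr \<tau> * real M powr (1 + \<tau>)"
            have "0 \<le> Y" by (simp add: Y_def)
            have "(cmod k * Y powr (-1)) powr (-b) = cmod k powr (-b) * (Y powr (-1)) powr (-b)"
              by (subst powr_mult) auto
            also have "(Y powr (-1)) powr (-b) = Y powr b" unfolding powr_powr by simp
            also have "Y powr b = (3 * 2 powr \<tau>) powr b * ?R"
              unfolding Y_def by (simp add: powr_mult powr_powr)
            finally show ?thesis unfolding Y_def .
          qed
          finally have "(?\<delta> * cmod m) powr (-b) \<le> cmod k powr (-b) * ((3 * 2 powr \<tau>) powr b * ?R)" .
          then have "729 * (?\<delta> * cmod m) powr (-b) \<le> 729 * (cmod k powr (-b) * ((3 * 2 powr \<tau>) powr b * ?R))"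
            by (intro mult_left_mono) auto
          also have "\<dots> = C1 * ?R * cmod k powr (-b)" unfolding C1_def by (simp only: mult_ac)
          finally show ?thesis using kernel_coeff_bound[of b ?\<delta> m] ab d m qm by simp
        qed
        \<comment> \<open>For fixed \<open>k\<close> a pair is determined by \<open>q\<close>, since
          then \<open>m = k / cnj q\<close>; and \<open>cnj q\<close> is a divisor of
          \<open>k\<close>.\<close>
        have card: "real (card {p\<in>T. \<kappa> p = k}) \<le> D * cmod k powr (b - a)"
        proof -
          have "card {p\<in>T. \<kappa> p = k} \<le> card (gdivisors k)"
          proof (rule card_inj_on_le[where f = "\<lambda>p. cnj (fst p)"])
            show "inj_on (\<lambda>p. cnj (fst p)) {p\<in>T. \<kappa> p = k}"
              using denominators_props(2) by (auto simp: inj_on_def T_def \<kappa>_def)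
            show "(\<lambda>p. cnj (fst p)) ` {p\<in>T. \<kappa> p = k} \<subseteq> gdivisors k"
            proof clarify
              fix q m assume "(q, m) \<in> T" "k = \<kappa> (q, m)"
              then have "q \<in> ?Q" "m \<in> gauss_ints" "\<kappa> (q, m) = cnj q * m"
                using gauss_box_subset[of n] by (auto simp: T_def \<kappa>_def)
              then show "cnj (fst (q, m)) \<in> gdivisors (\<kappa> (q, m))"
                using denominators_props(1) by (auto simp: gdivisors_def gdvd_def)
            qed
          qed (rule finite_gdivisors[OF k(2)])
          then have "real (card {p\<in>T. \<kappa> p = k}) \<le> real (card (gdivisors k))" by simp
          then show ?thesis using D(2)[OF k] by linarith
        qed
        have "(\<Sum>p\<in>{p\<in>T. \<kappa> p = k}. ?c (snd p) * cmod (ghat G (\<xi> - \<kappa> p))) \<le>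
          (\<Sum>p\<in>{p\<in>T. \<kappa> p = k}. C1 * ?R * cmod k powr (-b) * cmod (ghat G (\<xi> - k)))"
          using coeff by (intro sum_mono mult_mono) (auto simp: C1)
        also have "\<dots> = real (card {p\<in>T. \<kappa> p = k}) * (C1 * ?R * cmod k powr (-b) * cmod (ghat G (\<xi> - k)))"
          by simp
        also have "\<dots> \<le> (D * cmod k powr (b - a)) * (C1 * ?R * cmod k powr (-b) * cmod (ghat G (\<xi> - k)))"
          using card C1 by (intro mult_right_mono) auto
        also have "\<dots> = D * C1 * ?R * cmod (ghat G (\<xi> - k)) * (cmod k powr (b - a) * cmod k powr (-b))"
          by (simp only: mult_ac)
        \<comment> \<open>The divisor count lowers the decay exponent from \<open>b\<close> to
          \<open>a\<close>. The decay in |k| is then moved to |\<xi>| through 1 + |\<xi>| <= (1 +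
          |k|)(1 + |\<xi> - k|); since \<open>a \<le> 1\<close>, the loss is at most the weight
          built into \<open>rough_bound\<close>, up to a factor 2.\<close>
        also have "cmod k powr (b - a) * cmod k powr (-b) = cmod k powr (-a)" by (simp flip: powr_add)
        also have "D * C1 * ?R * cmod (ghat G (\<xi> - k)) * cmod k powr (-a) \<le>
           D * C1 * ?R * cmod (ghat G (\<xi> - k)) * (2 * ?w * (1 + cmod (\<xi> - k)))"
        proof (rule mult_left_mono)
          have "cmod k powr (-a) \<le> ((1 + cmod k) / 2) powr (-a)"
            using k1 ab by (intro powr_mono2') auto
          also have "\<dots> = 2 powr a * (1 + cmod k) powr (-a)" by (rule half_powr_minus) simp
          also have "\<dots> \<le> 2 powr 1 * ((1 + cmod \<xi>) / (1 + cmod (\<xi> - k))) powr (-a)"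
          proof (intro mult_mono powr_mono powr_mono2')
            show "(1 + cmod \<xi>) / (1 + cmod (\<xi> - k)) \<le> 1 + cmod k"
              using one_plus_cmod_add_le[of k "\<xi> - k"] by (simp add: divide_le_eq add_pos_nonneg)
          qed (use ab in \<open>auto simp: add_pos_nonneg\<close>)
          also have "((1 + cmod \<xi>) / (1 + cmod (\<xi> - k))) powr (-a) = ?w * (1 + cmod (\<xi> - k)) powr a"
            by (simp add: powr_divide powr_minus field_simps)
          also have "2 powr 1 * (?w * (1 + cmod (\<xi> - k)) powr a) \<le>
             2 powr 1 * (?w * (1 + cmod (\<xi> - k)) powr 1)"
            using ab by (intro mult_left_mono powr_mono) auto
          finally show "cmod k powr (-a) \<le> 2 * ?w * (1 + cmod (\<xi> - k))" 
            by (simp add: add_pos_nonneg)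
        qed (use D C1 in auto)
        finally show "(\<Sum>p\<in>{p\<in>T. \<kappa> p = k}. ?c (snd p) * cmod (ghat G (\<xi> - \<kappa> p))) \<le>
          2 * D * C1 * ?R * ?w * (cmod (ghat G (\<xi> - k)) * (1 + cmod (\<xi> - k)))"
          by (simp only: mult_ac)
      qed
      also have "\<dots> = 2 * D * C1 * ?R * ?w * (\<Sum>k\<in>K. cmod (ghat G (\<xi> - k)) * (1 + cmod (\<xi> - k)))"
        by (simp only: sum_distrib_left)
      also have "\<dots> \<le> 2 * D * C1 * ?R * ?w * W"
      proof (rule mult_left_mono)
        have "K \<subseteq> gauss_ints" using K by auto
        then show "(\<Sum>k\<in>K. cmod (ghat G (\<xi> - k)) * (1 + cmod (\<xi> - k))) \<le> W"
          using W K(1) unfolding rough_bound_def by simp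
      qed (use D C1 in simp)
      finally have "cmod (P n - ghat G \<xi>) \<le> 2 * D * C1 * ?R * ?w * W / (real M)\<^sup>2"
        by (simp add: divide_right_mono)
      also have "\<dots> = 2 * D * C1 * real M powr ((1 + \<tau>) * b - 2) * W * ?w"
        using M by (simp add: powr_diff powr_numeral)
      finally show ?thesis .
    qed
    then show ?thesis
      by (intro LIMSEQ_le_const2[OF tendsto_norm[OF tendsto_diff[OF P tendsto_const]]]) auto
  qed
  show ?thesis
  proof (rule that[of "2 * D * C1"])
    show "0 \<le> 2 * D * C1" using D C1 by simp
  qed (rule main)
qed

section \<open>The measure on well approximable points\<close>

lemma admissible_1: "admissible (\<lambda>_. 1)"
  unfolding admissible_def using rough_bound_1 by (auto intro: exI[of _ 1])

lemma admissibleE: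
  assumes "admissible G"
  obtains A W where "G \<in> borel_measurable borel" "\<And>x. 0 \<le> G x" "\<And>x. G x \<le> A" "rough_bound G W"
  using assms unfolding admissible_def by blast

lemma admissible_kernel:
  assumes "\<tau> \<ge> 1" "M \<ge> 1" "admissible G"
  shows "admissible (\<lambda>x. G x * kernel \<tau> M x)"
proof -
  obtain A W where G: "G \<in> borel_measurable borel" "\<And>x. 0 \<le> G x" "\<And>x. G x \<le> A" "rough_bound G W"
    using admissibleE[OF assms(3)] by blast
  have A: "\<bar>G x\<bar> \<le> A" for x using G(2,3) by simp
  have A0: "0 \<le> A" using G(2,3) order_trans by blast
  obtain B where B: "\<And>x. \<bar>kernel \<tau> M x\<bar> \<le> B" using kernel_bounded[OF assms(1,2)] by blast
  obtain W' where "rough_bound (\<lambda>x. G x * kernel \<tau> M x) W'"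
    using rough_bound_kernel[OF assms(1,2) G(1) A G(4)] by blast
  moreover have "(\<lambda>x. G x * kernel \<tau> M x) \<in> borel_measurable borel"
    using G(1) borel_measurable_kernel[OF assms(1,2)] by measurable
  moreover have "G x * kernel \<tau> M x \<le> A * B" for x
    using G(2,3) B[of x] kernel_nonneg[OF assms(1,2), of x] A0 by (intro mult_mono) auto
  ultimately show ?thesis
    unfolding admissible_def using G(2) kernel_nonneg[OF assms(1,2)] by (metis mult_nonneg_nonneg)
qed

text \<open>Each \<open>N j\<close> is chosen after \<open>G j\<close>, so the constant
  \<open>W\<close> of \<open>G j\<close> is fixed and a negative power of \<open>N j\<close> beats
  it. The factors 1/4, 1/16, ... sum to 1/3, which will keep the total mass at least 2/3, and
  \<open>j \<le> N j\<close> sends the denominators to infinity.\<close>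

lemma ghat_sequence:
  assumes \<tau>: "\<tau> \<ge> 1" and a: "0 \<le> a" "a * (1 + \<tau>) < 2"
  obtains G :: "nat \<Rightarrow> complex \<Rightarrow> real" and N :: "nat \<Rightarrow> nat" where
    "G 0 = (\<lambda>_. 1)" "\<And>j. G (Suc j) = (\<lambda>x. G j x * kernel \<tau> (N j) x)"
    "\<And>j. 1 \<le> N j" "\<And>j. j \<le> N j" "\<And>j. admissible (G j)"
    "\<And>j \<xi>. cmod (ghat (G (Suc j)) \<xi> - ghat (G j) \<xi>) \<le> (1/4) ^ Suc j * (1 + cmod \<xi>) powr (-a)"
proof -
  \<comment> \<open>The midpoint between \<open>a\<close> and 2/(1+\<tau>): the gap above
    \<open>a\<close> pays for the divisors, the gap below 2/(1+\<tau>) makes the exponent of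
    \<open>M\<close> negative.\<close>
  define b where "b = (a + 2 / (1 + \<tau>)) / 2"
  have "a < 2 / (1 + \<tau>)" using a \<tau> by (simp add: field_simps)
  moreover have "2 / (1 + \<tau>) \<le> 1" using \<tau> by simp
  ultimately have b: "a < b" "b \<le> 1" "b < 2 / (1 + \<tau>)" by (auto simp: b_def)
  have b2: "(1 + \<tau>) * b - 2 < 0" using b(3) \<tau> by (simp add: field_simps)
  obtain C where C: "0 \<le> C" "\<And>M G A W \<xi>. M \<ge> 1 \<Longrightarrow> G \<in> borel_measurable borel \<Longrightarrow> (\<And>x. \<bar>G x\<bar> \<le> A) \<Longrightarrow> rough_bound G W \<Longrightarrow>
     cmod (ghat (\<lambda>x. G x * kernel \<tau> M x) \<xi> - ghat G \<xi>) \<le> C * real M powr ((1 + \<tau>) * b - 2) * W * (1 + cmod \<xi>) powr (-a)"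
    using ghat_kernel_diff_bound[OF \<tau> a(1) b(1,2)] by blast
  define good where "good j G M \<longleftrightarrow> 1 \<le> M \<and> j \<le> M \<and>
    (\<forall>\<xi>. cmod (ghat (\<lambda>x. G x * kernel \<tau> M x) \<xi> - ghat G \<xi>) \<le> (1/4) ^ Suc j * (1 + cmod \<xi>) powr (-a))" for j G M
  have ex: "\<exists>M. good j G M" if adm: "admissible G" for j G
  proof -
    obtain A W where G: "G \<in> borel_measurable borel" "\<And>x. 0 \<le> G x" "\<And>x. G x \<le> A" "rough_bound G W"
      using admissibleE[OF adm] by blast
    have A: "\<bar>G x\<bar> \<le> A" for x using G(2,3) by simp
    have "(\<lambda>M. C * real M powr ((1 + \<tau>) * b - 2) * W) \<longlonglongrightarrow> C * 0 * W"
      by (intro tendsto_intros tendsto_neg_powr b2 filterlim_real_sequentially)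
    then have "eventually (\<lambda>M. C * real M powr ((1 + \<tau>) * b - 2) * W < (1/4) ^ Suc j) sequentially"
      by (intro order_tendstoD(2)) auto
    then have "eventually (\<lambda>M. C * real M powr ((1 + \<tau>) * b - 2) * W < (1/4) ^ Suc j \<and> max 1 j \<le> M) sequentially"
      using eventually_ge_at_top by (rule eventually_conj)
    then obtain M where M: "C * real M powr ((1 + \<tau>) * b - 2) * W < (1/4) ^ Suc j" "max 1 j \<le> M"
      using eventually_happens'[OF sequentially_bot] by blast
    have "cmod (ghat (\<lambda>x. G x * kernel \<tau> M x) \<xi> - ghat G \<xi>) \<le> (1/4) ^ Suc j * (1 + cmod \<xi>) powr (-a)" for \<xi>
    proof -
      have "cmod (ghat (\<lambda>x. G x * kernel \<tau> M x) \<xi> - ghat G \<xi>) \<le> C * real M powr ((1 + \<tau>) * b - 2) * W * (1 + cmod \<xi>) powr (-a)"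
        using M(2) by (intro C(2)[OF _ G(1) A G(4)]) auto
      also have "\<dots> \<le> (1/4) ^ Suc j * (1 + cmod \<xi>) powr (-a)"
        using M(1) by (intro mult_right_mono) auto
      finally show ?thesis .
    qed
    then show ?thesis using M(2) by (auto simp: good_def)
  qed
  define pick where "pick j G = (SOME M. good j G M)" for j G
  have pick: "good j G (pick j G)" if "admissible G" for j G
    unfolding pick_def by (rule someI_ex) (rule ex[OF that])
  define G where "G = rec_nat (\<lambda>_. 1) (\<lambda>j g x. g x * kernel \<tau> (pick j g) x)"
  have G0: "G 0 = (\<lambda>_. 1)" and GS: "\<And>j. G (Suc j) = (\<lambda>x. G j x * kernel \<tau> (pick j (G j)) x)"
    by (simp_all add: G_def)
  have adm: "admissible (G j)" for j
  proof (induction j)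
    case (Suc j)
    have "1 \<le> pick j (G j)" using pick[OF Suc, of j] by (simp add: good_def)
    then show ?case unfolding GS by (rule admissible_kernel[OF \<tau> _ Suc])
  qed (simp add: G0 admissible_1)
  show ?thesis
  proof (rule that[of G "\<lambda>j. pick j (G j)"])
    show "cmod (ghat (G (Suc j)) \<xi> - ghat (G j) \<xi>) \<le> (1/4) ^ Suc j * (1 + cmod \<xi>) powr (-a)" for j \<xi>
      using pick[OF adm, of j j] unfolding good_def GS by blast
    show "1 \<le> pick j (G j)" "j \<le> pick j (G j)" for j using pick[OF adm, of j j] by (simp_all add: good_def)
  qed (fact G0 GS adm)+
qed

text \<open>For widths in [0, 1/2] the inequalities say that both coordinates of
  \<open>q * x\<close> are within the width of an integer. The cosine form makes closedness
  immediate and matches \<open>bump_periodic_eq_0\<close>.\<close>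

definition near_rationals :: "real \<Rightarrow> nat \<Rightarrow> complex set" where
  "near_rationals \<tau> M = {x. \<exists>q\<in>denominators M.
     cos (2 * pi * scale \<tau> M) \<le> cos (2 * pi * Re (q * x)) \<and> cos (2 * pi * scale \<tau> M) \<le> cos (2 * pi * Im (q * x))}"

lemma closed_near_rationals: "closed (near_rationals \<tau> M)"
proof -
  have "near_rationals \<tau> M = (\<Union>q\<in>denominators M. {x.
     cos (2 * pi * scale \<tau> M) \<le> cos (2 * pi * Re (q * x)) \<and> cos (2 * pi * scale \<tau> M) \<le> cos (2 * pi * Im (q * x))})"
    by (auto simp: near_rationals_def)
  also have "closed \<dots>"
    by (intro closed_UN finite_denominators ballI closed_Collect_conj closed_Collect_le continuous_intros)
  finally show ?thesis .
qed

lemma zero_in_near_rationals: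
  assumes "M \<ge> 1" shows "0 \<in> near_rationals \<tau> M"
proof -
  have "denominators M \<noteq> {}" using card_denominators[of M] assms by auto
  then show ?thesis by (auto simp: near_rationals_def)
qed

lemma kernel_eq_0:
  assumes "\<tau> \<ge> 1" "M \<ge> 1" "x \<notin> near_rationals \<tau> M"
  shows "kernel \<tau> M x = 0"
  unfolding kernel_def
proof -
  have "Re (bump_periodic (scale \<tau> M) (Re (q * x))) * Re (bump_periodic (scale \<tau> M) (Im (q * x))) = 0"
    if "q \<in> denominators M" for q
    using assms(3) that bump_periodic_eq_0[OF scale_bounds[OF assms(1,2)]]
    by (auto simp: near_rationals_def not_le)
  then show "(\<Sum>q\<in>denominators M. Re (bump_periodic (scale \<tau> M) (Re (q * x))) * Re (bump_periodic (scale \<tau> M) (Im (q * x)))) / (real M)\<^sup>2 = 0"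
    by (simp only: sum.neutral[OF ballI] div_0)
qed

lemma near_integer:
  assumes "0 \<le> \<delta>" "\<delta> \<le> 1/2" "cos (2 * pi * \<delta>) \<le> cos (2 * pi * y)"
  shows "\<bar>y - of_int (round y)\<bar> \<le> \<delta>"
proof (rule ccontr)
  define u where "u = \<bar>y - of_int (round y)\<bar>"
  assume "\<not> ?thesis"
  then have u: "\<delta> < u" "u \<le> 1/2" using of_int_round_abs_le[of y] by (auto simp: u_def abs_minus_commute)
  have "cos (2 * pi * u) = cos (2 * pi * (y - of_int (round y)))"
    unfolding u_def by (metis abs_mult abs_of_nonneg cos_abs_real mult_nonneg_nonneg pi_ge_zero zero_le_numeral)
  also have "\<dots> = cos (2 * pi * y)" by (simp add: right_diff_distrib cos_diff)
  finally have "cos (2 * pi * u) = cos (2 * pi * y)" .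
  moreover have "cos (2 * pi * u) < cos (2 * pi * \<delta>)"
    using u assms(1) by (intro cos_monotone_0_pi) auto
  ultimately show False using assms(3) by simp
qed

text \<open>Every \<open>j\<close> supplies a pair with \<open>supnorm q \<ge> j\<close>, so the
  denominators are unbounded and the pairs infinite in number. The tolerance is admissible because
  \<open>supnorm q\<close> is at most \<open>2 * N j\<close>.\<close>

lemma near_rationals_subset_E_star:
  assumes \<tau>: "\<tau> \<ge> 1" and N: "\<And>j. 1 \<le> N j" "\<And>j. j \<le> N j"
  shows "(\<Inter>j. near_rationals \<tau> (N j)) \<subseteq> E_star \<tau>"
proof
  fix x assume x: "x \<in> (\<Inter>j. near_rationals \<tau> (N j))"
  let ?A = "{(q, r). q \<in> gauss_ints \<and> r \<in> gauss_ints \<and> q \<noteq> 0 \<and> supnorm (q * x - r) \<le> supnorm q powr (- \<tau>)}"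
  have ex: "\<exists>q r. (q, r) \<in> ?A \<and> real j \<le> supnorm q" for j
  proof -
    have M: "1 \<le> N j" by (rule N)
    note sc = scale_bounds[OF \<tau> M]
    obtain q where q: "q \<in> denominators (N j)"
      "cos (2 * pi * scale \<tau> (N j)) \<le> cos (2 * pi * Re (q * x))" "cos (2 * pi * scale \<tau> (N j)) \<le> cos (2 * pi * Im (q * x))"
      using x by (auto simp: near_rationals_def)
    define r where "r = Complex (of_int (round (Re (q * x)))) (of_int (round (Im (q * x))))"
    have "supnorm (q * x - r) \<le> scale \<tau> (N j)"
      unfolding supnorm_def r_def minus_complex.simps complex.sel
      using near_integer[OF _ sc(2) q(2)] near_integer[OF _ sc(2) q(3)] sc(1) by (intro max.boundedI) auto
    also have "\<dots> \<le> supnorm q powr (-\<tau>)"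
      unfolding scale_def using denominators_props[OF q(1)] M \<tau> by (intro powr_mono2') auto
    finally have "(q, r) \<in> ?A" using denominators_props(1,2)[OF q(1)] by (simp add: r_def gauss_ints_def)
    moreover have "real j \<le> supnorm q" using denominators_props(3)[OF q(1)] N(2)[of j] by linarith
    ultimately show ?thesis by blast
  qed
  have "infinite ?A"
  proof
    assume "finite ?A"
    then have fin: "finite ((\<lambda>p. supnorm (fst p)) ` ?A)" by simp
    obtain j :: nat where j: "Max ((\<lambda>p. supnorm (fst p)) ` ?A) < real j" using reals_Archimedean2 by blast
    obtain q r where qr: "(q, r) \<in> ?A" "real j \<le> supnorm q" using ex by blast
    have "supnorm q \<in> (\<lambda>p. supnorm (fst p)) ` ?A" by (rule rev_image_eqI[OF qr(1)]) simp
    then have "supnorm q \<le> Max ((\<lambda>p. supnorm (fst p)) ` ?A)" by (rule Max_ge[OF fin])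
    then show False using j qr(2) by linarith
  qed
  then show "x \<in> E_star \<tau>" by (simp add: E_star_def)
qed

text \<open>The truncated distance to \<open>E\<close> is a bounded continuous test function whose
  integrals vanish from some index on, hence also in the limit. Its zero set is \<open>E\<close>
  because \<open>E\<close> is closed and nonempty; \<open>infdist\<close> to the empty set would be
  0 everywhere.\<close>

lemma weak_limit_closed_support:
  fixes M :: "complex measure"
  assumes M: "prob_space M" "sets M = sets borel"
    and lim: "\<And>(f :: complex \<Rightarrow> complex) B. continuous_on UNIV f \<Longrightarrow> (\<And>x. cmod (f x) \<le> B) \<Longrightarrow>
        (\<lambda>n. LINT x|\<mu> n. f x) \<longlonglongrightarrow> (LINT x|M. f x)"
    and E: "closed E" "E \<noteq> {}" "eventually (\<lambda>n. AE x in \<mu> n. x \<in> E) sequentially"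
  shows "measure_support M \<subseteq> E"
proof -
  interpret prob_space M by fact
  define f where "f x = min 1 (infdist x E)" for x
  have f: "continuous_on UNIV f" "\<And>x. 0 \<le> f x" "\<And>x. f x \<le> 1"
    unfolding f_def by (auto intro!: continuous_intros simp: infdist_nonneg)
  have fm: "f \<in> borel_measurable M"
    unfolding measurable_cong_sets[OF M(2) refl] by (rule borel_measurable_continuous_onI[OF f(1)])
  have conv: "(\<lambda>n. LINT x|\<mu> n. complex_of_real (f x)) \<longlonglongrightarrow> (LINT x|M. complex_of_real (f x))"
    using f by (intro lim[of _ 1] continuous_on_of_real) auto
  have ev: "eventually (\<lambda>n. (LINT x|\<mu> n. complex_of_real (f x)) = 0) sequentially"
    using E(3)
  proof eventually_elim
    case (elim n)
    have "AE x in \<mu> n. complex_of_real (f x) = 0"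
      using elim by eventually_elim (simp add: f_def)
    then show ?case by (rule integral_eq_zero_AE)
  qed
  have "(LINT x|M. complex_of_real (f x)) = 0"
    by (rule LIMSEQ_unique[OF conv tendsto_eventually[OF ev]])
  then have "(LINT x|M. f x) = 0" by simp
  moreover have "integrable M f"
    by (rule prob_space_integrable_bounded[OF M(1) fm, where B = 1]) (use f in auto)
  ultimately have "AE x in M. f x = 0"
    using integral_nonneg_eq_0_iff_AE[of M f] f(2) by auto
  then have AE: "AE x in M. x \<in> E"
    by eventually_elim (use E in \<open>auto simp: f_def min_def in_closed_iff_infdist_zero split: if_splits\<close>)
  show ?thesis
  proof (rule ccontr)
    assume "\<not> ?thesis"
    then obtain x where x: "x \<in> measure_support M" "x \<in> - E" by auto
    then obtain e where e: "e > 0" "ball x e \<subseteq> - E"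
      using E(1) open_contains_ball[of "- E"] by (auto simp: open_Compl)
    have out: "AE y in M. y \<notin> ball x e" using AE by eventually_elim (use e in auto)
    have "ball x e \<in> sets M" using M(2) by simp
    then have "ball x e \<in> null_sets M" using out by (simp only: AE_iff_null_sets)
    then have "emeasure M (ball x e) = 0" by (rule null_setsD1)
    then show False using x(1) e(1) by (auto simp: measure_support_def)
  qed
qed

text \<open>The exponent is \<open>2 * a\<close> because \<open>fourier_dim\<close> measures the
  square of the transform; the hypothesis on \<open>a\<close> amounts to 2a < 4/(1+\<tau>).\<close>

lemma exists_salem_measure:
  assumes \<tau>: "\<tau> \<ge> 1" and a: "0 \<le> a" "a * (1 + \<tau>) < 2"
  shows "\<exists>M \<in> compact_prob_measures (E_star \<tau>). \<exists>C. \<forall>\<xi>. \<xi> \<noteq> 0 \<longrightarrow>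
          (cmod (fourier_transform M \<xi>))\<^sup>2 * supnorm \<xi> powr (2 * a) \<le> C"
proof -
  let ?w = "\<lambda>\<xi>. (1 + cmod \<xi>) powr (-a)"
  obtain G N where G0: "G 0 = (\<lambda>_. 1)" and GS: "\<And>j. G (Suc j) = (\<lambda>x. G j x * kernel \<tau> (N j) x)"
    and N: "\<And>j. 1 \<le> N j" "\<And>j. j \<le> N j" and adm: "\<And>j. admissible (G j)"
    and diff: "\<And>j \<xi>. cmod (ghat (G (Suc j)) \<xi> - ghat (G j) \<xi>) \<le> (1/4) ^ Suc j * ?w \<xi>"
    by (rule ghat_sequence[OF \<tau> a]) (rule that; assumption)
  have Gm [measurable]: "G j \<in> borel_measurable borel" for j using adm[of j] by (simp add: admissible_def)
  have Gn: "0 \<le> G j x" for j x using adm[of j] by (simp add: admissible_def)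
  have Gmb: "G j \<in> borel_measurable base" for j
    unfolding measurable_cong_sets[OF sets_plane_measure refl] by (rule Gm)
  have Gint: "integrable base (G j)" for j
  proof -
    obtain B where "\<And>x. G j x \<le> B" using adm[of j] by (auto simp: admissible_def)
    then show ?thesis
      by (intro prob_space_integrable_bounded[OF prob_space_base Gmb, where B = B]) (use Gn in auto)
  qed
  have acc: "cmod (ghat (G j) \<xi> - ghat (G 0) \<xi>) \<le> (1/3) * ?w \<xi>" for j \<xi>
  proof -
    \<comment> \<open>The partial sums of 1/4 + 1/16 + ... in closed form.\<close>
    have "cmod (ghat (G j) \<xi> - ghat (G 0) \<xi>) \<le> (1/3 - (1/3) * (1/4) ^ j) * ?w \<xi>"
    proof (induction j)
      case (Suc j)
      have "cmod (ghat (G (Suc j)) \<xi> - ghat (G 0) \<xi>) \<le>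
         cmod (ghat (G (Suc j)) \<xi> - ghat (G j) \<xi>) + cmod (ghat (G j) \<xi> - ghat (G 0) \<xi>)"
        using norm_triangle_ineq[of "ghat (G (Suc j)) \<xi> - ghat (G j) \<xi>" "ghat (G j) \<xi> - ghat (G 0) \<xi>"] by simp
      also have "\<dots> \<le> (1/4) ^ Suc j * ?w \<xi> + (1/3 - (1/3) * (1/4) ^ j) * ?w \<xi>"
        by (intro add_mono diff Suc)
      also have "\<dots> = (1/3 - (1/3) * (1/4) ^ Suc j) * ?w \<xi>" by (simp add: algebra_simps)
      finally show ?case .
    qed simp
    also have "\<dots> \<le> (1/3) * ?w \<xi>" by (intro mult_right_mono) auto
    finally show ?thesis .
  qed
  obtain W where W: "rough_bound (G 0) W" using adm[of 0] by (auto simp: admissible_def)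
  \<comment> \<open>The single term \<open>k = 0\<close> of \<open>rough_bound\<close> already gives
    decay of order 1, and \<open>a \<le> 1\<close>.\<close>
  have decay0: "cmod (ghat (G 0) \<xi>) \<le> W * ?w \<xi>" for \<xi>
  proof -
    have W0: "0 \<le> W" by (rule rough_bound_nonneg[OF W])
    have "cmod (ghat (G 0) \<xi>) * (1 + cmod \<xi>) \<le> W"
      using W[unfolded rough_bound_def, rule_format, of "{0}" \<xi>] by simp
    then have "cmod (ghat (G 0) \<xi>) \<le> W * (1 + cmod \<xi>) powr (-1)"
      by (simp add: powr_minus field_simps add_pos_nonneg)
    also have "\<dots> \<le> W * ?w \<xi>"
    proof -
      have "a * 1 \<le> a * (1 + \<tau>) / 2 * 1" using a \<tau> by (simp add: mult_left_mono)
      then have "a \<le> 1" using a(2) by linarith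
      then show ?thesis using W0 by (intro mult_left_mono powr_mono) auto
    qed
    finally show ?thesis .
  qed
  have decay: "cmod (ghat (G j) \<xi>) \<le> (W + 1/3) * ?w \<xi>" for j \<xi>
    using acc[of j \<xi>] decay0[of \<xi>] norm_triangle_ineq[of "ghat (G j) \<xi> - ghat (G 0) \<xi>" "ghat (G 0) \<xi>"]
    by (simp add: distrib_right)
  define m where "m j = (LINT x|base. G j x)" for j
  have ghat0: "ghat (G j) 0 = of_real (m j)" for j
    unfolding ghat_def m_def by (simp add: Gint)
  \<comment> \<open>At frequency 0 the weight is 1 and the total change of the mass is at most 1/3,
    so the normalization in \<open>\<mu>\<close> costs at most the factor 3/2.\<close>
  have m: "2/3 \<le> m j" for j
  proof -
    interpret prob_space base by (rule prob_space_base)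
    have "m 0 = 1" by (simp add: m_def G0 prob_space)
    moreover have "\<bar>m j - m 0\<bar> \<le> (1/3) * (1 + cmod 0) powr (-a)"
      using acc[of j 0] unfolding ghat0 of_real_diff[symmetric] norm_of_real .
    ultimately have "\<bar>m j - 1\<bar> \<le> 1/3" by simp
    then show ?thesis by linarith
  qed
  define \<mu> where "\<mu> j = density base (\<lambda>x. ennreal (G j x / m j))" for j
  have m0: "0 < m j" for j using m[of j] by linarith
  have dens: "(\<lambda>x. ennreal (G j x / m j)) \<in> borel_measurable base" for j
    using Gmb by measurable
  have prob: "prob_space (\<mu> j)" for j
  proof
    have "emeasure (\<mu> j) (space (\<mu> j)) = (\<integral>\<^sup>+x. ennreal (G j x / m j) \<partial>base)"
      unfolding \<mu>_def space_density by (subst emeasure_density[OF dens sets.top]) (auto intro!: nn_integral_cong)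
    also have "\<dots> = ennreal (LINT x|base. G j x / m j)"
      using Gint Gn m0[of j] by (intro nn_integral_eq_integral) auto
    also have "(LINT x|base. G j x / m j) = 1" using m0[of j] by (simp add: m_def)
    finally show "emeasure (\<mu> j) (space (\<mu> j)) = 1" by simp
  qed
  have sets: "sets (\<mu> j) = sets borel" for j by (simp add: \<mu>_def)
  have supp: "AE x in \<mu> j. supnorm x \<le> 1/2" for j
    unfolding \<mu>_def AE_density[OF dens] using AE_base by eventually_elim simp
  have ft: "fourier_transform (\<mu> j) \<xi> = ghat (G j) \<xi> / of_real (m j)" for j \<xi>
  proof -
    have wm: "wave \<xi> \<in> borel_measurable base"
      unfolding measurable_cong_sets[OF sets_plane_measure refl] by measurable
    have "fourier_transform (\<mu> j) \<xi> = (LINT x|base. (G j x / m j) *\<^sub>R wave \<xi> x)"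
      unfolding fourier_transform_def \<mu>_def
      using Gmb[of j] Gn m0[of j] by (intro integral_density wm) auto
    also have "\<dots> = (LINT x|base. of_real (G j x) * wave \<xi> x / of_real (m j))"
      by (intro Bochner_Integration.integral_cong) (auto simp: scaleR_conv_of_real)
    also have "\<dots> = ghat (G j) \<xi> / of_real (m j)" unfolding ghat_def by (rule integral_divide_zero)
    finally show ?thesis .
  qed
  obtain r M where r: "strict_mono (r :: nat \<Rightarrow> nat)" and M: "prob_space M" "sets M = sets borel"
    and lim: "\<And>(f :: complex \<Rightarrow> complex) B. continuous_on UNIV f \<Longrightarrow> (\<And>x. cmod (f x) \<le> B) \<Longrightarrow>
        (\<lambda>n. LINT x|\<mu> (r n). f x) \<longlonglongrightarrow> (LINT x|M. f x)"
  proof (rule weak_limit_in_plane[of \<mu>, OF prob sets supp])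
    fix r M
    assume "strict_mono (r :: nat \<Rightarrow> nat)" "prob_space M" "sets M = sets borel"
      "\<And>(f :: complex \<Rightarrow> complex) B. continuous_on UNIV f \<Longrightarrow> (\<And>x. cmod (f x) \<le> B) \<Longrightarrow>
        (\<lambda>n. LINT x|\<mu> (r n). f x) \<longlonglongrightarrow> (LINT x|M. f x)"
    then show thesis by (rule that)
  qed
  define C where "C = (W + 1/3) * (3/2)"
  have C0: "0 \<le> C" using rough_bound_nonneg[OF W] by (simp add: C_def)
  have ftM: "cmod (fourier_transform M \<xi>) \<le> C * ?w \<xi>" for \<xi>
  proof -
    have "(\<lambda>n. fourier_transform (\<mu> (r n)) \<xi>) \<longlonglongrightarrow> fourier_transform M \<xi>"
      unfolding fourier_transform_def
      by (rule lim[where B = 1]) (auto simp: cis_conv_exp intro!: continuous_intros)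
    then have "(\<lambda>n. cmod (fourier_transform (\<mu> (r n)) \<xi>)) \<longlonglongrightarrow> cmod (fourier_transform M \<xi>)"
      by (rule tendsto_norm)
    moreover have "cmod (fourier_transform (\<mu> j) \<xi>) \<le> C * ?w \<xi>" for j
    proof -
      have "cmod (fourier_transform (\<mu> j) \<xi>) = cmod (ghat (G j) \<xi>) / m j"
        using m0[of j] by (simp add: ft norm_divide)
      also have "\<dots> \<le> ((W + 1/3) * ?w \<xi>) / (2/3)"
        using decay[of j \<xi>] m[of j] rough_bound_nonneg[OF W] by (intro frac_le) auto
      finally show ?thesis by (simp add: C_def field_simps)
    qed
    ultimately show ?thesis by (intro LIMSEQ_le_const2[of _ "cmod (fourier_transform M \<xi>)"]) auto
  qed
  have sub1: "measure_support M \<subseteq> {x. supnorm x \<le> 1/2}"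
  proof (rule weak_limit_closed_support[OF M lim])
    show "closed {x. supnorm x \<le> 1/2}"
      unfolding supnorm_def by (intro closed_Collect_le continuous_intros)
    show "{x. supnorm x \<le> 1/2} \<noteq> {}" using supnorm_0 by (auto intro!: exI[of _ 0])
    show "eventually (\<lambda>n. AE x in \<mu> (r n). x \<in> {x. supnorm x \<le> 1/2}) sequentially" using supp by simp
  qed
  have sub2: "measure_support M \<subseteq> near_rationals \<tau> (N j)" for j
  proof (rule weak_limit_closed_support[OF M lim closed_near_rationals])
    show "near_rationals \<tau> (N j) \<noteq> {}" using zero_in_near_rationals[OF N(1)] by blast
    \<comment> \<open>Later factors cannot undo a zero of an earlier kernel, so from stage
      \<open>Suc j\<close> on all measures live on the closed set of stage \<open>j\<close>, and the
      limit inherits every one of these sets.\<close>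
    have vanish: "G i x = 0" if "Suc j \<le> i" "x \<notin> near_rationals \<tau> (N j)" for i x
      using that(1)
    proof (induction i rule: dec_induct)
      case base
      show ?case unfolding GS by (simp add: kernel_eq_0[OF \<tau> N(1) that(2)])
    next
      case (step i)
      then show ?case unfolding GS by simp
    qed
    have "AE x in \<mu> i. x \<in> near_rationals \<tau> (N j)" if "Suc j \<le> i" for i
      unfolding \<mu>_def AE_density[OF dens]
    proof (intro AE_I2 impI, rule ccontr)
      fix x assume "0 < ennreal (G i x / m i)" "x \<notin> near_rationals \<tau> (N j)"
      then show False using vanish[OF that, of x] by simp
    qed
    moreover have "eventually (\<lambda>n. Suc j \<le> r n) sequentially"
      using filterlim_subseq[OF r] by (simp add: filterlim_at_top)
    ultimately show "eventually (\<lambda>n. AE x in \<mu> (r n). x \<in> near_rationals \<tau> (N j)) sequentially"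
      by (auto elim: eventually_mono)
  qed
  have "measure_support M \<subseteq> E_star \<tau>"
    using sub2 near_rationals_subset_E_star[OF \<tau> N] by blast
  moreover have "compact (measure_support M)"
  proof -
    have "closed (measure_support M)" using open_Compl_measure_support[OF M(2)] by (simp add: closed_def)
    moreover have "bounded (measure_support M)"
    proof (rule boundedI)
      fix x assume "x \<in> measure_support M"
      then show "norm x \<le> 1" using sub1 cmod_le_2_supnorm[of x] by force
    qed
    ultimately show ?thesis by (simp add: compact_eq_bounded_closed)
  qed
  ultimately have "M \<in> compact_prob_measures (E_star \<tau>)" using M by (simp add: compact_prob_measures_def)
  moreover have "(cmod (fourier_transform M \<xi>))\<^sup>2 * supnorm \<xi> powr (2 * a) \<le> C\<^sup>2" for \<xi>
  proof -
    have "(cmod (fourier_transform M \<xi>))\<^sup>2 * supnorm \<xi> powr (2 * a) \<le> (C * ?w \<xi>)\<^sup>2 * (1 + cmod \<xi>) powr (2 * a)"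
      using ftM a supnorm_le_cmod[of \<xi>] by (intro mult_mono power_mono powr_mono2) auto
    also have "\<dots> = C\<^sup>2 * (?w \<xi> * ?w \<xi> * (1 + cmod \<xi>) powr (2 * a))"
      by (simp only: power2_eq_square mult_ac)
    also have "\<dots> = C\<^sup>2" by (simp add: add_nonneg_eq_0_iff flip: powr_add)
    finally show ?thesis .
  qed
  ultimately show ?thesis by blast
qed

lemma E_star_antimono:
  assumes "\<tau> \<le> \<sigma>" shows "E_star \<sigma> \<subseteq> E_star \<tau>"
proof
  fix x assume "x \<in> E_star \<sigma>"
  then have inf: "infinite {(q, r). q \<in> gauss_ints \<and> r \<in> gauss_ints \<and> q \<noteq> 0 \<and> supnorm (q * x - r) \<le> supnorm q powr (- \<sigma>)}"
    by (simp add: E_star_def)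
  have "supnorm q powr (-\<sigma>) \<le> supnorm q powr (-\<tau>)" if "q \<in> gauss_ints" "q \<noteq> 0" for q
    using gauss_supnorm_ge_1[OF that] assms by (intro powr_mono) auto
  then have "{(q, r). q \<in> gauss_ints \<and> r \<in> gauss_ints \<and> q \<noteq> 0 \<and> supnorm (q * x - r) \<le> supnorm q powr (- \<sigma>)} \<subseteq>
     {(q, r). q \<in> gauss_ints \<and> r \<in> gauss_ints \<and> q \<noteq> 0 \<and> supnorm (q * x - r) \<le> supnorm q powr (- \<tau>)}"
    by (auto intro: order_trans)
  then show "x \<in> E_star \<tau>" using inf by (auto simp: E_star_def dest: finite_subset)
qed

theorem theorem2:
  fixes \<tau> :: real
  assumes "\<tau> > -1"
  shows "salem_set (E_star \<tau>) \<and>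
         hausdorff_dim (E_star \<tau>) = min (4 / (1 + \<tau>)) 2 \<and>
         fourier_dim (E_star \<tau>) = min (4 / (1 + \<tau>)) 2"
proof -
  define d where "d = min (4 / (1 + \<tau>)) 2"
  define X where "X = {s. 0 \<le> s \<and> s \<le> 2 \<and>
      (\<exists>M \<in> compact_prob_measures (E_star \<tau>). \<exists>C. \<forall>\<xi>. \<xi> \<noteq> 0 \<longrightarrow>
          (cmod (fourier_transform M \<xi>))\<^sup>2 * supnorm \<xi> powr s \<le> C)}"
  have d0: "0 < d" using assms by (auto simp: d_def)
  have mem: "s \<in> X" if s: "0 \<le> s" "s < d" for s
  proof -
    \<comment> \<open>For \<tau> <= 1 the target \<open>d\<close> is 2, which the case of exponent 1
      already approaches, and \<open>E_star\<close> shrinks as the exponent grows.\<close>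
    define \<sigma> where "\<sigma> = max \<tau> 1"
    have "1 + \<sigma> = max (1 + \<tau>) 2" by (simp add: \<sigma>_def max_def)
    have "s * (1 + \<sigma>) < 4"
    proof (cases "\<tau> \<le> 1")
      case True
      then show ?thesis using s by (simp add: \<sigma>_def d_def max_def)
    next
      case False
      have "s < 4 / (1 + \<tau>)" using s by (simp add: d_def)
      then show ?thesis using False by (simp add: \<sigma>_def max_def field_simps)
    qed
    then have "s / 2 * (1 + \<sigma>) < 2" by simp
    moreover have "1 \<le> \<sigma>" by (simp add: \<sigma>_def)
    ultimately obtain M C where MC: "M \<in> compact_prob_measures (E_star \<sigma>)"
       "\<And>\<xi>. \<xi> \<noteq> 0 \<Longrightarrow> (cmod (fourier_transform M \<xi>))\<^sup>2 * supnorm \<xi> powr s \<le> C"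
      using exists_salem_measure[of \<sigma> "s / 2"] s by auto
    have "M \<in> compact_prob_measures (E_star \<tau>)"
      using MC(1) E_star_antimono[of \<tau> \<sigma>] by (auto simp: compact_prob_measures_def \<sigma>_def)
    then show ?thesis using MC(2) s by (auto simp: X_def d_def)
  qed
  have upper: "hausdorff_dim (E_star \<tau>) \<le> d" unfolding d_def by (rule hausdorff_dim_E_star_le[OF assms])
  have F: "fourier_dim (E_star \<tau>) = Sup X" by (simp add: fourier_dim_def X_def)
  \<comment> \<open>Together with \<open>upper\<close> and the lower bound proved next, this closes
    the chain from \<open>d\<close> through \<open>fourier_dim\<close> and
    \<open>hausdorff_dim\<close> back to \<open>d\<close>.\<close>
  have "fourier_dim (E_star \<tau>) \<le> hausdorff_dim (E_star \<tau>)"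
    unfolding F
  proof (rule cSup_least)
    show "X \<noteq> {}" using mem[of 0] d0 by auto
    show "s \<le> hausdorff_dim (E_star \<tau>)" if "s \<in> X" for s
      using that fourier_dim_exponent_le_hausdorff_dim[of _ "E_star \<tau>" s] by (auto simp: X_def)
  qed
  moreover have "d \<le> fourier_dim (E_star \<tau>)"
  proof (rule dense_le_bounded[OF d0])
    fix s assume "0 < s" "s < d"
    then have "s \<in> X" using mem by simp
    then show "s \<le> fourier_dim (E_star \<tau>)"
      unfolding F by (rule cSup_upper) (auto simp: X_def intro: bdd_aboveI[of _ 2])
  qed
  ultimately show ?thesis using upper unfolding salem_set_def d_def[symmetric] by linarith
qed

end
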